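(* Let $R\in\mathcal E(\Omega)$. Then the following conditions are equivalent (in each, the expressions $R(S_\varepsilon\cdot,x)$ are required to be defined for the $\varepsilon$, $x$ considered): (A) $\forall K\subset\subset\Omega\ \forall\alpha\in\mathbb N_0^s\ \exists N\in\mathbb N\ \forall$ bounded $\mathcal B\subseteq C^\infty(\Omega,\mathcal A_0(\mathbb R^s))\ \exists C,\eta>0\ \forall\phi\in\mathcal B\ \forall\varepsilon\in(0,\eta)\ \forall x\in K$: $|\partial^\alpha_x(R(S_\varepsilon\phi(x),x))|\le C\varepsilon^{-N}$. (B) $\forall K\ \forall\alpha\ \exists N\ \forall\phi\in C^{[\infty,\Omega]}_b(I\times\Omega,\mathcal A_0(\mathbb R^s))\ \exists C,\eta>0\ \forall\varepsilon\in(0,\eta)\ \forall x\in K$: $|\partial^\alpha_x(R(S_\varepsilon\phi(\varepsilon,x),x))|\le C\varepsilon^{-N}$. (C) as (B), but with $\phi$ ranging over $\mathcal C^\infty_b(I\times\Omega,\mathcal A_0(\mathbb R^s))$ (i.e. $R$ is moderate). (D) as (C), but only for those $\phi\in\mathcal C^\infty_b(I\times\Omega,\mathcal A_0(\mathbb R^s))$ with $(\phi(\varepsilon,x),x)\in U_\delta(\Omega)$ for all $\varepsilon,\delta\in I$ and $x\in K$. (E) as (C), but only for those $\phi\in\mathcal C^\infty_b(I\times\Omega,\mathcal A_0(\mathbb R^s))$ such that for every compact $L\subseteq\Omega$ there is $\delta_0>0$ with $(\phi(\varepsilon,x),x)\in U_\delta(\Omega)$ for all $(\varepsilon,x)\in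 I\times L$, $0<\delta\le\delta_0$. (Z) $\forall K\ \forall\alpha\ \exists N$ such that for every $D\subseteq I\times\Omega$ and $\phi:D\to\mathcal A_0(\mathbb R^s)$ satisfying [for each compact $L\subseteq\Omega$ there are $\varepsilon_0>0$ and $U\subseteq D$ open in $I\times\Omega$ with $(0,\varepsilon_0]\times L\subseteq U$, $\phi$ smooth on $U$, and $\{\partial_x^\beta\phi(\varepsilon,x):0<\varepsilon\le\varepsilon_0,x\in L\}$ bounded in $\mathcal D(\mathbb R^s)$ for all $\beta$] there exist $C,\eta>0$ such that for all $\varepsilon\in(0,\eta)$, $x\in K$: $(\varepsilon,x)\in D$ and $|\partial^\alpha_x(R(S_\varepsilon\phi(\varepsilon,x),x))|\le C\varepsilon^{-N}$.
   Context: $\Omega\subseteq\mathbb R^s$ open, $I=(0,1]$, $K\subset\subset\Omega$ means $K$ compact in $\Omega$. $\mathcal D(\mathbb R^s),\mathcal D(\Omega)$ carry their (LF)-topologies; $\mathcal A_0(\mathbb R^s)=\{\varphi\in\mathcal D(\mathbb R^s):\int\varphi=1\}$, $\mathcal A_0(\Omega)=\mathcal A_0(\mathbb R^s)\cap\mathcal D(\Omega)$. $(S_\varepsilon\varphi)(\xi)=\varepsilon^{-s}\varphi(\xi/\varepsilon)$, $T(\varphi,x)=(\varphi(\cdot-x),x)$. Smoothness is in the convenient sense. $U(\Omega)=\{(\varphi,x)\in\mathcal A_0(\mathbb R^s)\times\Omega:\operatorname{supp}\varphi\subseteq\Omega-x\}$ with topology and smooth structure transported from $\mathcal A_0(\Omega)\times\Omega$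 via $T$; $\mathcal E(\Omega)$ is the algebra of smooth maps $U(\Omega)\to\mathbb C$. $U_\delta(\Omega)=\{(\varphi,x)\in\mathcal A_0(\mathbb R^s)\times\Omega:\operatorname{supp}\varphi\subseteq\delta^{-1}(\Omega-x)\}$. A set $\mathcal B\subseteq C^\infty(\Omega,\mathcal A_0(\mathbb R^s))$ is bounded if for all $K\subset\subset\Omega$ and $\alpha$, $\{\partial^\alpha\phi(x):\phi\in\mathcal B,x\in K\}$ is bounded in $\mathcal D(\mathbb R^s)$. $C^{[\infty,\Omega]}_b(I\times\Omega,\mathcal A_0(\mathbb R^s))$: maps $\phi:I\times\Omega\to\mathcal A_0(\mathbb R^s)$, smooth in $x$ for each fixed $\varepsilon$ (no regularity in $\varepsilon$), such that $\{\partial_x^\alpha\phi(\varepsilon,x):\varepsilon\in I,x\in K\}$ is bounded in $\mathcal D(\mathbb R^s)$ for all $K\subset\subset\Omega$, $\alpha$. $\mathcal C^\infty_b(I\times\Omega,\mathcal A_0(\mathbb R^s))$: those elements of the latter which are smooth jointly in $(\varepsilon,x)$. *)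

theory Defs
  imports "HOL-Analysis.Analysis"
begin

text \<open>Partial (directional) derivative along a vector b, and iterated partial
  derivatives along a list of basis vectors (a multi-index is represented by the
  list of coordinate directions in which one differentiates).\<close>

definition pd :: "'a::real_normed_vector \<Rightarrow> ('a \<Rightarrow> 'b::real_normed_vector) \<Rightarrow> 'a \<Rightarrow> 'b" where
  "pd b f x = vector_derivative (\<lambda>t::real. f (x + t *\<^sub>R b)) (at 0)"

fun pdl :: "'a::real_normed_vector list \<Rightarrow> ('a \<Rightarrow> 'b::real_normed_vector) \<Rightarrow> 'a \<Rightarrow> 'b" where
  "pdl [] f = f"
| "pdl (b # bs) f = pd b (pdl bs f)"

definition C_inf_on :: "'a::euclidean_space set \<Rightarrow> ('a \<Rightarrow> 'b::real_normed_vector) \<Rightarrow> bool" where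
  "C_inf_on S f \<longleftrightarrow> open S \<and>
     (\<forall>bs. set bs \<subseteq> Basis \<longrightarrow>
        continuous_on S (pdl bs f) \<and>
        (\<forall>b\<in>Basis. \<forall>x\<in>S. (\<lambda>t::real. pdl bs f (x + t *\<^sub>R b)) differentiable (at 0)))"

definition supp :: "('a::real_normed_vector \<Rightarrow> complex) \<Rightarrow> 'a set" where
  "supp f = closure {x. f x \<noteq> 0}"

definition test_fun :: "('a::euclidean_space \<Rightarrow> complex) \<Rightarrow> bool" where
  "test_fun f \<longleftrightarrow> C_inf_on UNIV f \<and> compact (supp f)"

definition A0 :: "('a::euclidean_space \<Rightarrow> complex) \<Rightarrow> bool" where
  "A0 f \<longleftrightarrow> test_fun f \<and> integral UNIV f = 1"

definition Dbounded :: "('a::euclidean_space \<Rightarrow> complex) set \<Rightarrow> bool" where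
  "Dbounded A \<longleftrightarrow> (\<forall>f\<in>A. test_fun f) \<and>
     (\<exists>K. compact K \<and> (\<forall>f\<in>A. supp f \<subseteq> K)) \<and>
     (\<forall>bs. set bs \<subseteq> Basis \<longrightarrow> (\<exists>M. \<forall>f\<in>A. \<forall>\<xi>. norm (pdl bs f \<xi>) \<le> M))"

text \<open>Smooth curves R -> D(X), X open (Kriegl--Michor description of smooth
  curves into the LF-space D(X)): locally the supports lie in a fixed compact
  subset of X and the curve is jointly smooth in (t, xi).\<close>
definition Dcurve :: "'a::euclidean_space set \<Rightarrow> (real \<Rightarrow> 'a \<Rightarrow> complex) \<Rightarrow> bool" where
  "Dcurve X c \<longleftrightarrow>
     (\<forall>a b. \<exists>K. compact K \<and> K \<subseteq> X \<and> (\<forall>t\<in>{a..b}. supp (c t) \<subseteq> K)) \<and>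
     C_inf_on UNIV (\<lambda>p::real \<times> 'a. c (fst p) (snd p))"

text \<open>Convenient smoothness of a map from an open set W of a finite-dimensional
  space into D(X): it maps smooth curves in W to smooth curves in D(X).\<close>
definition smoothD :: "'b::euclidean_space set \<Rightarrow> 'a::euclidean_space set
     \<Rightarrow> ('b \<Rightarrow> 'a \<Rightarrow> complex) \<Rightarrow> bool" where
  "smoothD W X f \<longleftrightarrow> open W \<and>
     (\<forall>c::real \<Rightarrow> 'b. C_inf_on UNIV c \<and> (\<forall>t. c t \<in> W) \<longrightarrow> Dcurve X (f \<circ> c))"

definition smooth_on_set :: "'b::euclidean_space set \<Rightarrow> ('b \<Rightarrow> 'a::euclidean_space \<Rightarrow> complex) \<Rightarrow> bool" where
  "smooth_on_set S f \<longleftrightarrow> (\<exists>W \<psi>. S \<subseteq> W \<and> smoothD W UNIV \<psi> \<and> (\<forall>p\<in>S. \<psi> p = f p))"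

definition Seps :: "real \<Rightarrow> ('a::euclidean_space \<Rightarrow> complex) \<Rightarrow> 'a \<Rightarrow> complex" where
  "Seps \<epsilon> f = (\<lambda>\<xi>. complex_of_real (inverse (\<epsilon> ^ DIM('a))) * f (inverse \<epsilon> *\<^sub>R \<xi>))"

definition inU :: "'a::euclidean_space set \<Rightarrow> ('a \<Rightarrow> complex) \<times> 'a \<Rightarrow> bool" where
  "inU \<Omega> p \<longleftrightarrow> A0 (fst p) \<and> snd p \<in> \<Omega> \<and> supp (fst p) \<subseteq> (\<lambda>z. z - snd p) ` \<Omega>"

definition inUdelta :: "'a::euclidean_space set \<Rightarrow> real \<Rightarrow> ('a \<Rightarrow> complex) \<times> 'a \<Rightarrow> bool" where
  "inUdelta \<Omega> \<delta> p \<longleftrightarrow> A0 (fst p) \<and> snd p \<in> \<Omega> \<and>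
     supp (fst p) \<subseteq> (\<lambda>z. inverse \<delta> *\<^sub>R (z - snd p)) ` \<Omega>"

text \<open>The algebra E(Omega): R is smooth on U(Omega), where U(Omega) carries the smooth
  structure transported from A_0(Omega) x Omega via T(phi,x) = (phi(.-x), x);
  i.e. R o T^{-1}, T^{-1}(psi,x) = (psi(.+x),x), maps smooth curves in
  A_0(Omega) x Omega to smooth curves in C.\<close>
definition Ealg :: "'a::euclidean_space set \<Rightarrow> (('a \<Rightarrow> complex) \<times> 'a \<Rightarrow> complex) \<Rightarrow> bool" where
  "Ealg \<Omega> R \<longleftrightarrow>
     (\<forall>(c::real \<Rightarrow> 'a \<Rightarrow> complex) (x::real \<Rightarrow> 'a).
        Dcurve \<Omega> c \<and> (\<forall>t. integral UNIV (c t) = 1) \<and> C_inf_on UNIV x \<and> (\<forall>t. x t \<in> \<Omega>)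
        \<longrightarrow> C_inf_on UNIV (\<lambda>t. R (\<lambda>\<xi>. c t (\<xi> + x t), x t)))"

definition dx :: "'a::euclidean_space list \<Rightarrow> ('a \<Rightarrow> 'a \<Rightarrow> complex) \<Rightarrow> 'a \<Rightarrow> 'a \<Rightarrow> complex" where
  "dx bs \<phi> x = (\<lambda>\<xi>. pdl bs (\<lambda>y. \<phi> y \<xi>) x)"

definition CinfA0 :: "'a::euclidean_space set \<Rightarrow> ('a \<Rightarrow> 'a \<Rightarrow> complex) \<Rightarrow> bool" where
  "CinfA0 \<Omega> \<phi> \<longleftrightarrow> smoothD \<Omega> UNIV \<phi> \<and> (\<forall>x\<in>\<Omega>. A0 (\<phi> x))"

definition bounded_CinfA0 :: "'a::euclidean_space set \<Rightarrow> ('a \<Rightarrow> 'a \<Rightarrow> complex) set \<Rightarrow> bool" where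
  "bounded_CinfA0 \<Omega> B \<longleftrightarrow> (\<forall>\<phi>\<in>B. CinfA0 \<Omega> \<phi>) \<and>
     (\<forall>K bs. compact K \<and> K \<subseteq> \<Omega> \<and> set bs \<subseteq> Basis \<longrightarrow>
        Dbounded {dx bs \<phi> x | \<phi> x. \<phi> \<in> B \<and> x \<in> K})"

definition Cb_weak :: "'a::euclidean_space set \<Rightarrow> (real \<times> 'a \<Rightarrow> 'a \<Rightarrow> complex) \<Rightarrow> bool" where
  "Cb_weak \<Omega> \<phi> \<longleftrightarrow> (\<forall>\<epsilon>\<in>{0<..1}. CinfA0 \<Omega> (\<lambda>x. \<phi> (\<epsilon>, x))) \<and>
     (\<forall>K bs. compact K \<and> K \<subseteq> \<Omega> \<and> set bs \<subseteq> Basis \<longrightarrow>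
        Dbounded {dx bs (\<lambda>y. \<phi> (\<epsilon>, y)) x | \<epsilon> x. \<epsilon> \<in> {0<..1} \<and> x \<in> K})"

definition Cb_smooth :: "'a::euclidean_space set \<Rightarrow> (real \<times> 'a \<Rightarrow> 'a \<Rightarrow> complex) \<Rightarrow> bool" where
  "Cb_smooth \<Omega> \<phi> \<longleftrightarrow> Cb_weak \<Omega> \<phi> \<and> smooth_on_set ({0<..1} \<times> \<Omega>) \<phi>"

text \<open>The estimate |d^alpha_x R(S_eps Phi(x), x)| <= C eps^(-N) on K, including the
  requirement that R(S_eps Phi(y), y) be defined for y in an open neighbourhood of K.\<close>
definition est :: "'a::euclidean_space set \<Rightarrow> (('a \<Rightarrow> complex) \<times> 'a \<Rightarrow> complex)
     \<Rightarrow> ('a \<Rightarrow> 'a \<Rightarrow> complex) \<Rightarrow> real \<Rightarrow> 'a set \<Rightarrow> 'a list \<Rightarrow> nat \<Rightarrow> real \<Rightarrow> bool" where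
  "est \<Omega> R \<Phi> \<epsilon> K bs N C \<longleftrightarrow>
     (\<exists>V. open V \<and> K \<subseteq> V \<and> V \<subseteq> \<Omega> \<and> (\<forall>y\<in>V. inU \<Omega> (Seps \<epsilon> (\<Phi> y), y)) \<and>
        (\<forall>x\<in>K. norm (pdl bs (\<lambda>y. R (Seps \<epsilon> (\<Phi> y), y)) x) \<le> C / \<epsilon> ^ N))"

definition condA where
  "condA \<Omega> R \<longleftrightarrow> (\<forall>K bs. compact K \<and> K \<subseteq> \<Omega> \<and> set bs \<subseteq> Basis \<longrightarrow>
     (\<exists>N::nat. \<forall>B. bounded_CinfA0 \<Omega> B \<longrightarrow>
        (\<exists>C \<eta>. C > 0 \<and> \<eta> > 0 \<and> (\<forall>\<phi>\<in>B. \<forall>\<epsilon>\<in>{0<..<\<eta>}. est \<Omega> R \<phi> \<epsilon> K bs N C))))"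

definition cond_net where
  "cond_net P \<Omega> R \<longleftrightarrow> (\<forall>K bs. compact K \<and> K \<subseteq> \<Omega> \<and> set bs \<subseteq> Basis \<longrightarrow>
     (\<exists>N::nat. \<forall>\<phi>. P K \<phi> \<longrightarrow>
        (\<exists>C \<eta>. C > 0 \<and> \<eta> > 0 \<and>
           (\<forall>\<epsilon>\<in>{0<..<\<eta>}. est \<Omega> R (\<lambda>y. \<phi> (\<epsilon>, y)) \<epsilon> K bs N C))))"

definition condB where "condB \<Omega> R \<longleftrightarrow> cond_net (\<lambda>K \<phi>. Cb_weak \<Omega> \<phi>) \<Omega> R"

definition condC where "condC \<Omega> R \<longleftrightarrow> cond_net (\<lambda>K \<phi>. Cb_smooth \<Omega> \<phi>) \<Omega> R"

definition condD where "condD \<Omega> R \<longleftrightarrow> cond_net (\<lambda>K \<phi>. Cb_smooth \<Omega> \<phi> \<and>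
     (\<forall>\<epsilon>\<in>{0<..1}. \<forall>\<delta>\<in>{0<..1}. \<forall>x\<in>K. inUdelta \<Omega> \<delta> (\<phi> (\<epsilon>, x), x))) \<Omega> R"

definition condE where "condE \<Omega> R \<longleftrightarrow> cond_net (\<lambda>K \<phi>. Cb_smooth \<Omega> \<phi> \<and>
     (\<forall>L. compact L \<and> L \<subseteq> \<Omega> \<longrightarrow> (\<exists>\<delta>0>0. \<forall>\<epsilon>\<in>{0<..1}. \<forall>x\<in>L. \<forall>\<delta>.
         0 < \<delta> \<and> \<delta> \<le> \<delta>0 \<longrightarrow> inUdelta \<Omega> \<delta> (\<phi> (\<epsilon>, x), x)))) \<Omega> R"

definition condZ :: "'a::euclidean_space set \<Rightarrow> (('a \<Rightarrow> complex) \<times> 'a \<Rightarrow> complex) \<Rightarrow> bool" where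
  "condZ \<Omega> R \<longleftrightarrow> (\<forall>K bs. compact K \<and> K \<subseteq> \<Omega> \<and> set bs \<subseteq> Basis \<longrightarrow>
     (\<exists>N::nat. \<forall>(D::(real \<times> 'a) set) (\<phi>::real \<times> 'a \<Rightarrow> 'a \<Rightarrow> complex).
        D \<subseteq> {0<..1} \<times> \<Omega> \<and> (\<forall>p\<in>D. A0 (\<phi> p)) \<and>
        (\<forall>L. compact L \<and> L \<subseteq> \<Omega> \<longrightarrow>
           (\<exists>\<epsilon>0>0. \<exists>U. U \<subseteq> D \<and> openin (top_of_set ({0<..1} \<times> \<Omega>)) U \<and>
              {0<..\<epsilon>0} \<times> L \<subseteq> U \<and> smooth_on_set U \<phi> \<and>
              (\<forall>bs'. set bs' \<subseteq> Basis \<longrightarrow>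
                 Dbounded {dx bs' (\<lambda>y. \<phi> (\<epsilon>, y)) x | \<epsilon> x. \<epsilon> \<in> {0<..\<epsilon>0} \<and> x \<in> L})))
        \<longrightarrow> (\<exists>C \<eta>. C > 0 \<and> \<eta> > 0 \<and>
              (\<forall>\<epsilon>\<in>{0<..<\<eta>}. (\<forall>x\<in>K. (\<epsilon>, x) \<in> D) \<and>
                 (\<exists>V. open V \<and> K \<subseteq> V \<and> (\<forall>y\<in>V. (\<epsilon>, y) \<in> D) \<and>
                      est \<Omega> R (\<lambda>y. \<phi> (\<epsilon>, y)) \<epsilon> K bs N C)))))"

end

theory Submission imports Defs begin

text \<open>
Since the space of functions with integral 1 is affine, nets can be glued by convex combinations.
Suppose (A) fails for a bounded set B. Pick phi n in B and rapidly decreasing eps n violating the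
estimate with constant n, and interpolate the phi n by bump functions in eps into one jointly smooth
bounded net, for which the estimate then fails. Rescaling the phi n by a fixed S_rho first makes
their supports so small that the net even satisfies the restriction in (D). The restriction in (E)
holds automatically because supports over compact sets are uniformly bounded. For (Z), a cutoff in x
extends a locally defined net from a neighbourhood of K to all of Omega, which yields a bounded set
to which (A) applies.

Smoothness is defined by testing along smooth curves, whereas boundedness involves iterated partial
derivatives in x. The link is Boman's theorem: a map that is smooth along smooth curves is smooth.
A curve through a rapidly converging sequence of points shows that the iterated derivatives along
coordinate lines are locally bounded, and a Landau-Kolmogorov interpolation inequality upgrades this
to smoothness of each first partial derivative along curves.
\<close>

subsection \<open>Smooth curves\<close>

text \<open>The obstacle behind the analytic half is that test curves control derivatives along
  single lines only: \<open>directional_nderiv_bounded\<close> bounds the pure s-derivatives and the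
  pure t-derivatives of a map G(s, t), whereas smoothness of t -> dG/ds(0, t) concerns the mixed
  ones. Interpolation recovers these from the pure ones. Iterated partial derivatives cannot be
  bypassed, because boundedness is stated with \<open>pdl\<close> and the cutoff for (Z) needs the
  product rule for them. In passing from (D) to (A) the exponent N is fixed before B, so one bad net
  is a contradiction. Shrinking supports costs nothing: S_e S_rho = S_(e rho), so rescaling by rho
  <= 1 merely moves the parameter eps n up to eps n / rho, where the estimate is the stronger
  one.\<close>

primrec Ck :: "nat \<Rightarrow> (real \<Rightarrow> 'a::real_normed_vector) \<Rightarrow> bool" where
  "Ck 0 f \<longleftrightarrow> True"
| "Ck (Suc n) f \<longleftrightarrow> (\<exists>f'. (\<forall>t. (f has_vector_derivative f' t) (at t)) \<and> Ck n f')"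

text \<open>\<open>Ck n\<close> asks for n successive derivatives without continuity of the last
  one; demanding all n supplies that continuity. The finite orders are kept because the closure
  properties are inductions on n.\<close>

definition smooth_curve :: "(real \<Rightarrow> 'a::real_normed_vector) \<Rightarrow> bool" where
  "smooth_curve c \<longleftrightarrow> (\<forall>n. Ck n c)"

definition nderiv :: "nat \<Rightarrow> (real \<Rightarrow> 'a::real_normed_vector) \<Rightarrow> real \<Rightarrow> 'a" where
  "nderiv n = (\<lambda>f t. vector_derivative f (at t)) ^^ n"

lemma Ck_SucI:
  assumes "\<And>t. (f has_vector_derivative f' t) (at t)" "Ck n f'"
  shows "Ck (Suc n) f"
  using assms by auto

lemma Ck_SucE:
  assumes "Ck (Suc n) f"
  obtains f' where "\<And>t. (f has_vector_derivative f' t) (at t)" "Ck n f'"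
  using assms by auto

lemma Ck_Suc_imp: "Ck (Suc n) f \<Longrightarrow> Ck n f"
proof (induction n arbitrary: f)
  case (Suc n)
  then obtain f' where "\<And>t. (f has_vector_derivative f' t) (at t)" "Ck (Suc n) f'"
    by (auto elim: Ck_SucE)
  then show ?case using Suc.IH by (blast intro: Ck_SucI)
qed simp

lemma Ck_const: "Ck n (\<lambda>t. a)"
proof (induction n arbitrary: a)
  case (Suc n)
  show ?case by (rule Ck_SucI[where f' = "\<lambda>t. 0"]) (auto simp: Suc)
qed simp

lemma Ck_ident: "Ck n (\<lambda>t::real. t)"
proof (cases n)
  case (Suc m)
  show ?thesis unfolding Suc by (rule Ck_SucI[where f' = "\<lambda>t. 1"]) (auto simp: Ck_const)
qed simp

lemma Ck_add: "Ck n f \<Longrightarrow> Ck n g \<Longrightarrow> Ck n (\<lambda>t. f t + g t)"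
proof (induction n arbitrary: f g)
  case (Suc n)
  obtain f' where f': "\<And>t. (f has_vector_derivative f' t) (at t)" "Ck n f'"
    using Suc.prems(1) by (rule Ck_SucE) auto
  obtain g' where g': "\<And>t. (g has_vector_derivative g' t) (at t)" "Ck n g'"
    using Suc.prems(2) by (rule Ck_SucE) auto
  show ?case
    by (rule Ck_SucI[where f' = "\<lambda>t. f' t + g' t"])
       (auto intro!: derivative_eq_intros f' g' Suc.IH)
qed simp

lemma Ck_bounded_linear:
  assumes "bounded_linear L"
  shows "Ck n f \<Longrightarrow> Ck n (\<lambda>t. L (f t))"
proof (induction n arbitrary: f)
  case (Suc n)
  obtain f' where f': "\<And>t. (f has_vector_derivative f' t) (at t)" "Ck n f'"
    using Suc.prems(1) by (rule Ck_SucE) auto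
  show ?case
    by (rule Ck_SucI[where f' = "\<lambda>t. L (f' t)"])
       (auto intro!: bounded_linear.has_vector_derivative[OF assms] f' Suc.IH)
qed simp

lemma Ck_bilinear:
  assumes "bounded_bilinear B"
  shows "Ck n f \<Longrightarrow> Ck n g \<Longrightarrow> Ck n (\<lambda>t. B (f t) (g t))"
proof (induction n arbitrary: f g)
  case (Suc n)
  obtain f' where f': "\<And>t. (f has_vector_derivative f' t) (at t)" "Ck n f'"
    using Suc.prems(1) by (rule Ck_SucE) auto
  obtain g' where g': "\<And>t. (g has_vector_derivative g' t) (at t)" "Ck n g'"
    using Suc.prems(2) by (rule Ck_SucE) auto
  have "Ck n f" "Ck n g" using Suc.prems by (blast intro: Ck_Suc_imp)+
  then show ?case
    by (intro Ck_SucI[where f' = "\<lambda>t. B (f t) (g' t) + B (f' t) (g t)"] Ck_add)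
       (auto intro!: bounded_bilinear.has_vector_derivative[OF assms] f' g' Suc.IH)
qed simp

lemma Ck_compose:
  fixes g :: "real \<Rightarrow> real"
  shows "Ck n f \<Longrightarrow> Ck n g \<Longrightarrow> Ck n (\<lambda>t. f (g t))"
proof (induction n arbitrary: f)
  case (Suc n)
  obtain f' where f': "\<And>t. (f has_vector_derivative f' t) (at t)" "Ck n f'"
    using Suc.prems(1) by (rule Ck_SucE) auto
  obtain g' where g': "\<And>t. (g has_vector_derivative g' t) (at t)" "Ck n g'"
    using Suc.prems(2) by (rule Ck_SucE) auto
  have g: "Ck n g" using Suc.prems by (blast intro: Ck_Suc_imp)
  show ?case
  proof (rule Ck_SucI[where f' = "\<lambda>t. g' t *\<^sub>R f' (g t)"])
    show "((\<lambda>t. f (g t)) has_vector_derivative g' t *\<^sub>R f' (g t)) (at t)" for t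
      using vector_diff_chain_at[OF g'(1) f'(1)] by (simp add: o_def)
    show "Ck n (\<lambda>t. g' t *\<^sub>R f' (g t))"
      by (rule Ck_bilinear[OF bounded_bilinear_scaleR g'(2) Suc.IH[OF f'(2) g]])
  qed
qed simp

text \<open>The derivative is a product of g' with two copies of \<open>inverse (g t)\<close>, so at
  order n the induction hypothesis and the product rule cover it.\<close>

lemma Ck_inverse:
  fixes g :: "real \<Rightarrow> real"
  assumes "\<And>t. g t \<noteq> 0"
  shows "Ck n g \<Longrightarrow> Ck n (\<lambda>t. inverse (g t))"
proof (induction n)
  case (Suc n)
  obtain g' where g': "\<And>t. (g has_vector_derivative g' t) (at t)" "Ck n g'"
    using Suc.prems by (rule Ck_SucE) auto
  have I: "Ck n (\<lambda>t. inverse (g t))" using Suc by (blast intro: Ck_Suc_imp)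
  show ?case
  proof (rule Ck_SucI[where f' = "\<lambda>t. (- 1) * (inverse (g t) * g' t * inverse (g t))"])
    show "((\<lambda>t. inverse (g t)) has_vector_derivative (- 1) * (inverse (g t) * g' t * inverse (g t))) (at t)" for t
      using g'(1)[of t] assms[of t] unfolding has_real_derivative_iff_has_vector_derivative[symmetric]
      by (auto intro!: derivative_eq_intros)
    show "Ck n (\<lambda>t. (- 1) * (inverse (g t) * g' t * inverse (g t)))"
      by (intro Ck_bilinear[OF bounded_bilinear_mult] Ck_const I g')
  qed
qed simp

lemma Ck_local:
  assumes "\<And>t. \<exists>g S. open S \<and> t \<in> S \<and> Ck n g \<and> (\<forall>u\<in>S. f u = g u)"
  shows "Ck n f"
  using assms
proof (induction n arbitrary: f)
  case (Suc n)
  \<comment> \<open>The derivative of the local representative is recorded at every point of S, not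
    only at t, because the induction hypothesis is applied to f', which must agree with g' on a
    neighbourhood.\<close>
  have D: "\<exists>g' S. open S \<and> t \<in> S \<and> Ck n g' \<and> (\<forall>u\<in>S. (f has_vector_derivative g' u) (at u))" for t
  proof -
    obtain g S where g: "open S" "t \<in> S" "Ck (Suc n) g" "\<forall>u\<in>S. f u = g u"
      using Suc.prems by blast
    obtain g' where g': "\<And>t. (g has_vector_derivative g' t) (at t)" "Ck n g'"
      using g(3) by (rule Ck_SucE) auto
    have "(f has_vector_derivative g' u) (at u)" if "u \<in> S" for u
      using has_vector_derivative_transform_within_open[OF g'(1) g(1) that] g(4) by auto
    then show ?thesis using g g' by blast
  qed
  define f' where "f' t = vector_derivative f (at t)" for t
  show ?case
  proof (rule Ck_SucI[where f' = f'])
    show "(f has_vector_derivative f' t) (at t)" for t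
      using D[of t] unfolding f'_def by (metis vector_derivative_at)
    show "Ck n f'"
    proof (rule Suc.IH)
      show "\<exists>g S. open S \<and> t \<in> S \<and> Ck n g \<and> (\<forall>u\<in>S. f' u = g u)" for t
        using D[of t] unfolding f'_def by (metis vector_derivative_at)
    qed
  qed
qed simp

lemma smooth_curve_const [simp]: "smooth_curve (\<lambda>t. a)"
  and smooth_curve_ident [simp]: "smooth_curve (\<lambda>t::real. t)"
  and smooth_curve_add: "smooth_curve f \<Longrightarrow> smooth_curve g \<Longrightarrow> smooth_curve (\<lambda>t. f t + g t)"
  and smooth_curve_bounded_linear: "bounded_linear L \<Longrightarrow> smooth_curve f \<Longrightarrow> smooth_curve (\<lambda>t. L (f t))"
  and smooth_curve_bilinear: "bounded_bilinear B \<Longrightarrow> smooth_curve f \<Longrightarrow> smooth_curve h \<Longrightarrow> smooth_curve (\<lambda>t. B (f t) (h t))"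
  and smooth_curve_inverse: "(\<And>t. r t \<noteq> (0::real)) \<Longrightarrow> smooth_curve r \<Longrightarrow> smooth_curve (\<lambda>t. inverse (r t))"
  and smooth_curve_compose: "smooth_curve f \<Longrightarrow> smooth_curve r \<Longrightarrow> smooth_curve (\<lambda>t. f (r t))"
  by (auto simp: smooth_curve_def Ck_const Ck_ident Ck_add Ck_bounded_linear Ck_bilinear Ck_inverse Ck_compose)

lemma smooth_curve_local:
  assumes "\<And>t. \<exists>g S. open S \<and> t \<in> S \<and> smooth_curve g \<and> (\<forall>u\<in>S. f u = g u)"
  shows "smooth_curve f"
proof -
  have "\<exists>g S. open S \<and> t \<in> S \<and> Ck n g \<and> (\<forall>u\<in>S. f u = g u)" for n t
    using assms[of t] unfolding smooth_curve_def by metis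
  then show ?thesis unfolding smooth_curve_def using Ck_local by metis
qed

lemma smooth_curve_minus: "smooth_curve f \<Longrightarrow> smooth_curve (\<lambda>t. - f t)"
  by (rule smooth_curve_bounded_linear) (simp add: bounded_linear_minus bounded_linear_ident)

lemma smooth_curve_diff: "smooth_curve f \<Longrightarrow> smooth_curve g \<Longrightarrow> smooth_curve (\<lambda>t. f t - g t)"
  using smooth_curve_add[of f "\<lambda>t. - g t"] smooth_curve_minus by auto

lemmas smooth_curve_scaleR = smooth_curve_bilinear[OF bounded_bilinear_scaleR]
lemmas smooth_curve_mult = smooth_curve_bilinear[OF bounded_bilinear_mult]
lemmas smooth_curve_inner = smooth_curve_bilinear[OF bounded_bilinear_inner]
lemmas smooth_curve_fst = smooth_curve_bounded_linear[OF bounded_linear_fst]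
lemmas smooth_curve_snd = smooth_curve_bounded_linear[OF bounded_linear_snd]
lemmas smooth_curve_of_real = smooth_curve_bounded_linear[OF bounded_linear_of_real]

lemma smooth_curve_Pair:
  assumes "smooth_curve f" "smooth_curve g"
  shows "smooth_curve (\<lambda>t. (f t, g t))"
proof -
  have "smooth_curve (\<lambda>t. (f t, 0) + (0, g t))"
    by (intro smooth_curve_add smooth_curve_bounded_linear[of "\<lambda>x. (x, 0)"]
        smooth_curve_bounded_linear[of "\<lambda>x. (0, x)"] assms bounded_linear_Pair
        bounded_linear_ident bounded_linear_zero)
  then show ?thesis by simp
qed

lemma smooth_curve_prod:
  fixes f :: "'i \<Rightarrow> real \<Rightarrow> real"
  assumes "finite I" "\<And>i. i \<in> I \<Longrightarrow> smooth_curve (f i)"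
  shows "smooth_curve (\<lambda>t. \<Prod>i\<in>I. f i t)"
  using assms by (induction I rule: finite_induct) (auto intro: smooth_curve_mult)

lemma smooth_curve_has_vector_derivative:
  assumes "smooth_curve f"
  shows "(f has_vector_derivative vector_derivative f (at t)) (at t)"
    and "smooth_curve (\<lambda>t. vector_derivative f (at t))"
proof -
  have D: "(f has_vector_derivative vector_derivative f (at t)) (at t)" for t
    using assms unfolding smooth_curve_def by (metis Ck_SucE vector_derivative_at)
  then show "(f has_vector_derivative vector_derivative f (at t)) (at t)" .
  have "Ck n (\<lambda>t. vector_derivative f (at t))" for n
  proof -
    have "Ck (Suc n) f" using assms by (simp add: smooth_curve_def)
    then obtain f' where f': "\<And>t. (f has_vector_derivative f' t) (at t)" "Ck n f'"
      by (rule Ck_SucE) auto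
    then have "f' = (\<lambda>t. vector_derivative f (at t))"
      by (intro ext vector_derivative_at[symmetric]) blast
    then show ?thesis using f' by simp
  qed
  then show "smooth_curve (\<lambda>t. vector_derivative f (at t))" by (simp add: smooth_curve_def)
qed

section \<open>Iterated derivatives of curves\<close>

lemma nderiv_0 [simp]: "nderiv 0 f = f"
  and nderiv_Suc: "nderiv (Suc n) f = (\<lambda>t. vector_derivative (nderiv n f) (at t))"
  by (simp_all add: nderiv_def)

lemma smooth_curve_nderiv: "smooth_curve f \<Longrightarrow> smooth_curve (nderiv n f)"
  by (induction n) (auto simp: nderiv_Suc smooth_curve_has_vector_derivative)

lemma nderiv_has_vector_derivative:
  "smooth_curve f \<Longrightarrow> (nderiv n f has_vector_derivative nderiv (Suc n) f t) (at t)"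
  by (simp add: nderiv_Suc smooth_curve_has_vector_derivative smooth_curve_nderiv)

lemma smooth_curve_continuous: "smooth_curve f \<Longrightarrow> continuous_on S f"
  using smooth_curve_has_vector_derivative(1) has_vector_derivative_continuous
  by (meson continuous_at_imp_continuous_on)

lemma nderiv_local:
  assumes "open S" "\<And>u. u \<in> S \<Longrightarrow> f u = g u" "t \<in> S"
  shows "nderiv n f t = nderiv n g t"
  using assms(3)
proof (induction n arbitrary: t)
  case (Suc n)
  have "eventually (\<lambda>u. nderiv n f u = nderiv n g u) (nhds t)"
    using Suc assms(1) by (auto simp: eventually_nhds)
  then show ?case
    unfolding nderiv_Suc by (intro vector_derivative_cong_eq) (auto intro: Suc)
qed (use assms in auto)

lemma nderiv_affine:
  assumes "smooth_curve f"
  shows "nderiv n (\<lambda>u. f (a + l * u)) t = l ^ n *\<^sub>R nderiv n f (a + l * t)"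
proof (induction n arbitrary: t)
  case (Suc n)
  have "((\<lambda>t. l ^ n *\<^sub>R nderiv n f (a + l * t)) has_vector_derivative l ^ n *\<^sub>R l *\<^sub>R nderiv (Suc n) f (a + l * t)) (at t)"
    by (intro bounded_linear.has_vector_derivative[OF bounded_linear_scaleR_right]
        vector_diff_chain_at[of "\<lambda>t. a + l * t" l, unfolded o_def] nderiv_has_vector_derivative assms)
       (auto intro!: derivative_eq_intros)
  moreover have "nderiv n (\<lambda>u. f (a + l * u)) = (\<lambda>t. l ^ n *\<^sub>R nderiv n f (a + l * t))"
    using Suc by (rule ext)
  ultimately show ?case
    by (simp only: nderiv_Suc[of n "\<lambda>u. f (a + l * u)"] vector_derivative_at) (simp add: mult.commute)
qed simp

subsection \<open>Smooth cutoffs on the line\<close>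

text \<open>In terms of u = 1/t this is u^k exp(-u). The whole family over k is needed:
  differentiating leads from k to k + 1 and k + 2, so smoothness is proved for all k at once. The
  classical flat function is \<open>flat 0\<close>.\<close>

definition flat :: "nat \<Rightarrow> real \<Rightarrow> real" where
  "flat k t = (if t \<le> 0 then 0 else (1 / t) ^ k * exp (- (1 / t)))"

text \<open>A single term of the exponential series, u^(k+2) / (k+2)!, is at most exp u. The
  quadratic bound makes the difference quotient at 0 tend to 0.\<close>

lemma flat_le: "\<bar>flat k t\<bar> \<le> fact (k + 2) * t\<^sup>2"
proof (cases "t \<le> 0")
  case False
  define u where "u = 1 / t"
  have u: "u > 0" using False by (simp add: u_def)
  have "u ^ (k + 2) / fact (k + 2) = (\<Sum>i\<in>{k+2}. u ^ i /\<^sub>R fact i)"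
    by (simp add: divide_inverse mult.commute)
  also have "\<dots> \<le> exp u"
    unfolding exp_def using u
    by (intro sum_le_suminf summable_exp_generic) auto
  finally have "u ^ k * exp (- u) \<le> fact (k + 2) * (1 / u)\<^sup>2"
    using u by (simp add: field_simps exp_minus power_add power2_eq_square del: fact_Suc)
  then show ?thesis using False by (simp add: flat_def u_def del: fact_Suc)
qed (simp add: flat_def)

lemma flat_has_derivative:
  "(flat k has_vector_derivative flat (k + 2) t - real k * flat (k + 1) t) (at t)"
proof -
  have "(flat k has_real_derivative flat (k + 2) t - real k * flat (k + 1) t) (at t)"
  proof (cases t "0::real" rule: linorder_cases)
    case less
    have "(flat k has_real_derivative 0) (at t)"
      by (rule has_field_derivative_transform_within_open[of "\<lambda>_. 0" _ _ "{..<0}"])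
         (use less in \<open>auto simp: flat_def\<close>)
    then show ?thesis using less by (simp add: flat_def)
  next
    case greater
    have "((\<lambda>t. (1 / t) ^ k * exp (- (1 / t))) has_real_derivative
        flat (k + 2) t - real k * flat (k + 1) t) (at t)"
    proof (cases k)
      case (Suc m)
      then show ?thesis using greater
        by (auto intro!: derivative_eq_intros simp: flat_def field_simps power2_eq_square)
           (metis One_nat_def power_eq_if)
    qed (use greater in \<open>auto intro!: derivative_eq_intros simp: flat_def field_simps power2_eq_square\<close>)
    then show ?thesis
      by (rule has_field_derivative_transform_within_open[of _ _ _ "{0<..}"])
         (use greater in \<open>auto simp: flat_def\<close>)
  next
    case equal
    have "((\<lambda>h. flat k h / h) \<longlongrightarrow> 0) (at 0)"
    proof (rule Lim_null_comparison)
      show "\<forall>\<^sub>F h in at 0. norm (flat k h / h) \<le> fact (k + 2) * \<bar>h\<bar>"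
        using eventually_neq_at_within[of 0 0 UNIV]
      proof eventually_elim
        case (elim h)
        have "norm (flat k h / h) \<le> fact (k + 2) * h\<^sup>2 / \<bar>h\<bar>"
          using flat_le[of k h] by (simp add: divide_right_mono del: fact_Suc)
        also have "\<dots> = fact (k + 2) * \<bar>h\<bar>"
          using elim by (simp add: power2_eq_square abs_if del: fact_Suc)
        finally show ?case .
      qed
      show "((\<lambda>h. fact (k + 2) * \<bar>h\<bar>) \<longlongrightarrow> (0::real)) (at 0)"
        by (auto intro!: tendsto_eq_intros simp del: fact_Suc)
    qed
    then show ?thesis using equal by (simp add: DERIV_def flat_def)
  qed
  then show ?thesis by (simp add: has_real_derivative_iff_has_vector_derivative)
qed

lemma smooth_curve_flat: "smooth_curve (flat k)"
proof -
  have "Ck n (flat k)" for n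
  proof (induction n arbitrary: k)
    case (Suc n)
    have "Ck n (\<lambda>t. flat (k + 2) t + (- real k) * flat (k + 1) t)"
      by (intro Ck_add Ck_bilinear[OF bounded_bilinear_mult] Ck_const Suc)
    then show ?case by (intro Ck_SucI[OF flat_has_derivative]) simp
  qed simp
  then show ?thesis by (simp add: smooth_curve_def)
qed

text \<open>The thresholds 1 and 4 are the squares of 1 and 2: the arguments will be squared
  relative distances, which are smooth even at the centre, so the cutoffs change between radius r
  and radius 2 r.\<close>

definition smooth_step :: "real \<Rightarrow> real" where
  "smooth_step u = flat 0 (4 - u) / (flat 0 (4 - u) + flat 0 (u - 1))"

lemma smooth_step_simps: "u \<le> 1 \<Longrightarrow> smooth_step u = 1" "4 \<le> u \<Longrightarrow> smooth_step u = 0"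
  by (auto simp: smooth_step_def flat_def)

lemma smooth_step_bounds: "0 \<le> smooth_step u" "smooth_step u \<le> 1"
proof -
  have "flat 0 x \<ge> 0" for x by (simp add: flat_def)
  then show "0 \<le> smooth_step u" "smooth_step u \<le> 1"
    by (auto simp: smooth_step_def divide_simps add_nonneg_eq_0_iff) (smt (verit))+
qed

lemma smooth_curve_smooth_step: "smooth_curve r \<Longrightarrow> smooth_curve (\<lambda>t. smooth_step (r t))"
proof -
  \<comment> \<open>The two terms never vanish together, since u < 4 or u > 1.\<close>
  have "flat 0 (4 - u) + flat 0 (u - 1) > 0" for u
    by (cases "u < 4") (auto simp: flat_def add_pos_nonneg)
  then have "flat 0 (4 - u) + flat 0 (u - 1) \<noteq> 0" for u by (metis less_irrefl)
  then have "smooth_curve smooth_step"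
    unfolding smooth_step_def divide_inverse
    by (intro smooth_curve_mult smooth_curve_inverse smooth_curve_add smooth_curve_diff
        smooth_curve_compose[OF smooth_curve_flat]) auto
  then show "smooth_curve r \<Longrightarrow> smooth_curve (\<lambda>t. smooth_step (r t))"
    by (rule smooth_curve_compose)
qed

subsection \<open>Smooth curves through rapidly converging sequences\<close>

text \<open>The majorant concerns the derivatives only, uniformly in t; for the functions themselves
  pointwise summability is enough.\<close>

lemma has_vector_derivative_series:
  fixes f :: "nat \<Rightarrow> real \<Rightarrow> 'b::banach"
  assumes f': "\<And>k t. (f k has_vector_derivative f' k t) (at t)"
    and M: "\<And>k t. norm (f' k t) \<le> M k" "summable M"
    and S: "\<And>t. summable (\<lambda>k. f k t)"
  shows "((\<lambda>t. \<Sum>k. f k t) has_vector_derivative (\<Sum>k. f' k t)) (at t)"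
proof -
  have U: "uniform_limit UNIV (\<lambda>n x. \<Sum>i<n. f' i x) (\<lambda>x. \<Sum>i. f' i x) sequentially"
    by (rule Weierstrass_m_test) (use M in auto)
  have "\<exists>g. \<forall>x\<in>UNIV. (\<lambda>n. f n x) sums g x \<and>
      (g has_derivative (\<lambda>h. h *\<^sub>R (\<Sum>i. f' i x))) (at x within UNIV)"
  proof (rule has_derivative_series[where f' = "\<lambda>n x h. h *\<^sub>R f' n x"])
    show "(f n has_derivative (\<lambda>h. h *\<^sub>R f' n x)) (at x within UNIV)" for n x
      using f' by (simp add: has_vector_derivative_def)
    show "\<forall>\<^sub>F n in sequentially. \<forall>x\<in>UNIV. \<forall>h.
        norm ((\<Sum>i<n. h *\<^sub>R f' i x) - h *\<^sub>R (\<Sum>i. f' i x)) \<le> e * norm h" if "e > 0" for e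
      using uniform_limitD[OF U that]
    proof eventually_elim
      case (elim n)
      have "norm ((\<Sum>i<n. h *\<^sub>R f' i x) - h *\<^sub>R (\<Sum>i. f' i x)) \<le> e * norm h" for x h
      proof -
        have "norm ((\<Sum>i<n. h *\<^sub>R f' i x) - h *\<^sub>R (\<Sum>i. f' i x)) = \<bar>h\<bar> * norm ((\<Sum>i<n. f' i x) - (\<Sum>i. f' i x))"
          by (simp flip: scaleR_sum_right scaleR_diff_right)
        also have "\<dots> \<le> \<bar>h\<bar> * e"
          using elim by (intro mult_left_mono) (auto simp: dist_norm less_imp_le)
        finally show ?thesis by (simp add: mult.commute)
      qed
      then show ?case by blast
    qed
    show "(\<lambda>n. f n 0) sums (\<Sum>n. f n 0)" using S by (rule summable_sums)
  qed auto
  then obtain g where g: "\<And>x. (\<lambda>n. f n x) sums g x"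
      "\<And>x. (g has_vector_derivative (\<Sum>i. f' i x)) (at x)"
    by (auto simp: has_vector_derivative_def)
  have "g = (\<lambda>t. \<Sum>k. f k t)" using g(1) by (auto simp: sums_iff)
  then show ?thesis using g(2) by simp
qed

text \<open>The second index counts derivatives, so the induction on j shifts it by one and passes
  to the series of derivatives.\<close>

lemma Ck_series:
  fixes f :: "nat \<Rightarrow> nat \<Rightarrow> real \<Rightarrow> 'b::banach"
  assumes "\<And>k i t. i < j \<Longrightarrow> (f k i has_vector_derivative f k (Suc i) t) (at t)"
    and "\<And>i. i \<le> j \<Longrightarrow> \<exists>M. summable M \<and> (\<forall>k t. norm (f k i t) \<le> M k)"
  shows "Ck j (\<lambda>t. \<Sum>k. f k 0 t)"
  using assms
proof (induction j arbitrary: f)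
  case (Suc j)
  obtain M0 where M0: "summable M0" "\<And>k t. norm (f k 0 t) \<le> M0 k" using Suc.prems(2)[of 0] by auto
  obtain M1 where M1: "summable M1" "\<And>k t. norm (f k 1 t) \<le> M1 k" using Suc.prems(2)[of 1] by auto
  show ?case
  proof (rule Ck_SucI)
    show "((\<lambda>t. \<Sum>k. f k 0 t) has_vector_derivative (\<Sum>k. f k 1 t)) (at t)" for t
      by (rule has_vector_derivative_series[OF _ M1(2,1)])
         (use Suc.prems(1)[of 0] in \<open>auto intro: summable_comparison_test'[OF M0(1)] M0(2)\<close>)
    show "Ck j (\<lambda>t. \<Sum>k. f k 1 t)"
      using Suc.IH[of "\<lambda>k i. f k (Suc i)"] Suc.prems by auto
  qed
qed simp

lemma nderiv_const: "nderiv n (\<lambda>_. a) = (\<lambda>_. if n = 0 then a else 0)"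
  by (induction n) (auto simp: nderiv_Suc)

lemma nderiv_bounded_if_compact_support:
  fixes f :: "real \<Rightarrow> 'b::real_normed_vector"
  assumes "smooth_curve f" "\<And>z. r < \<bar>z\<bar> \<Longrightarrow> f z = 0"
  shows "\<exists>A\<ge>0. \<forall>z. norm (nderiv j f z) \<le> A"
proof -
  have z: "nderiv j f z = 0" if "r < \<bar>z\<bar>" for z
  proof -
    have "nderiv j f z = nderiv j (\<lambda>_. 0) z"
      by (rule nderiv_local[of "{z. r < \<bar>z\<bar>}"])
         (use that assms in \<open>auto intro!: open_Collect_less continuous_intros\<close>)
    then show ?thesis by (cases j) (simp_all add: nderiv_const)
  qed
  have "bounded (nderiv j f ` {-r..r})"
    by (intro compact_imp_bounded compact_continuous_image smooth_curve_continuous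
        smooth_curve_nderiv assms) auto
  then obtain A where A: "\<And>z. z \<in> {-r..r} \<Longrightarrow> norm (nderiv j f z) \<le> A"
    unfolding bounded_iff by blast
  have "norm (nderiv j f z) \<le> max 0 A" for z
    using A[of z] z[of z] by (cases "r < \<bar>z\<bar>") (force simp: le_max_iff_disj)+
  then show ?thesis by (intro exI[of _ "max 0 A"]) auto
qed

text \<open>The bumps sit at the points 2^(-k) and have width comparable to 2^(-k); the factors 1 / k! beat
  all powers of 2^k produced by differentiating them.\<close>
lemma smooth_curve_through:
  fixes x :: "nat \<Rightarrow> 'b::banach"
  assumes x: "\<And>k. norm (x k - a) \<le> 1 / fact k"
  obtains c where "smooth_curve c" "c 0 = a"
    "\<And>k u. \<bar>u\<bar> < (1/2) ^ k / 8 \<Longrightarrow> c ((1/2) ^ k + u) = x k + (u / fact k) *\<^sub>R v"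
proof -
  define X where "X z = smooth_step (z\<^sup>2)" for z :: real
  \<comment> \<open>\<open>Y\<close> is the identity near 0, cut off; rescaled to width
    \<open>w k\<close> it contributes the linear term (u / k!) v.\<close>
  define Y where "Y z = z * X z" for z :: real
  have X1: "X z = 1" if "\<bar>z\<bar> \<le> 1" for z
    using that by (simp add: X_def smooth_step_simps abs_square_le_1)
  have X0: "X z = 0" if "2 \<le> \<bar>z\<bar>" for z
    using power_mono[OF that, of 2] by (simp add: X_def smooth_step_simps)
  have Xs: "smooth_curve X" unfolding X_def
    by (intro smooth_curve_smooth_step) (auto simp: power2_eq_square intro!: smooth_curve_mult)
  have Ys: "smooth_curve Y" unfolding Y_def by (intro smooth_curve_mult Xs) auto
  \<comment> \<open>A bump of half-width 2 w k = 2^(-k) / 4 around 2^(-k) reaches neither 0 nor the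
    window of radius 2^(-i) / 8 around any other point 2^(-i).\<close>
  define w where "w k = (1/2) ^ k / (8::real)" for k :: nat
  have w: "w k > 0" "w k \<le> 1" for k
    using power_le_one[of "1/2::real" k] by (auto simp: w_def)
  \<comment> \<open>\<open>f k j\<close> is the j-th derivative of the k-th bump. By hypothesis k!
    (x k - a) has norm at most 1, so apart from the prefactor everything is bounded uniformly in
    k.\<close>
  define f where "f k j t = (inverse (fact k) / w k ^ j) *\<^sub>R
      (nderiv j X ((t - (1/2) ^ k) / w k) *\<^sub>R (fact k *\<^sub>R (x k - a)) +
       (w k * nderiv j Y ((t - (1/2) ^ k) / w k)) *\<^sub>R v)" for k j t
  have D: "(f k j has_vector_derivative f k (Suc j) t) (at t)" for k j t
  proof -
    have chain: "((\<lambda>t. nderiv j Z ((t - (1/2) ^ k) / w k)) has_vector_derivative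
        inverse (w k) *\<^sub>R nderiv (Suc j) Z ((t - (1/2) ^ k) / w k)) (at t)"
      if "smooth_curve Z" for Z :: "real \<Rightarrow> real"
    proof -
      have "((\<lambda>t. (t - (1/2) ^ k) / w k) has_vector_derivative inverse (w k)) (at t)"
        unfolding has_real_derivative_iff_has_vector_derivative[symmetric] divide_inverse
        by (intro derivative_eq_intros) auto
      from vector_diff_chain_at[OF this nderiv_has_vector_derivative[OF that]]
      show ?thesis by (simp only: o_def)
    qed
    let ?z = "\<lambda>t. (t - (1/2) ^ k) / w k"
    have "((\<lambda>t. nderiv j X (?z t) *\<^sub>R (fact k *\<^sub>R (x k - a))) has_vector_derivative
        (inverse (w k) *\<^sub>R nderiv (Suc j) X (?z t)) *\<^sub>R (fact k *\<^sub>R (x k - a))) (at t)"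
      by (rule bounded_linear.has_vector_derivative[OF bounded_linear_scaleR_left chain[OF Xs]])
    moreover have "((\<lambda>t. nderiv j Y (?z t) *\<^sub>R (w k *\<^sub>R v)) has_vector_derivative
        (inverse (w k) *\<^sub>R nderiv (Suc j) Y (?z t)) *\<^sub>R (w k *\<^sub>R v)) (at t)"
      by (rule bounded_linear.has_vector_derivative[OF bounded_linear_scaleR_left chain[OF Ys]])
    ultimately have "(f k j has_vector_derivative (inverse (fact k) / w k ^ j) *\<^sub>R
        ((inverse (w k) *\<^sub>R nderiv (Suc j) X (?z t)) *\<^sub>R (fact k *\<^sub>R (x k - a)) +
         (inverse (w k) *\<^sub>R nderiv (Suc j) Y (?z t)) *\<^sub>R (w k *\<^sub>R v))) (at t)"
      unfolding f_def
      using bounded_linear.has_vector_derivative[OF bounded_linear_scaleR_right has_vector_derivative_add]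
      by (simp add: mult.commute)
    moreover have "(inverse F / W ^ j) *\<^sub>R ((inverse W *\<^sub>R p) *\<^sub>R y + (inverse W *\<^sub>R q) *\<^sub>R (W *\<^sub>R v)) =
        (inverse F / W ^ Suc j) *\<^sub>R (p *\<^sub>R y + (W * q) *\<^sub>R v)" for F W p q :: real and y
      by (simp add: scaleR_add_right divide_inverse mult_ac)
    ultimately show ?thesis unfolding f_def by (simp only:)
  qed
  have B: "\<exists>M. summable M \<and> (\<forall>k t. norm (f k j t) \<le> M k)" for j
  proof -
    obtain A where A: "A \<ge> 0" "\<And>z. norm (nderiv j X z) \<le> A"
      using nderiv_bounded_if_compact_support[OF Xs, of 2 j] X0 by (metis less_imp_le)
    obtain A' where A': "A' \<ge> 0" "\<And>z. norm (nderiv j Y z) \<le> A'"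
      using nderiv_bounded_if_compact_support[OF Ys, of 2 j] X0 by (metis less_imp_le Y_def mult_zero_right)
    have "norm (f k j t) \<le> 8 ^ j * (A + A' * norm v) * (inverse (fact k) * (2 ^ j) ^ k)" for k t
    proof -
      let ?z = "(t - (1/2) ^ k) / w k"
      have "norm (nderiv j X ?z *\<^sub>R (fact k *\<^sub>R (x k - a)) + (w k * nderiv j Y ?z) *\<^sub>R v)
        \<le> \<bar>nderiv j X ?z\<bar> * (fact k * norm (x k - a)) + w k * \<bar>nderiv j Y ?z\<bar> * norm v"
        using w(1)[of k] by (intro order_trans[OF norm_triangle_ineq]) (simp add: abs_mult)
      also have "\<dots> \<le> A * 1 + 1 * A' * norm v"
        using A A' w[of k] x[of k]
        by (intro add_mono mult_mono mult_nonneg_nonneg) (auto simp: field_simps less_imp_le)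
      finally have *: "norm (nderiv j X ?z *\<^sub>R (fact k *\<^sub>R (x k - a)) + (w k * nderiv j Y ?z) *\<^sub>R v) \<le> A + A' * norm v"
        by simp
      have "norm (f k j t) = inverse (fact k) / w k ^ j * norm (nderiv j X ?z *\<^sub>R (fact k *\<^sub>R (x k - a)) + (w k * nderiv j Y ?z) *\<^sub>R v)"
        using w(1)[of k] by (simp add: f_def)
      also have "\<dots> \<le> inverse (fact k) / w k ^ j * (A + A' * norm v)"
        using * w(1)[of k] by (intro mult_left_mono) auto
      also have "inverse (fact k) / w k ^ j = 8 ^ j * (inverse (fact k) * (2 ^ j) ^ k)"
        by (simp add: w_def power_divide field_simps flip: power_mult)
      finally show ?thesis by (simp add: mult_ac)
    qed
    \<comment> \<open>Up to a constant this is the exponential series at 2^j.\<close>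
    moreover have "summable (\<lambda>k. 8 ^ j * (A + A' * norm v) * (inverse (fact k) * (2 ^ j) ^ k))"
      by (intro summable_mult summable_exp)
    ultimately show ?thesis by blast
  qed
  define c where "c t = a + (\<Sum>k. f k 0 t)" for t
  show ?thesis
  proof (rule that)
    show "smooth_curve c" unfolding c_def smooth_curve_def
      by (intro allI Ck_add Ck_const Ck_series D B)
    have f0: "f k 0 t = 0" if "2 * w k \<le> \<bar>t - (1/2) ^ k\<bar>" for k t
    proof -
      have "2 \<le> \<bar>(t - (1/2) ^ k) / w k\<bar>" using that w(1)[of k] by (simp add: field_simps)
      then show ?thesis using X0 by (simp add: f_def Y_def)
    qed
    have "f k 0 0 = 0" for k by (rule f0) (simp add: w_def)
    then show "c 0 = a" by (simp add: c_def)
    fix k u assume u: "\<bar>u\<bar> < (1/2) ^ k / (8::real)"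
    have z: "f i 0 ((1/2) ^ k + u) = 0" if "i \<noteq> k" for i
    proof (rule f0)
      show "2 * w i \<le> \<bar>(1/2) ^ k + u - (1/2) ^ i\<bar>"
      proof -
        have gap: "2 * (q / 8) \<le> \<bar>p + u - q\<bar>"
          if "p \<le> q / 2 \<or> q \<le> p / 2" "0 < p" "0 < q" "\<bar>u\<bar> < p / 8" for p q :: real
          using that by arith
        have "(1/2) ^ k \<le> (1/2::real) ^ Suc i \<or> (1/2) ^ i \<le> (1/2::real) ^ Suc k"
          using \<open>i \<noteq> k\<close> power_decreasing[of "Suc i" k "1/2::real"] power_decreasing[of "Suc k" i "1/2::real"]
          by linarith
        then have "(1/2) ^ k \<le> (1/2::real) ^ i / 2 \<or> (1/2) ^ i \<le> (1/2::real) ^ k / 2" by simp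
        then show ?thesis unfolding w_def by (rule gap) (use u in auto)
      qed
    qed
    have "(\<Sum>i. f i 0 ((1/2) ^ k + u)) = (\<Sum>i\<in>{k}. f i 0 ((1/2) ^ k + u))"
      by (rule suminf_finite) (auto simp: z)
    also have "\<dots> = x k - a + (u / fact k) *\<^sub>R v"
    proof -
      have "\<bar>u\<bar> < w k" using u by (simp add: w_def)
      then have "\<bar>u / w k\<bar> \<le> 1" using w(1)[of k] by (simp add: abs_divide)
      then have "X (u / w k) = 1" "w k * Y (u / w k) = u" using w(1)[of k] by (simp_all add: X1 Y_def)
      moreover have "f k 0 ((1/2) ^ k + u) = inverse (fact k) *\<^sub>R
          (X (u / w k) *\<^sub>R (fact k *\<^sub>R (x k - a)) + (w k * Y (u / w k)) *\<^sub>R v)"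
        unfolding f_def add_diff_cancel_left' by simp
      ultimately have "f k 0 ((1/2) ^ k + u) = inverse (fact k) *\<^sub>R (fact k *\<^sub>R (x k - a) + u *\<^sub>R v)"
        by (simp only: scaleR_one)
      also have "\<dots> = x k - a + (u / fact k) *\<^sub>R v"
        unfolding divide_inverse[of u] by (simp add: scaleR_add_right mult.commute)
      finally show ?thesis by (simp only: sum.insert[OF finite.emptyI] sum.empty empty_iff simp_thms add_0_right)
    qed
    finally show "c ((1/2) ^ k + u) = x k + (u / fact k) *\<^sub>R v" by (simp add: c_def)
  qed
qed

subsection \<open>Smoothness of partial derivatives along curves\<close>

text \<open>The mean value inequality is used twice, first for f' and then for f minus its tangent.
  The constant 1 in place of 1/2 is good enough.\<close>

lemma linearization_bound:
  fixes f :: "real \<Rightarrow> 'b::real_normed_vector"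
  assumes f: "\<And>t. (f has_vector_derivative f' t) (at t)" "\<And>t. (f' has_vector_derivative f'' t) (at t)"
    and "\<And>u. u \<in> {t..t+h} \<Longrightarrow> norm (f'' u) \<le> M" "h \<ge> 0"
  shows "norm (f (t + h) - f t - h *\<^sub>R f' t) \<le> h\<^sup>2 * M"
proof -
  have M: "M \<ge> 0" using assms(3)[of t] assms(4) norm_ge_zero by (metis atLeastAtMost_iff le_add_same_cancel1 order_refl order_trans)
  have B: "norm (f' u - f' t) \<le> h * M" if "u \<in> {t..t+h}" for u
  proof -
    have "norm (f' u - f' t) \<le> M * norm (u - t)"
    proof (rule differentiable_bound[of "{t..t+h}" _ "\<lambda>x y. y *\<^sub>R f'' x"])
      show "(f' has_derivative (\<lambda>y. y *\<^sub>R f'' x)) (at x within {t..t+h})" for x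
        using f(2)[of x] unfolding has_vector_derivative_def by (rule has_derivative_at_withinI)
      show "onorm (\<lambda>y. y *\<^sub>R f'' x) \<le> M" if "x \<in> {t..t+h}" for x
        using assms(3)[OF that] by (intro onorm_le) (simp add: mult_left_mono mult.commute[of M])
    qed (use that assms(4) in auto)
    also have "\<dots> \<le> M * h" using that M by (intro mult_left_mono) auto
    finally show ?thesis by (simp add: mult.commute)
  qed
  have "norm (f (t + h) - f t - (t + h - t) *\<^sub>R f' t) \<le> norm (t + h - t) * (h * M)"
    by (rule vector_differentiable_bound_linearization[of "{t..t+h}"])
       (use f(1) B assms(4) in \<open>auto intro: has_vector_derivative_at_within simp: closed_segment_eq_real_ivl\<close>)
  then show ?thesis using assms(4) by (simp add: power2_eq_square mult.assoc)
qed

text \<open>Induction on P. The number X = sup |D P| takes the role of M in the induction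
  hypothesis; linearizing D (P - 1) over a suitable step then bounds X by X / 2 plus the desired
  terms. Absorbing X / 2 requires X to be finite, which is where the assumed boundedness enters; C
  does not depend on those bounds.\<close>

lemma landau_kolmogorov:
  "\<exists>C>0. \<forall>(D :: nat \<Rightarrow> real \<Rightarrow> 'b::real_normed_vector) A M h.
     (\<forall>i<P. \<forall>t. (D i has_vector_derivative D (Suc i) t) (at t)) \<and> (\<forall>i\<le>P. bounded (range (D i))) \<and>
     (\<forall>t. norm (D 0 t) \<le> A) \<and> (\<forall>t. norm (D P t) \<le> M) \<and> h > 0 \<longrightarrow>
     (\<forall>p\<le>P. \<forall>t. norm (D p t) \<le> C * (A / h ^ p + M * h ^ (P - p)))"
proof (induction P)
  case 0
  have "norm x \<le> 1 * (A / h ^ 0 + M * h ^ (0 - 0))" if "norm x \<le> A" "norm x \<le> M" for x :: 'b and A M h :: real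
    using that norm_ge_zero[of x] by (simp del: norm_ge_zero) 
  then show ?case by (intro exI[of _ 1]) auto
next
  case (Suc P)
  obtain C where C: "C > 0" and IH: "\<forall>(D :: nat \<Rightarrow> real \<Rightarrow> 'b) A M h.
     (\<forall>i<P. \<forall>t. (D i has_vector_derivative D (Suc i) t) (at t)) \<and> (\<forall>i\<le>P. bounded (range (D i))) \<and>
     (\<forall>t. norm (D 0 t) \<le> A) \<and> (\<forall>t. norm (D P t) \<le> M) \<and> h > 0 \<longrightarrow>
     (\<forall>p\<le>P. \<forall>t. norm (D p t) \<le> C * (A / h ^ p + M * h ^ (P - p)))"
    using Suc.IH by (elim exE conjE)
  \<comment> \<open>The factor 2 + 8 C comes from inserting the bound for X below; the summand 1
    serves the top order p = Suc P.\<close>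
  define C' where "C' = C * (2 + 8 * C) + 1"
  have C': "C' > 0" using C by (auto simp: C'_def intro!: add_pos_pos mult_pos_pos)
  have "norm (D p t) \<le> C' * (A / h ^ p + M * h ^ (Suc P - p))"
    if D: "\<And>i t. i < Suc P \<Longrightarrow> (D i has_vector_derivative D (Suc i) t) (at t)"
      and bd: "\<And>i. i \<le> Suc P \<Longrightarrow> bounded (range (D i))"
      and A: "\<And>t. norm (D 0 t) \<le> A" and M: "\<And>t. norm (D (Suc P) t) \<le> M" and h: "h > 0" and p: "p \<le> Suc P"
    for D :: "nat \<Rightarrow> real \<Rightarrow> 'b" and A M h p t
  proof -
    have A0: "A \<ge> 0" using A[of 0] norm_ge_zero order_trans by blast
    have M0: "M \<ge> 0" using M[of 0] norm_ge_zero order_trans by blast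
    define X where "X = (SUP t. norm (D P t))"
    have bdd: "bdd_above (range (\<lambda>t. norm (D P t)))"
      using bd[of P] by (auto simp: bounded_iff bdd_above_def)
    have XX: "norm (D P t) \<le> X" for t unfolding X_def by (rule cSUP_upper[OF _ bdd]) simp
    have X0: "X \<ge> 0" using XX[of 0] norm_ge_zero order_trans by blast
    have low: "norm (D q t) \<le> C * (A / h ^ q + X * h ^ (P - q))" if "q \<le> P" for q t
      by (rule IH[rule_format]) (use D bd A XX h that in auto)
    have X: "X \<le> A / h ^ P + 8 * C * h * M"
    proof (cases P)
      case 0
      have "X \<le> A" unfolding X_def using A 0 by (intro cSUP_least) auto
      then show ?thesis using 0 C h M0 by (simp add: add_increasing2)
    next
      case (Suc Q)
      \<comment> \<open>With this step the coefficient of X, namely 2 C h / k, is exactly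
        1/2.\<close>
      define k where "k = 4 * C * h"
      have k: "k > 0" using C h by (simp add: k_def)
      have "norm (D P t) \<le> X / 2 + (A / h ^ P / 2 + 4 * C * h * M)" for t
      proof -
        have "norm (D Q (t + k) - D Q t - k *\<^sub>R D P t) \<le> k\<^sup>2 * M"
          by (rule linearization_bound[where f'' = "D (Suc P)"])
             (use D[of Q] D[of P] M k Suc in auto)
        moreover have "k *\<^sub>R D P t = D Q (t + k) - D Q t - (D Q (t + k) - D Q t - k *\<^sub>R D P t)" by simp
        ultimately have "norm (k *\<^sub>R D P t) \<le> norm (D Q (t + k)) + norm (D Q t) + k\<^sup>2 * M"
          by (smt (verit) norm_triangle_ineq4)
        also have "\<dots> \<le> 2 * (C * (A / h ^ Q + X * h)) + k\<^sup>2 * M"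
        proof -
          have "norm (D Q t) \<le> C * (A / h ^ Q + X * h)" for t
            using low[of Q t] Suc by simp
          from add_mono[OF this[of "t + k"] this[of t]] show ?thesis by (simp only: mult_2 add_right_mono)
        qed
        finally have "k * norm (D P t) \<le> 2 * (C * (A / h ^ Q + X * h)) + k\<^sup>2 * M" using k by simp
        also have "\<dots> = k * (X / 2 + (A / h ^ P / 2 + 4 * C * h * M))"
          using h C by (simp add: k_def Suc field_simps power2_eq_square)
        finally show ?thesis using k by simp
      qed
      then have "X \<le> X / 2 + (A / h ^ P / 2 + 4 * C * h * M)"
        unfolding X_def by (intro cSUP_least) auto
      then show ?thesis by simp
    qed
    show ?thesis
    proof (cases "p = Suc P")
      case True
      have "M \<le> 1 * (A / h ^ p + M * h ^ (Suc P - p))" using True A0 h by simp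
      also have "\<dots> \<le> C' * (A / h ^ p + M * h ^ (Suc P - p))"
        using A0 M0 h C by (intro mult_right_mono) (auto simp: C'_def)
      finally show ?thesis using M[of t] True by simp
    next
      case False
      then have p: "p \<le> P" using p by simp
      have "h ^ P = h ^ p * h ^ (P - p)" using p by (simp flip: power_add)
      then have e: "A / h ^ P * h ^ (P - p) = A / h ^ p" using h by simp
      have "norm (D p t) \<le> C * (A / h ^ p + X * h ^ (P - p))" using low[OF p] .
      also have "\<dots> \<le> C * (A / h ^ p + (A / h ^ P + 8 * C * h * M) * h ^ (P - p))"
        using X C h by (intro mult_left_mono add_left_mono mult_right_mono) auto
      also have "\<dots> = C * (2 * (A / h ^ p) + 8 * C * (M * h ^ (Suc P - p)))"
      proof -
        have "(A / h ^ P + 8 * C * h * M) * h ^ (P - p) = A / h ^ p + 8 * C * (M * h ^ (Suc P - p))"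
          unfolding distrib_right e using p by (simp add: Suc_diff_le)
        then show ?thesis by simp
      qed
      also have "\<dots> \<le> C * ((2 + 8 * C) * (A / h ^ p) + (2 + 8 * C) * (M * h ^ (Suc P - p)))"
        using C A0 M0 h by (intro mult_left_mono add_mono mult_right_mono) auto
      also have "\<dots> = C * (2 + 8 * C) * (A / h ^ p + M * h ^ (Suc P - p))" by (simp add: algebra_simps)
      also have "\<dots> \<le> C' * (A / h ^ p + M * h ^ (Suc P - p))"
        using C A0 M0 h by (intro mult_right_mono) (auto simp: C'_def)
      finally show ?thesis .
    qed
  qed
  then show ?case using C' by (intro exI[of _ C']) auto
qed

text \<open>The difference quotients at s k = 2^(-m k) differ by O(s k) in sup norm, while their derivatives
  are only known to be O(1 / s k). Interpolating against a derivative of order 2 m, at scale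
  h = 2^(-k), makes the derivatives of order below m converge geometrically.\<close>
lemma smooth_curve_partial_derivative:
  fixes G :: "real \<Rightarrow> real \<Rightarrow> 'c::banach"
  assumes Gs: "\<And>t. smooth_curve (\<lambda>s. G s t)" and Gt: "\<And>s. smooth_curve (G s)"
    and M2: "\<And>s t. \<bar>s\<bar> \<le> 1 \<Longrightarrow> norm (nderiv 2 (\<lambda>s. G s t) s) \<le> M2"
    and Bt: "\<And>p. \<exists>M. \<forall>s t. \<bar>s\<bar> \<le> 1 \<longrightarrow> norm (nderiv p (G s) t) \<le> M"
  shows "smooth_curve (\<lambda>t. vector_derivative (\<lambda>s. G s t) (at 0))"
proof -
  have "Ck j (\<lambda>t. vector_derivative (\<lambda>s. G s t) (at 0))" for j
  proof -
    let ?h = "\<lambda>t. vector_derivative (\<lambda>s. G s t) (at 0)"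
    define m where "m = Suc j"
    define P where "P = 2 * m"
    obtain C where C: "C > 0" and LK: "\<forall>(D :: nat \<Rightarrow> real \<Rightarrow> 'c) A M h.
     (\<forall>i<P. \<forall>t. (D i has_vector_derivative D (Suc i) t) (at t)) \<and> (\<forall>i\<le>P. bounded (range (D i))) \<and>
     (\<forall>t. norm (D 0 t) \<le> A) \<and> (\<forall>t. norm (D P t) \<le> M) \<and> h > 0 \<longrightarrow>
     (\<forall>p\<le>P. \<forall>t. norm (D p t) \<le> C * (A / h ^ p + M * h ^ (P - p)))"
      using landau_kolmogorov[of P, where 'b = 'c] by (elim exE conjE)
    define s :: "nat \<Rightarrow> real" where "s k = (1 / 2 ^ k) ^ m" for k
    have s: "0 < s k" "s k \<le> 1" for k by (auto simp: s_def intro!: power_le_one)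
    have sSuc: "s (Suc k) = s k / 2 ^ m" for k by (simp add: s_def power_divide power_mult_distrib)
    \<comment> \<open>These are the i-th t-derivatives of the difference quotients in s;
      \<open>q k 0\<close> tends to the s-derivative at 0.\<close>
    define q where "q k i t = inverse (s k) *\<^sub>R (nderiv i (G (s k)) t - nderiv i (G 0) t)" for k i t
    have qD: "(q k i has_vector_derivative q k (Suc i) t) (at t)" for k i t
      unfolding q_def
      by (intro bounded_linear.has_vector_derivative[OF bounded_linear_scaleR_right]
          has_vector_derivative_diff nderiv_has_vector_derivative Gt)
    have M20: "M2 \<ge> 0" using order_trans[OF norm_ge_zero M2[of 0 0]] by simp
    have qh: "norm (q k 0 t - ?h t) \<le> s k * M2" for k t
    proof -
      have "norm (G (0 + s k) t - G 0 t - s k *\<^sub>R nderiv 1 (\<lambda>s. G s t) 0) \<le> (s k)\<^sup>2 * M2"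
      proof (rule linearization_bound)
        show "((\<lambda>s. G s t) has_vector_derivative nderiv 1 (\<lambda>s. G s t) u) (at u)" for u
          using nderiv_has_vector_derivative[OF Gs, of 0] by simp
        show "(nderiv 1 (\<lambda>s. G s t) has_vector_derivative nderiv 2 (\<lambda>s. G s t) u) (at u)" for u
          using nderiv_has_vector_derivative[OF Gs, of 1] by (simp add: numeral_2_eq_2)
        show "norm (nderiv 2 (\<lambda>s. G s t) u) \<le> M2" if "u \<in> {0..0 + s k}" for u
          by (rule M2) (use that s[of k] in auto)
      qed (use s[of k] in simp)
      moreover have "nderiv 1 (\<lambda>s. G s t) 0 = ?h t" by (simp add: nderiv_Suc)
      moreover have "G (s k) t - G 0 t - s k *\<^sub>R ?h t = s k *\<^sub>R (q k 0 t - ?h t)"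
        using s(1)[of k] by (simp add: q_def scaleR_diff_right)
      ultimately have "s k * norm (q k 0 t - ?h t) \<le> s k * (s k * M2)"
        using s(1)[of k] by (simp add: power2_eq_square)
      then show ?thesis using s(1)[of k] by simp
    qed
    have s0: "s \<longlonglongrightarrow> 0"
    proof -
      have "(\<lambda>k. (1 / 2 ^ k :: real) ^ m) \<longlonglongrightarrow> 0 ^ m"
        using LIMSEQ_divide_realpow_zero[of 2 1] by (intro tendsto_power) auto
      moreover have "s = (\<lambda>k. (1 / 2 ^ k) ^ m)" by (rule ext) (rule s_def)
      moreover have "0 ^ m = (0::real)" by (simp add: m_def)
      ultimately show ?thesis by (simp only:)
    qed
    have qlim: "(\<lambda>k. q k 0 t) \<longlonglongrightarrow> ?h t" for t
    proof -
      have "(\<lambda>k. q k 0 t - ?h t) \<longlonglongrightarrow> 0"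
        by (rule Lim_null_comparison[of _ "\<lambda>k. s k * M2"])
           (use qh tendsto_mult_left_zero[OF s0] in auto)
      then show ?thesis by (simp add: LIM_zero_iff)
    qed
    \<comment> \<open>Telescoping turns the limit of the quotients into \<open>q 0 0\<close> plus a
      series, the form to which \<open>Ck_series\<close> applies.\<close>
    define E where "E k i t = q (Suc k) i t - q k i t" for k i t
    have ED: "(E k i has_vector_derivative E k (Suc i) t) (at t)" for k i t
      unfolding E_def by (intro has_vector_derivative_diff qD)
    have bq: "\<exists>M\<ge>0. \<forall>k t. norm (q k p t) \<le> M / s k" for p
    proof -
      obtain M where M: "\<And>s t. \<bar>s\<bar> \<le> 1 \<Longrightarrow> norm (nderiv p (G s) t) \<le> M" using Bt by blast
      have "norm (q k p t) \<le> 2 * M / s k" for k t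
      proof -
        have "norm (nderiv p (G (s k)) t - nderiv p (G 0) t) \<le> M + M"
          by (intro norm_triangle_le_diff add_mono M) (use s[of k] in auto)
        moreover have "norm (q k p t) = norm (nderiv p (G (s k)) t - nderiv p (G 0) t) / s k"
          using s(1)[of k] by (simp add: q_def divide_inverse mult.commute)
        ultimately show ?thesis using s(1)[of k] by (simp add: divide_right_mono)
      qed
      moreover have "M \<ge> 0" using order_trans[OF norm_ge_zero M[of 0 0]] by simp
      ultimately show ?thesis by (intro exI[of _ "2 * M"]) auto
    qed
    have bE: "\<exists>M\<ge>0. \<forall>k t. norm (E k p t) \<le> M / s k" for p
    proof -
      obtain M where M: "M \<ge> 0" "\<And>k t. norm (q k p t) \<le> M / s k" using bq by blast
      have "norm (E k p t) \<le> (M * 2 ^ m + M) / s k" for k t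
      proof -
        have "norm (E k p t) \<le> M / s (Suc k) + M / s k"
          unfolding E_def by (intro norm_triangle_le_diff add_mono M)
        then show ?thesis by (simp add: sSuc add_divide_distrib)
      qed
      then show ?thesis using M(1) by (intro exI[of _ "M * 2 ^ m + M"]) auto
    qed
    obtain MP where MP: "MP \<ge> 0" "\<And>k t. norm (E k P t) \<le> MP / s k" using bE by blast
    have E0: "norm (E k 0 t) \<le> 2 * M2 * s k" for k t
    proof -
      have "E k 0 t = (q (Suc k) 0 t - ?h t) - (q k 0 t - ?h t)" by (simp add: E_def)
      then have "norm (E k 0 t) \<le> s (Suc k) * M2 + s k * M2"
        by (metis norm_triangle_le_diff add_mono qh)
      also have "s (Suc k) * M2 \<le> s k * M2"
        using s(1)[of k] M20 by (intro mult_right_mono) (auto simp: sSuc divide_le_eq)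
      finally show ?thesis by (simp add: mult_ac)
    qed
    define A where "A = C * (2 * M2 + MP)"
    have EE: "norm (E k i t) \<le> A * (1 / 2) ^ k" if "i \<le> j" for k i t
    proof -
      define h :: real where "h = (1 / 2) ^ k"
      have h: "0 < h" "h \<le> 1" by (auto simp: h_def power_le_one)
      have sh: "s k = h ^ m" by (simp add: s_def h_def power_one_over)
      have "norm (E k i t) \<le> C * (2 * M2 * s k / h ^ i + MP / s k * h ^ (P - i))"
      proof (rule LK[rule_format])
        have "bounded (range (E k p))" for p
          using bE[of p] unfolding bounded_iff by blast
        then show "(\<forall>i<P. \<forall>t. (E k i has_vector_derivative E k (Suc i) t) (at t)) \<and>
          (\<forall>i\<le>P. bounded (range (E k i))) \<and> (\<forall>t. norm (E k 0 t) \<le> 2 * M2 * s k) \<and>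
          (\<forall>t. norm (E k P t) \<le> MP / s k) \<and> 0 < h"
          using ED E0 MP h by blast
      qed (use that in \<open>auto simp: P_def m_def\<close>)
      \<comment> \<open>As s k = h^m and P = 2 m, both terms scale like h^(m - i). With m = Suc j at
        least one factor h is left for every i up to j.\<close>
      also have "2 * M2 * s k / h ^ i + MP / s k * h ^ (P - i) = (2 * M2 + MP) * h ^ (m - i)"
      proof -
        have "m = i + (m - i)" "P - i = m + (m - i)" using that by (auto simp: P_def m_def)
        then have "h ^ m = h ^ i * h ^ (m - i)" "h ^ (P - i) = h ^ m * h ^ (m - i)"
          by (metis power_add)+
        then show ?thesis using h by (simp add: sh field_simps)
      qed
      also have "C * \<dots> \<le> C * ((2 * M2 + MP) * h ^ 1)"
        using that C M20 MP h by (intro mult_left_mono power_decreasing) (auto simp: m_def)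
      finally show ?thesis by (simp add: A_def h_def)
    qed
    have sumE: "(\<Sum>k. E k 0 t) = ?h t - q 0 0 t" for t
      unfolding E_def using telescope_sums[OF qlim] by (simp add: sums_iff)
    have "Ck j (\<lambda>t. \<Sum>k. E k 0 t)"
    proof (rule Ck_series[of j E])
      show "(E k i has_vector_derivative E k (Suc i) t) (at t)" for k i t by (rule ED)
      fix i assume "i \<le> j"
      then show "\<exists>M. summable M \<and> (\<forall>k t. norm (E k i t) \<le> M k)"
        using EE by (intro exI[of _ "\<lambda>k. A * (1 / 2) ^ k"]) (auto intro!: summable_mult summable_geometric)
    qed
    moreover have "Ck j (q 0 0)"
    proof -
      have "smooth_curve (\<lambda>t. inverse (s 0) *\<^sub>R (G (s 0) t - G 0 t))"
        by (intro smooth_curve_scaleR smooth_curve_diff Gt smooth_curve_const)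
      moreover have "q 0 0 = (\<lambda>t. inverse (s 0) *\<^sub>R (G (s 0) t - G 0 t))" by (rule ext) (simp add: q_def)
      ultimately show ?thesis by (simp add: smooth_curve_def)
    qed
    ultimately have "Ck j (\<lambda>t. (\<Sum>k. E k 0 t) + q 0 0 t)" by (rule Ck_add)
    then show ?thesis by (simp add: sumE)
  qed
  then show ?thesis by (simp add: smooth_curve_def)
qed

subsection \<open>Boman's theorem\<close>

definition curve_smooth :: "'b::real_normed_vector set \<Rightarrow> ('b \<Rightarrow> 'c::real_normed_vector) \<Rightarrow> bool" where
  "curve_smooth W f \<longleftrightarrow> (\<forall>c. smooth_curve c \<and> range c \<subseteq> W \<longrightarrow> smooth_curve (\<lambda>t. f (c t)))"

lemma curve_smoothI:
  "(\<And>c. smooth_curve c \<Longrightarrow> (\<And>t. c t \<in> W) \<Longrightarrow> smooth_curve (\<lambda>t. f (c t))) \<Longrightarrow> curve_smooth W f"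
  by (auto simp: curve_smooth_def)

lemma curve_smoothD:
  "curve_smooth W f \<Longrightarrow> smooth_curve c \<Longrightarrow> (\<And>t. c t \<in> W) \<Longrightarrow> smooth_curve (\<lambda>t. f (c t))"
  by (auto simp: curve_smooth_def)

lemma curve_smooth_subset: "curve_smooth W f \<Longrightarrow> V \<subseteq> W \<Longrightarrow> curve_smooth V f"
  by (auto simp: curve_smooth_def)

lemma curve_smooth_cong:
  assumes "\<And>x. x \<in> W \<Longrightarrow> f x = g x" "curve_smooth W f"
  shows "curve_smooth W g"
proof (rule curve_smoothI)
  fix c :: "real \<Rightarrow> 'a" assume c: "smooth_curve c" "\<And>t. c t \<in> W"
  have "(\<lambda>t. f (c t)) = (\<lambda>t. g (c t))" using assms(1) c(2) by auto
  then show "smooth_curve (\<lambda>t. g (c t))" using curve_smoothD[OF assms(2) c] by simp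
qed

lemma curve_smooth_real_iff: "curve_smooth UNIV (c :: real \<Rightarrow> 'b::real_normed_vector) \<longleftrightarrow> smooth_curve c"
proof
  show "curve_smooth UNIV c" if "smooth_curve c"
    by (rule curve_smoothI) (rule smooth_curve_compose[OF that])
qed (use curve_smoothD[of UNIV c "\<lambda>t. t"] in auto)

text \<open>Precomposition with this map turns a map given near x into a globally defined one with the
  same germ at x.\<close>
definition retract_ball :: "'b::real_inner \<Rightarrow> real \<Rightarrow> 'b \<Rightarrow> 'b" where
  "retract_ball x r y = x + smooth_step ((y - x) \<bullet> (y - x) / r\<^sup>2) *\<^sub>R (y - x)"

lemma retract_ball_simps:
  assumes "r > 0"
  shows "dist x y \<le> r \<Longrightarrow> retract_ball x r y = y" "2 * r \<le> dist x y \<Longrightarrow> retract_ball x r y = x"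
    and "dist x (retract_ball x r y) \<le> 2 * r"
proof -
  have e: "(y - x) \<bullet> (y - x) / r\<^sup>2 = (dist x y / r)\<^sup>2"
    by (metis dist_norm norm_minus_commute power2_norm_eq_inner power_divide)
  show "retract_ball x r y = y" if "dist x y \<le> r"
  proof -
    have "(dist x y / r)\<^sup>2 \<le> 1" using that assms by (intro power_le_one) auto
    then show ?thesis by (simp add: retract_ball_def e smooth_step_simps)
  qed
  show far: "retract_ball x r y = x" if "2 * r \<le> dist x y"
  proof -
    have "2\<^sup>2 \<le> (dist x y / r)\<^sup>2" using that assms by (intro power_mono) (auto simp: field_simps)
    then show ?thesis by (simp add: retract_ball_def e smooth_step_simps)
  qed
  show "dist x (retract_ball x r y) \<le> 2 * r"
  proof (cases "2 * r \<le> dist x y")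
    case False
    have "dist x (retract_ball x r y) = smooth_step ((dist x y / r)\<^sup>2) * dist x y"
      by (simp add: retract_ball_def e dist_norm norm_minus_commute smooth_step_bounds)
    also have "\<dots> \<le> 1 * dist x y" by (intro mult_right_mono smooth_step_bounds) auto
    finally show ?thesis using False by simp
  qed (use far assms in auto)
qed

lemma smooth_curve_retract_ball: "smooth_curve c \<Longrightarrow> smooth_curve (\<lambda>t. retract_ball x r (c t))"
  unfolding retract_ball_def divide_inverse
  by (intro smooth_curve_add smooth_curve_scaleR smooth_curve_smooth_step smooth_curve_mult
      smooth_curve_inner smooth_curve_diff smooth_curve_const)

text \<open>Test curves must stay in W for all time, which straight lines and the curves from
  \<open>smooth_curve_through\<close> need not do. Replacing f by F, with the same germ at x,
  removes this constraint.\<close>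

lemma curve_smooth_localize:
  fixes x :: "'b::real_inner"
  assumes "curve_smooth W f" "open W" "x \<in> W"
  obtains F r where "curve_smooth UNIV F" "r > 0" "cball x r \<subseteq> W" "\<And>y. y \<in> cball x r \<Longrightarrow> F y = f y"
proof -
  obtain e where e: "e > 0" "cball x e \<subseteq> W" using assms open_contains_cball by blast
  define r where "r = e / 2"
  have r: "r > 0" "cball x (2 * r) \<subseteq> W" using e by (auto simp: r_def)
  have "curve_smooth UNIV (\<lambda>y. f (retract_ball x r y))"
  proof (rule curve_smoothI)
    fix c :: "real \<Rightarrow> 'b" assume c: "smooth_curve c"
    have "retract_ball x r (c t) \<in> W" for t
      using r retract_ball_simps(3)[OF r(1), of x "c t"] by auto
    then show "smooth_curve (\<lambda>t. f (retract_ball x r (c t)))"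
      by (rule curve_smoothD[OF assms(1) smooth_curve_retract_ball[OF c]])
  qed
  then show ?thesis by (rule that[of _ r]) (use r in \<open>auto simp: retract_ball_simps(1)\<close>)
qed

text \<open>A curve in the union stays in one S i only for a short time and so is no test curve for
  it; localizing f at the current point repairs this.\<close>

lemma curve_smooth_Union:
  fixes f :: "'b::real_inner \<Rightarrow> 'c::real_normed_vector"
  assumes "\<And>i. i \<in> I \<Longrightarrow> open (S i)" "\<And>i. i \<in> I \<Longrightarrow> curve_smooth (S i) f"
  shows "curve_smooth (\<Union>i\<in>I. S i) f"
proof (rule curve_smoothI, rule smooth_curve_local)
  fix c :: "real \<Rightarrow> 'b" and t assume c: "smooth_curve c" "\<And>t. c t \<in> (\<Union>i\<in>I. S i)"
  then obtain i where i: "i \<in> I" "c t \<in> S i" by blast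
  obtain F r where F: "curve_smooth UNIV F" "r > 0" "\<And>y. y \<in> cball (c t) r \<Longrightarrow> F y = f y"
    using curve_smooth_localize[OF assms(2,1) i(2)] i(1) by metis
  have "open (c -` ball (c t) r)"
    using continuous_open_vimage[of "ball (c t) r" c] smooth_curve_continuous[OF c(1), of UNIV]
    by (simp add: continuous_on_eq_continuous_at)
  moreover have "smooth_curve (\<lambda>t. F (c t))" using curve_smoothD[OF F(1) c(1)] by simp
  ultimately show "\<exists>g S. open S \<and> t \<in> S \<and> smooth_curve g \<and> (\<forall>u\<in>S. f (c u) = g u)"
    using F by (intro exI[of _ "\<lambda>t. F (c t)"] exI[of _ "c -` ball (c t) r"]) auto
qed

text \<open>At a discontinuity there are points y k within 1 / k! of x whose values stay away from F
  x. A smooth curve through them, with v = 0, would make F discontinuous along the curve.\<close>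

lemma curve_smooth_isCont:
  fixes f :: "'b::{banach,real_inner} \<Rightarrow> 'c::real_normed_vector"
  assumes "curve_smooth W f" "open W" "x \<in> W"
  shows "isCont f x"
proof -
  obtain F r where F: "curve_smooth UNIV F" "r > 0" "\<And>y. y \<in> cball x r \<Longrightarrow> F y = f y"
    using curve_smooth_localize[OF assms] by metis
  have "isCont F x"
  proof (rule ccontr)
    assume "\<not> isCont F x"
    then obtain e where e: "e > 0" "\<And>d. d > 0 \<Longrightarrow> \<exists>y. dist y x < d \<and> \<not> dist (F y) (F x) < e"
      unfolding continuous_at_eps_delta by blast
    have "\<exists>y. dist y x < 1 / fact k \<and> \<not> dist (F y) (F x) < e" for k :: nat by (rule e(2)) simp
    then obtain y where y: "\<And>k::nat. dist (y k) x < 1 / fact k" "\<And>k. \<not> dist (F (y k)) (F x) < e" by metis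
    have "norm (y k - x) \<le> 1 / fact k" for k using y(1)[of k] by (simp add: dist_norm)
    then obtain c where c: "smooth_curve c" "c 0 = x"
        "\<And>k u. \<bar>u\<bar> < (1/2) ^ k / 8 \<Longrightarrow> c ((1/2) ^ k + u) = y k + (u / fact k) *\<^sub>R 0"
      by (rule smooth_curve_through[of y x 0]) (rule that)
    have c': "c ((1/2) ^ k) = y k" for k using c(3)[of 0 k] by simp
    have "smooth_curve (\<lambda>t. F (c t))" using curve_smoothD[OF F(1) c(1)] by simp
    then have "isCont (\<lambda>t. F (c t)) 0"
      using smooth_curve_continuous[of _ UNIV] by (auto simp: continuous_on_eq_continuous_at)
    moreover have "(\<lambda>k. (1/2::real) ^ k) \<longlonglongrightarrow> 0" by (rule LIMSEQ_power_zero) simp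
    ultimately have "(\<lambda>k. F (c ((1/2) ^ k))) \<longlonglongrightarrow> F (c 0)"
      by (rule isCont_tendsto_compose)
    then have "(\<lambda>k. F (y k)) \<longlonglongrightarrow> F x" by (simp add: c' c(2))
    then show False using y(2) e(1) by (meson LIMSEQ_iff_nz lim_sequentially order_refl)
  qed
  moreover have "\<forall>\<^sub>F y in nhds x. F y = f y"
    unfolding eventually_nhds_metric using F(2,3) by (auto intro!: exI[of _ r] simp: dist_commute)
  ultimately show ?thesis using isCont_cong[of F f x] by simp
qed

text \<open>If the p-th derivatives in direction v were unbounded on Q, a curve running through bad
  points in direction v would have unbounded p-th derivatives of H along it on the compact interval
  [0, 1].\<close>

lemma directional_nderiv_bounded:
  fixes H :: "'e::euclidean_space \<Rightarrow> 'c::real_normed_vector"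
  assumes H: "curve_smooth UNIV H" and "compact Q"
  shows "\<exists>M. \<forall>a\<in>Q. norm (nderiv p (\<lambda>u. H (a + u *\<^sub>R v)) 0) \<le> M"
proof (rule ccontr)
  let ?d = "\<lambda>a. nderiv p (\<lambda>u. H (a + u *\<^sub>R v)) 0"
  assume "\<nexists>M. \<forall>a\<in>Q. norm (?d a) \<le> M"
  \<comment> \<open>The curve below passes its k-th point with velocity v / k!, which costs the
    factor (1 / k!)^p; the threshold k (k!)^p leaves more than k after that.\<close>
  then have "\<exists>a\<in>Q. norm (?d a) > real k * fact k ^ p" for k by (meson not_le)
  then obtain a where a: "\<And>k. a k \<in> Q" "\<And>k. norm (?d (a k)) > real k * fact k ^ p" by metis
  obtain l r where r: "l \<in> Q" "strict_mono r" "(a \<circ> r) \<longlonglongrightarrow> l"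
    using \<open>compact Q\<close> a(1) unfolding compact_def by metis
  \<comment> \<open>A further selection gives convergence at the rate 1 / k!; the indices stay at
    least k, so the thresholds survive.\<close>
  have "\<exists>n\<ge>k. norm (a (r n) - l) \<le> 1 / fact k" for k
  proof -
    have "\<forall>\<^sub>F n in sequentially. dist ((a \<circ> r) n) l < 1 / fact k" by (rule tendstoD[OF r(3)]) simp
    then obtain N where "\<And>n. n \<ge> N \<Longrightarrow> dist ((a \<circ> r) n) l < 1 / fact k"
      by (auto simp: eventually_sequentially)
    then show ?thesis by (intro exI[of _ "max k N"]) (auto simp: dist_norm less_imp_le)
  qed
  then obtain n where n: "\<And>k. n k \<ge> k" "\<And>k. norm (a (r (n k)) - l) \<le> 1 / fact k" by metis
  define x where "x k = a (r (n k))" for k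
  have large: "norm (?d (x k)) > real k * fact k ^ p" for k
  proof -
    have "k \<le> r (n k)" using n(1)[of k] seq_suble[OF r(2), of "n k"] by linarith
    then have "real k * fact k ^ p \<le> real (r (n k)) * fact (r (n k)) ^ p"
      by (intro mult_mono power_mono fact_mono) auto
    then show ?thesis using a(2)[of "r (n k)"] by (simp add: x_def)
  qed
  have "norm (x k - l) \<le> 1 / fact k" for k using n(2) by (simp add: x_def)
  then obtain c where c: "smooth_curve c" "c 0 = l"
      "\<And>k u. \<bar>u\<bar> < (1/2) ^ k / 8 \<Longrightarrow> c ((1/2) ^ k + u) = x k + (u / fact k) *\<^sub>R v"
    by (rule smooth_curve_through[of x l v]) (rule that)
  have Hc: "smooth_curve (\<lambda>t. H (c t))" using curve_smoothD[OF H c(1)] by simp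
  have k: "norm (nderiv p (\<lambda>t. H (c t)) ((1/2) ^ k)) > real k" for k
  proof -
    have sm: "smooth_curve (\<lambda>u. H (x k + u *\<^sub>R v))"
      by (rule curve_smoothD[OF H]) (auto intro!: smooth_curve_add smooth_curve_scaleR)
    have "nderiv p (\<lambda>t. H (c t)) ((1/2) ^ k) = nderiv p (\<lambda>u. H (c ((1/2) ^ k + 1 * u))) 0"
      using nderiv_affine[OF Hc, of p "(1/2) ^ k" 1 0] by simp
    also have "\<dots> = nderiv p (\<lambda>u. H (x k + (0 + inverse (fact k) * u) *\<^sub>R v)) 0"
    proof (rule nderiv_local[of "ball 0 ((1/2) ^ k / 8)"])
      fix u :: real assume "u \<in> ball 0 ((1/2) ^ k / 8)"
      then have "c ((1/2) ^ k + u) = x k + (u / fact k) *\<^sub>R v" by (intro c(3)) simp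
      moreover have "u / fact k = 0 + inverse (fact k) * u" by (simp add: field_simps)
      ultimately show "H (c ((1/2) ^ k + 1 * u)) = H (x k + (0 + inverse (fact k) * u) *\<^sub>R v)"
        by (simp only: mult_1_left)
    qed auto
    also have "\<dots> = inverse (fact k) ^ p *\<^sub>R ?d (x k)"
      using nderiv_affine[OF sm, of p 0 "inverse (fact k)" 0] by simp
    finally show ?thesis using large[of k] by (simp add: field_simps power_inverse)
  qed
  have "bounded (nderiv p (\<lambda>t. H (c t)) ` {0..1})"
    by (intro compact_imp_bounded compact_continuous_image smooth_curve_continuous smooth_curve_nderiv Hc) auto
  then obtain M where M: "\<And>t. t \<in> {0..1} \<Longrightarrow> norm (nderiv p (\<lambda>t. H (c t)) t) \<le> M"
    unfolding bounded_iff by blast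
  obtain k where "real k > M" using reals_Archimedean2 by blast
  moreover have "norm (nderiv p (\<lambda>t. H (c t)) ((1/2) ^ k)) \<le> M"
    by (rule M) (auto simp: power_le_one)
  ultimately show False using k[of k] by simp
qed

section \<open>Partial derivatives of maps that are smooth along curves\<close>

lemma pd_local:
  assumes "open S" "\<And>y. y \<in> S \<Longrightarrow> f y = g y" "x \<in> S"
  shows "pd b f x = pd b g x"
proof -
  have "open ((\<lambda>t. x + t *\<^sub>R b) -` S)"
    by (rule continuous_open_vimage[OF assms(1)]) (auto intro!: continuous_intros)
  then have "eventually (\<lambda>t. x + t *\<^sub>R b \<in> S) (nhds 0)"
    using assms(3) by (auto simp: eventually_nhds)
  then show ?thesis
    unfolding pd_def using assms
    by (intro vector_derivative_cong_eq) (auto elim!: eventually_mono)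
qed

text \<open>Along c the partial derivative is the s-derivative at 0 of F (c t + s b), a problem in
  two real variables. \<open>smooth_curve_partial_derivative\<close> settles it once its bounds hold
  for all t.\<close>

lemma curve_smooth_pd:
  fixes f :: "'b::euclidean_space \<Rightarrow> 'c::banach"
  assumes "open W" "curve_smooth W f"
  shows "curve_smooth W (pd b f)"
proof (rule curve_smoothI, rule smooth_curve_local)
  fix c :: "real \<Rightarrow> 'b" and t0 assume c: "smooth_curve c" "\<And>t. c t \<in> W"
  obtain F r where F: "curve_smooth UNIV F" "r > 0" "\<And>y. y \<in> cball (c t0) r \<Longrightarrow> F y = f y"
    using curve_smooth_localize[OF assms(2,1) c(2)] by metis
  \<comment> \<open>Reparametrizing time by \<sigma> leaves the curve alone near t0 and freezes it
    for |t - t0| >= 2, so bounds on the compact set \<open>Q\<close> below yield bounds for all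
    t.\<close>
  define \<sigma> :: "real \<Rightarrow> real" where "\<sigma> = retract_ball t0 1"
  have \<sigma>: "smooth_curve \<sigma>" unfolding \<sigma>_def
    using smooth_curve_retract_ball[of "\<lambda>t. t" t0 1] by simp
  have \<sigma>_near: "\<sigma> t = t" if "\<bar>t - t0\<bar> \<le> 1" for t
    using that retract_ball_simps(1)[of 1 t0 t] by (simp add: \<sigma>_def dist_real_def abs_minus_commute)
  have \<sigma>_far: "\<sigma> t = t0" if "2 \<le> \<bar>t - t0\<bar>" for t
    using that retract_ball_simps(2)[of 1 t0 t] by (simp add: \<sigma>_def dist_real_def abs_minus_commute)
  define H where "H p = F (c (\<sigma> (snd p)) + fst p *\<^sub>R b)" for p
  have H: "curve_smooth UNIV H"
  proof (rule curve_smoothI)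
    fix d :: "real \<Rightarrow> real \<times> real" assume d: "smooth_curve d"
    show "smooth_curve (\<lambda>t. H (d t))" unfolding H_def
      by (rule curve_smoothD[OF F(1)])
         (auto intro!: smooth_curve_add smooth_curve_scaleR smooth_curve_fst d smooth_curve_compose[OF c(1)]
           smooth_curve_compose[OF \<sigma>] smooth_curve_snd)
  qed
  define G where "G s t = H (s, t)" for s t
  define Q where "Q = {-1..1::real} \<times> {t0 - 2..t0 + 2}"
  have Q: "compact Q" unfolding Q_def by (intro compact_Times) auto
  have Gs: "smooth_curve (\<lambda>s. G s t)" for t
    unfolding G_def by (rule curve_smoothD[OF H]) (auto intro!: smooth_curve_Pair)
  have Gt: "smooth_curve (G s)" for s
    unfolding G_def by (rule curve_smoothD[OF H]) (auto intro!: smooth_curve_Pair)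
  have far: "G s t = G s t0" if "2 \<le> \<bar>t - t0\<bar>" for s t
    using that by (simp add: G_def H_def \<sigma>_far \<sigma>_near)
  have "smooth_curve (\<lambda>t. vector_derivative (\<lambda>s. G s t) (at 0))"
  proof -
    obtain M2 where M2: "\<And>a. a \<in> Q \<Longrightarrow> norm (nderiv 2 (\<lambda>u. H (a + u *\<^sub>R (1, 0))) 0) \<le> M2"
      using directional_nderiv_bounded[OF H Q] by metis
    have near2: "norm (nderiv 2 (\<lambda>s. G s t) s) \<le> M2" if "(s, t) \<in> Q" for s t
      using M2[OF that] nderiv_affine[OF Gs[of t], of 2 s 1 0] by (simp add: G_def)
    have bound2: "norm (nderiv 2 (\<lambda>s. G s t) s) \<le> M2" if s: "\<bar>s\<bar> \<le> 1" for s t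
    proof (cases "\<bar>t - t0\<bar> \<le> 2")
      case True
      then show ?thesis using s by (intro near2) (auto simp: Q_def)
    next
      case False
      then have "(\<lambda>s. G s t) = (\<lambda>s. G s t0)" using far by auto
      then show ?thesis using near2[of s t0] s by (auto simp: Q_def abs_le_iff)
    qed
    have bound: "\<exists>M. \<forall>s t. \<bar>s\<bar> \<le> 1 \<longrightarrow> norm (nderiv p (G s) t) \<le> M" for p
    proof -
      obtain M where M: "\<And>a. a \<in> Q \<Longrightarrow> norm (nderiv p (\<lambda>u. H (a + u *\<^sub>R (0, 1))) 0) \<le> M"
        using directional_nderiv_bounded[OF H Q] by metis
      obtain M0 where M0: "\<And>a. a \<in> Q \<Longrightarrow> norm (nderiv 0 (\<lambda>u. H (a + u *\<^sub>R (0, 1))) 0) \<le> M0"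
        using directional_nderiv_bounded[OF H Q] by metis
      have "norm (nderiv p (G s) t) \<le> max M M0" if s: "\<bar>s\<bar> \<le> 1" for s t
      proof (cases "\<bar>t - t0\<bar> \<le> 2")
        case True
        then have "norm (nderiv p (\<lambda>u. H ((s, t) + u *\<^sub>R (0, 1))) 0) \<le> M"
          using s by (intro M) (auto simp: Q_def)
        then show ?thesis using nderiv_affine[OF Gt[of s], of p t 1 0] by (simp add: G_def le_max_iff_disj)
      next
        case False
        have "nderiv p (G s) t = nderiv p (\<lambda>_. G s t0) t"
          by (rule nderiv_local[of "- cball t0 2"])
             (use False far[of _ s] in \<open>auto simp: dist_real_def abs_minus_commute\<close>)
        then have "norm (nderiv p (G s) t) \<le> norm (G s t0)" by (simp add: nderiv_const)
        also have "\<dots> \<le> M0" using M0[of "(s, t0)"] s by (auto simp: Q_def G_def abs_le_iff)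
        finally show ?thesis by simp
      qed
      then show ?thesis by blast
    qed
    show ?thesis by (rule smooth_curve_partial_derivative[OF Gs Gt bound2 bound])
  qed
  moreover have "vector_derivative (\<lambda>s. G s t) (at 0) = pd b F (c (\<sigma> t))" for t
    by (simp add: pd_def G_def H_def)
  ultimately have sm: "smooth_curve (\<lambda>t. pd b F (c (\<sigma> t)))" by simp
  let ?S = "c -` ball (c t0) r \<inter> ball t0 1"
  have "open ?S"
    using continuous_open_vimage[of "ball (c t0) r" c] smooth_curve_continuous[OF c(1), of UNIV]
    by (simp add: continuous_on_eq_continuous_at open_Int)
  moreover have "pd b f (c u) = pd b F (c (\<sigma> u))" if "u \<in> ?S" for u
  proof -
    have "\<sigma> u = u" using that by (intro \<sigma>_near) (simp add: dist_real_def abs_minus_commute)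
    moreover have "pd b f (c u) = pd b F (c u)"
      by (rule pd_local[of "ball (c t0) r"]) (use that F(3) in auto)
    ultimately show ?thesis by simp
  qed
  ultimately show "\<exists>g S. open S \<and> t0 \<in> S \<and> smooth_curve g \<and> (\<forall>u\<in>S. pd b f (c u) = g u)"
    using sm F(2) by (intro exI[of _ "\<lambda>t. pd b F (c (\<sigma> t))"] exI[of _ ?S]) auto
qed

lemma curve_smooth_pdl:
  fixes f :: "'b::euclidean_space \<Rightarrow> 'c::banach"
  shows "open W \<Longrightarrow> curve_smooth W f \<Longrightarrow> curve_smooth W (pdl bs f)"
  by (induction bs) (auto intro: curve_smooth_pd)

lemma curve_smooth_has_pd:
  fixes f :: "'b::euclidean_space \<Rightarrow> 'c::real_normed_vector"
  assumes "open W" "curve_smooth W f" "x \<in> W"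
  shows "((\<lambda>t. f (x + t *\<^sub>R b)) has_vector_derivative pd b f x) (at 0)"
proof -
  obtain F r where F: "curve_smooth UNIV F" "r > 0" "\<And>y. y \<in> cball x r \<Longrightarrow> F y = f y"
    using curve_smooth_localize[OF assms(2,1,3)] by metis
  have "smooth_curve (\<lambda>t. F (x + t *\<^sub>R b))"
    by (rule curve_smoothD[OF F(1)]) (auto intro!: smooth_curve_add smooth_curve_scaleR)
  then have "((\<lambda>t. F (x + t *\<^sub>R b)) has_vector_derivative pd b F x) (at 0)"
    unfolding pd_def by (rule smooth_curve_has_vector_derivative)
  moreover have "open ((\<lambda>t. x + t *\<^sub>R b) -` ball x r)"
    by (rule continuous_open_vimage) (auto intro!: continuous_intros)
  ultimately have "((\<lambda>t. f (x + t *\<^sub>R b)) has_vector_derivative pd b F x) (at 0)"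
    by (rule has_vector_derivative_transform_within_open) (use F in auto)
  moreover have "pd b F x = pd b f x" by (rule pd_local[of "ball x r"]) (use F in auto)
  ultimately show ?thesis by simp
qed

section \<open>Continuous partial derivatives and the chain rule\<close>

lemma pd_line_has_vector_derivative:
  assumes "(\<lambda>t. f (z + u *\<^sub>R b + t *\<^sub>R b)) differentiable (at (0::real))"
  shows "((\<lambda>t. f (z + t *\<^sub>R b)) has_vector_derivative pd b f (z + u *\<^sub>R b)) (at u)"
proof -
  have "((\<lambda>t. f (z + u *\<^sub>R b + t *\<^sub>R b)) has_vector_derivative pd b f (z + u *\<^sub>R b)) (at (u - u))"
    using assms unfolding pd_def by (simp add: vector_derivative_works)
  moreover have "((\<lambda>t. t - u) has_vector_derivative 1) (at u)"
    by (auto intro!: derivative_eq_intros)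
  ultimately have "((\<lambda>t. f (z + u *\<^sub>R b + (t - u) *\<^sub>R b)) has_vector_derivative 1 *\<^sub>R pd b f (z + u *\<^sub>R b)) (at u)"
    using vector_diff_chain_at[of "\<lambda>t. t - u" 1 u "\<lambda>t. f (z + u *\<^sub>R b + t *\<^sub>R b)"] by (simp add: o_def)
  then show ?thesis by (simp add: algebra_simps)
qed

text \<open>The coordinates are changed one at a time. Each change is compared with its linear part
  by the mean value inequality, the partial derivative being nearly constant near x.\<close>

lemma has_derivative_if_continuous_pd:
  fixes f :: "'b::euclidean_space \<Rightarrow> 'c::real_normed_vector"
  assumes "open S" "x \<in> S"
    and cont: "\<And>b. b \<in> Basis \<Longrightarrow> continuous_on S (pd b f)"
    and diff: "\<And>b y. b \<in> Basis \<Longrightarrow> y \<in> S \<Longrightarrow> (\<lambda>t::real. f (y + t *\<^sub>R b)) differentiable (at 0)"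
  shows "(f has_derivative (\<lambda>h. \<Sum>b\<in>Basis. (h \<bullet> b) *\<^sub>R pd b f x)) (at x)"
  unfolding has_derivative_at_alt
proof (intro conjI allI impI)
  show "bounded_linear (\<lambda>h. \<Sum>b\<in>Basis. (h \<bullet> b) *\<^sub>R pd b f x)"
    by (intro bounded_linear_sum bounded_linear_scaleR_const bounded_linear_inner_left)
  fix e :: real assume e: "e > 0"
  \<comment> \<open>Each of the \<open>DIM('b)\<close> coordinate changes may cost e' times the norm
    of h.\<close>
  define e' where "e' = e / DIM('b)"
  have e': "e' > 0" using e by (simp add: e'_def)
  have "\<forall>\<^sub>F z in nhds x. z \<in> S \<and> (\<forall>b\<in>Basis. dist (pd b f z) (pd b f x) < e')"
  proof (intro eventually_conj eventually_ball_finite ballI)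
    fix b :: 'b assume "b \<in> Basis"
    then have "isCont (pd b f) x" using cont assms(1,2) continuous_on_eq_continuous_at by blast
    then have "(pd b f \<longlongrightarrow> pd b f x) (nhds x)" by (simp add: continuous_at tendsto_nhds_iff isCont_def)
    then show "\<forall>\<^sub>F z in nhds x. dist (pd b f z) (pd b f x) < e'" using e' by (rule tendstoD)
  qed (use assms in \<open>auto simp: eventually_nhds\<close>)
  then obtain d where d: "d > 0" "\<And>z. dist z x < d \<Longrightarrow> z \<in> S"
      "\<And>z b. dist z x < d \<Longrightarrow> b \<in> Basis \<Longrightarrow> dist (pd b f z) (pd b f x) < e'"
    unfolding eventually_nhds_metric by blast
  have main: "norm (f (x + (\<Sum>b\<in>A. (h \<bullet> b) *\<^sub>R b)) - f x - (\<Sum>b\<in>A. (h \<bullet> b) *\<^sub>R pd b f x))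
      \<le> card A * e' * norm h" if h: "norm h < d" and "A \<subseteq> Basis" for h A
    using finite_subset[OF that(2) finite_Basis] that(2)
  proof (induction A rule: finite_induct)
    case (insert b A)
    have b: "b \<in> Basis" using insert by auto
    define z where "z = x + (\<Sum>b\<in>A. (h \<bullet> b) *\<^sub>R b)"
    \<comment> \<open>Relative to x, an intermediate point has coordinates no larger in absolute
      value than those of h, so it stays in the ball of radius d.\<close>
    have near: "dist (z + u *\<^sub>R b) x < d" if "\<bar>u\<bar> \<le> \<bar>h \<bullet> b\<bar>" for u
    proof -
      have "norm ((\<Sum>b\<in>A. (h \<bullet> b) *\<^sub>R b) + u *\<^sub>R b) \<le> norm h"
      proof (rule norm_le_componentwise)
        fix i :: 'b assume i: "i \<in> Basis"
        have "(\<Sum>b\<in>A. (h \<bullet> b) *\<^sub>R b) \<bullet> i = (\<Sum>b\<in>A. if b = i then h \<bullet> i else 0)"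
          unfolding inner_sum_left using insert.prems i by (intro sum.cong) (auto simp: inner_Basis)
        also have "\<dots> = (if i \<in> A then h \<bullet> i else 0)" using insert.hyps by simp
        finally show "\<bar>((\<Sum>b\<in>A. (h \<bullet> b) *\<^sub>R b) + u *\<^sub>R b) \<bullet> i\<bar> \<le> \<bar>h \<bullet> i\<bar>"
          using that i b insert.hyps by (auto simp: inner_add_left inner_Basis)
      qed
      then show ?thesis using h by (simp add: z_def dist_norm add.assoc)
    qed
    define g where "g u = f (z + u *\<^sub>R b) - u *\<^sub>R pd b f x" for u
    have "norm (g (h \<bullet> b) - g 0) \<le> e' * norm (h \<bullet> b - 0)"
    proof (rule differentiable_bound[of "closed_segment 0 (h \<bullet> b)" g "\<lambda>u k. k *\<^sub>R (pd b f (z + u *\<^sub>R b) - pd b f x)"])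
      fix u assume "u \<in> closed_segment 0 (h \<bullet> b)"
      then have u: "\<bar>u\<bar> \<le> \<bar>h \<bullet> b\<bar>" by (auto simp: closed_segment_eq_real_ivl split: if_splits)
      have "((\<lambda>u. f (z + u *\<^sub>R b)) has_vector_derivative pd b f (z + u *\<^sub>R b)) (at u)"
        by (rule pd_line_has_vector_derivative) (intro diff b d(2) near u)
      then have "(g has_vector_derivative pd b f (z + u *\<^sub>R b) - pd b f x) (at u)"
        unfolding g_def by (auto intro!: derivative_eq_intros)
      then show "(g has_derivative (\<lambda>k. k *\<^sub>R (pd b f (z + u *\<^sub>R b) - pd b f x))) (at u within closed_segment 0 (h \<bullet> b))"
        unfolding has_vector_derivative_def by (rule has_derivative_at_withinI)
      have "norm (pd b f (z + u *\<^sub>R b) - pd b f x) \<le> e'"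
        using d(3)[OF near[OF u] b] by (simp add: dist_norm)
      then show "onorm (\<lambda>k. k *\<^sub>R (pd b f (z + u *\<^sub>R b) - pd b f x)) \<le> e'"
        by (intro onorm_le) (simp add: mult_left_mono mult.commute[of e'])
    qed auto
    also have "\<dots> \<le> e' * norm h" using e' b by (intro mult_left_mono) (auto simp: Basis_le_norm)
    finally have "norm (f (z + (h \<bullet> b) *\<^sub>R b) - f z - (h \<bullet> b) *\<^sub>R pd b f x) \<le> e' * norm h"
      by (simp add: g_def algebra_simps)
    moreover have "norm (f z - f x - (\<Sum>b\<in>A. (h \<bullet> b) *\<^sub>R pd b f x)) \<le> card A * e' * norm h"
      using insert unfolding z_def by auto
    ultimately have "norm ((f (z + (h \<bullet> b) *\<^sub>R b) - f z - (h \<bullet> b) *\<^sub>R pd b f x) +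
        (f z - f x - (\<Sum>b\<in>A. (h \<bullet> b) *\<^sub>R pd b f x))) \<le> e' * norm h + card A * e' * norm h"
      by (rule norm_triangle_mono)
    then show ?case using insert.hyps by (simp add: z_def algebra_simps)
  qed simp
  show "\<exists>d>0. \<forall>y. norm (y - x) < d \<longrightarrow>
      norm (f y - f x - (\<Sum>b\<in>Basis. ((y - x) \<bullet> b) *\<^sub>R pd b f x)) \<le> e * norm (y - x)"
  proof (intro exI[of _ d] conjI allI impI d(1))
    fix y assume y: "norm (y - x) < d"
    show "norm (f y - f x - (\<Sum>b\<in>Basis. ((y - x) \<bullet> b) *\<^sub>R pd b f x)) \<le> e * norm (y - x)"
      using main[OF y order_refl] by (simp add: euclidean_representation e'_def)
  qed
qed

lemma pdl_append: "pdl (as @ bs) f = pdl as (pdl bs f)"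
  by (induction as) auto

lemma C_inf_on_pd:
  assumes "C_inf_on S f" "b \<in> Basis"
  shows "C_inf_on S (pd b f)"
proof -
  have "continuous_on S (pdl bs (pd b f)) \<and>
      (\<forall>a\<in>Basis. \<forall>x\<in>S. (\<lambda>t::real. pdl bs (pd b f) (x + t *\<^sub>R a)) differentiable (at 0))"
    if "set bs \<subseteq> Basis" for bs
  proof -
    have "set (bs @ [b]) \<subseteq> Basis" using that assms(2) by simp
    moreover have "\<forall>bs. set bs \<subseteq> Basis \<longrightarrow> continuous_on S (pdl bs f) \<and>
      (\<forall>a\<in>Basis. \<forall>x\<in>S. (\<lambda>t::real. pdl bs f (x + t *\<^sub>R a)) differentiable (at 0))"
      using assms(1) by (simp add: C_inf_on_def)
    ultimately have "continuous_on S (pdl (bs @ [b]) f) \<and>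
      (\<forall>a\<in>Basis. \<forall>x\<in>S. (\<lambda>t::real. pdl (bs @ [b]) f (x + t *\<^sub>R a)) differentiable (at 0))"
      by blast
    then show ?thesis by (simp add: pdl_append)
  qed
  then show ?thesis using assms(1) by (auto simp: C_inf_on_def)
qed

text \<open>By the chain rule the derivative along c is a sum of components of c' times partial
  derivatives of f along c. These partial derivatives are again \<open>C_inf_on\<close>, hence the
  induction with f arbitrary.\<close>

lemma C_inf_on_Ck_compose:
  fixes c :: "real \<Rightarrow> 'b::euclidean_space"
  assumes c: "smooth_curve c" "\<And>t. c t \<in> S"
  shows "C_inf_on S f \<Longrightarrow> Ck n (\<lambda>t. f (c t))"
proof (induction n arbitrary: f)
  case (Suc n)
  let ?c' = "\<lambda>t. vector_derivative c (at t)"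
  show ?case
  proof (rule Ck_SucI)
    fix t
    have "(f has_derivative (\<lambda>h. \<Sum>b\<in>Basis. (h \<bullet> b) *\<^sub>R pd b f (c t))) (at (c t))"
    proof (rule has_derivative_if_continuous_pd[of S])
      fix b :: 'b assume "b \<in> Basis"
      then show "continuous_on S (pd b f)"
        using Suc.prems unfolding C_inf_on_def by (metis pdl.simps list.set(1,2) empty_subsetI insert_subset)
    qed (use Suc.prems c(2) in \<open>auto simp: C_inf_on_def dest: spec[of _ "[]"]\<close>)
    then have "(f has_derivative (\<lambda>h. \<Sum>b\<in>Basis. (h \<bullet> b) *\<^sub>R pd b f (c t))) (at (c t) within range c)"
      by (rule has_derivative_at_withinI)
    from vector_derivative_diff_chain_within[OF smooth_curve_has_vector_derivative(1)[OF c(1)] this]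
    show "((\<lambda>t. f (c t)) has_vector_derivative (\<Sum>b\<in>Basis. (?c' t \<bullet> b) *\<^sub>R pd b f (c t))) (at t)"
      by (simp add: o_def)
  next
    have "Ck n (\<lambda>t. (?c' t \<bullet> b) *\<^sub>R pd b f (c t))" if "b \<in> Basis" for b
    proof (rule Ck_bilinear[OF bounded_bilinear_scaleR])
      have "smooth_curve (\<lambda>t. ?c' t \<bullet> b)"
        by (intro smooth_curve_inner smooth_curve_has_vector_derivative c smooth_curve_const)
      then show "Ck n (\<lambda>t. ?c' t \<bullet> b)" by (simp add: smooth_curve_def)
      show "Ck n (\<lambda>t. pd b f (c t))" by (intro Suc.IH C_inf_on_pd Suc.prems that)
    qed
    note * = this
    have "B \<subseteq> Basis \<Longrightarrow> Ck n (\<lambda>t. \<Sum>b\<in>B. (?c' t \<bullet> b) *\<^sub>R pd b f (c t))" if "finite B" for B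
      using that by (induction B rule: finite_induct) (auto intro!: Ck_const Ck_add *)
    then show "Ck n (\<lambda>t. \<Sum>b\<in>Basis. (?c' t \<bullet> b) *\<^sub>R pd b f (c t))" by simp
  qed
qed simp

text \<open>In the converse direction every \<open>pdl bs f\<close> is again smooth along curves, so
  continuity and differentiability along lines are available at every order. The equivalence lets
  sums, products and gluing be treated along curves and then used for
  \<open>C_inf_on\<close>.\<close>

theorem boman:
  fixes f :: "'b::euclidean_space \<Rightarrow> 'c::banach"
  shows "C_inf_on S f \<longleftrightarrow> open S \<and> curve_smooth S f"
proof
  assume f: "C_inf_on S f"
  then show "open S \<and> curve_smooth S f"
    using C_inf_on_Ck_compose[OF _ _ f]
    by (auto intro!: curve_smoothI simp: smooth_curve_def C_inf_on_def)
next
  assume f: "open S \<and> curve_smooth S f"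
  then have sm: "curve_smooth S (pdl bs f)" for bs by (simp add: curve_smooth_pdl)
  have "continuous_on S (pdl bs f)" for bs
    using curve_smooth_isCont[OF sm] f by (simp add: continuous_at_imp_continuous_on)
  moreover have "(\<lambda>t. pdl bs f (x + t *\<^sub>R b)) differentiable at 0" if "x \<in> S" for bs x b
    using curve_smooth_has_pd[OF _ sm that] f by (auto intro: differentiableI_vector)
  ultimately show "C_inf_on S f" using f by (auto simp: C_inf_on_def)
qed

subsection \<open>Bounded sets of test functions\<close>

lemma C_inf_on_curve_iff:
  "C_inf_on UNIV (c :: real \<Rightarrow> 'b::euclidean_space) \<longleftrightarrow> smooth_curve c"
  by (simp add: boman curve_smooth_real_iff)

lemma curve_smooth_add: "curve_smooth W f \<Longrightarrow> curve_smooth W g \<Longrightarrow> curve_smooth W (\<lambda>x. f x + g x)"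
  by (auto simp: curve_smooth_def intro: smooth_curve_add)

lemma curve_smooth_mult:
  fixes f g :: "_ \<Rightarrow> 'c::real_normed_algebra"
  shows "curve_smooth W f \<Longrightarrow> curve_smooth W g \<Longrightarrow> curve_smooth W (\<lambda>x. f x * g x)"
  by (auto simp: curve_smooth_def intro: smooth_curve_mult)

lemma curve_smooth_const: "curve_smooth W (\<lambda>x. a)"
  by (simp add: curve_smooth_def)

lemma curve_smooth_of_real:
  "curve_smooth W f \<Longrightarrow> curve_smooth W (\<lambda>x. complex_of_real (f x))"
  by (auto simp: curve_smooth_def intro: smooth_curve_of_real)

lemma curve_smooth_lincomb:
  fixes a b :: complex
  shows "curve_smooth W f \<Longrightarrow> curve_smooth W g \<Longrightarrow> curve_smooth W (\<lambda>x. a * f x + b * g x)"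
  by (intro curve_smooth_add curve_smooth_mult curve_smooth_const)

section \<open>Algebra of iterated partial derivatives\<close>

lemma pdl_local:
  assumes "open S" "\<And>y. y \<in> S \<Longrightarrow> f y = g y" "x \<in> S"
  shows "pdl bs f x = pdl bs g x"
  using assms(3)
proof (induction bs arbitrary: x)
  case (Cons b bs)
  then show ?case using pd_local[OF assms(1), of "pdl bs f" "pdl bs g"] by simp
qed (use assms in auto)

lemma pd_lincomb:
  fixes f g :: "'b::euclidean_space \<Rightarrow> complex"
  assumes "open W" "curve_smooth W f" "curve_smooth W g" "x \<in> W"
  shows "pd v (\<lambda>y. a * f y + b * g y) x = a * pd v f x + b * pd v g x"
proof -
  have "((\<lambda>t. a * f (x + t *\<^sub>R v) + b * g (x + t *\<^sub>R v)) has_vector_derivative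
      a * pd v f x + b * pd v g x) (at 0)"
    by (intro has_vector_derivative_add has_vector_derivative_mult_right curve_smooth_has_pd[OF assms(1)] assms)
  then show ?thesis unfolding pd_def by (rule vector_derivative_at)
qed

lemma pd_mult:
  fixes f g :: "'b::euclidean_space \<Rightarrow> complex"
  assumes "open W" "curve_smooth W f" "curve_smooth W g" "x \<in> W"
  shows "pd v (\<lambda>y. f y * g y) x = pd v f x * g x + f x * pd v g x"
proof -
  have "((\<lambda>t. f (x + t *\<^sub>R v) * g (x + t *\<^sub>R v)) has_vector_derivative
      f (x + 0 *\<^sub>R v) * pd v g x + pd v f x * g (x + 0 *\<^sub>R v)) (at 0)"
    by (intro has_vector_derivative_mult curve_smooth_has_pd[OF assms(1)] assms)
  from vector_derivative_at[OF this] show ?thesis unfolding pd_def[of v "\<lambda>y. f y * g y"] by simp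
qed

lemma pdl_lincomb:
  fixes f g :: "'b::euclidean_space \<Rightarrow> complex"
  assumes "open W" "curve_smooth W f" "curve_smooth W g"
  shows "x \<in> W \<Longrightarrow> pdl bs (\<lambda>y. a * f y + b * g y) x = a * pdl bs f x + b * pdl bs g x"
proof (induction bs arbitrary: x)
  case (Cons v bs)
  have "pd v (pdl bs (\<lambda>y. a * f y + b * g y)) x = pd v (\<lambda>y. a * pdl bs f y + b * pdl bs g y) x"
    by (rule pd_local[OF assms(1) Cons.IH Cons.prems])
  also have "\<dots> = a * pd v (pdl bs f) x + b * pd v (pdl bs g) x"
    by (rule pd_lincomb[OF assms(1) _ _ Cons.prems]) (intro curve_smooth_pdl assms)+
  finally show ?case by simp
qed simp

lemma pdl_scale:
  fixes f :: "'b::euclidean_space \<Rightarrow> complex"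
  assumes "curve_smooth UNIV f"
  shows "pdl bs (\<lambda>y. k * f (l *\<^sub>R y)) x = k * of_real (l ^ length bs) * pdl bs f (l *\<^sub>R x)"
proof (induction bs arbitrary: x)
  case (Cons v bs)
  have "((\<lambda>t. pdl bs f (l *\<^sub>R x + t *\<^sub>R v)) has_vector_derivative pd v (pdl bs f) (l *\<^sub>R x)) (at (l * 0))"
    using curve_smooth_has_pd[OF open_UNIV curve_smooth_pdl[OF open_UNIV assms]] by simp
  moreover have "((\<lambda>t. l * t) has_vector_derivative l) (at 0)"
    unfolding has_real_derivative_iff_has_vector_derivative[symmetric] by (auto intro!: derivative_eq_intros)
  ultimately have "((\<lambda>t. pdl bs f (l *\<^sub>R x + (l * t) *\<^sub>R v)) has_vector_derivative l *\<^sub>R pd v (pdl bs f) (l *\<^sub>R x)) (at 0)"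
    using vector_diff_chain_at[of "\<lambda>t. l * t" l 0] by (simp add: o_def)
  from has_vector_derivative_mult_right[OF this, of "k * of_real (l ^ length bs)"]
  have "((\<lambda>t. k * of_real (l ^ length bs) * pdl bs f (l *\<^sub>R (x + t *\<^sub>R v))) has_vector_derivative
      k * of_real (l ^ length bs) * (l *\<^sub>R pd v (pdl bs f) (l *\<^sub>R x))) (at 0)"
    by (simp add: scaleR_add_right)
  from vector_derivative_at[OF this] show ?case
    by (simp add: Cons pd_def[of v "pdl bs (\<lambda>y. k * f (l *\<^sub>R y))"] scaleR_conv_of_real mult_ac)
qed simp

text \<open>Convenient smoothness splits into joint smoothness in (y, \<xi>), which the closure
  lemmas for \<open>curve_smooth\<close> handle, and locally uniform supports along curves. For
  joint smoothness along d, the curve attached to \<open>fst\<close> of d is tested with t -> (t,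
  snd (d t)).\<close>

lemma smoothD_iff:
  "smoothD W UNIV \<phi> \<longleftrightarrow> open W \<and> curve_smooth (W \<times> UNIV) (\<lambda>p. \<phi> (fst p) (snd p)) \<and>
     (\<forall>c a b. smooth_curve c \<and> (\<forall>t. c t \<in> W) \<longrightarrow> (\<exists>K. compact K \<and> (\<forall>t\<in>{a..b::real}. supp (\<phi> (c t)) \<subseteq> K)))"
  (is "?L \<longleftrightarrow> _ \<and> ?S \<and> ?K")
proof (intro iffI conjI)
  assume L: ?L
  then show "open W" by (simp add: smoothD_def)
  have D: "Dcurve UNIV (\<phi> \<circ> c)" if "smooth_curve c" "\<And>t. c t \<in> W" for c
    using L that by (simp add: smoothD_def C_inf_on_curve_iff)
  show ?S
  proof (rule curve_smoothI)
    fix d :: "real \<Rightarrow> 'a \<times> 'b" assume d: "smooth_curve d" "\<And>t. d t \<in> W \<times> UNIV"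
    have "Dcurve UNIV (\<phi> \<circ> (\<lambda>t. fst (d t)))"
      by (rule D) (use d in \<open>auto simp: mem_Times_iff intro: smooth_curve_fst\<close>)
    then have "curve_smooth UNIV (\<lambda>p. \<phi> (fst (d (fst p))) (snd p))"
      by (simp add: Dcurve_def boman o_def)
    from curve_smoothD[OF this, of "\<lambda>t. (t, snd (d t))"] d(1)
    show "smooth_curve (\<lambda>t. \<phi> (fst (d t)) (snd (d t)))"
      by (simp add: smooth_curve_Pair smooth_curve_snd)
  qed
  show ?K
  proof (intro allI impI)
    fix c :: "real \<Rightarrow> 'a" and a b assume "smooth_curve c \<and> (\<forall>t. c t \<in> W)"
    then have "Dcurve UNIV (\<phi> \<circ> c)" using D by blast
    then obtain K where "compact K" "\<forall>t\<in>{a..b}. supp ((\<phi> \<circ> c) t) \<subseteq> K" unfolding Dcurve_def by blast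
    then show "\<exists>K. compact K \<and> (\<forall>t\<in>{a..b}. supp (\<phi> (c t)) \<subseteq> K)" by auto
  qed
next
  assume R: "open W \<and> ?S \<and> ?K"
  have "Dcurve UNIV (\<phi> \<circ> c)" if c: "smooth_curve c" "\<And>t. c t \<in> W" for c
    unfolding Dcurve_def boman
  proof (intro conjI allI)
    show "\<exists>K. compact K \<and> K \<subseteq> UNIV \<and> (\<forall>t\<in>{a..b}. supp ((\<phi> \<circ> c) t) \<subseteq> K)" for a b
      using R c by simp
    have S: ?S using R by blast
    show "curve_smooth UNIV (\<lambda>p. (\<phi> \<circ> c) (fst p) (snd p))"
    proof (rule curve_smoothI)
      fix e :: "real \<Rightarrow> real \<times> 'b" assume e: "smooth_curve e"
      show "smooth_curve (\<lambda>t. (\<phi> \<circ> c) (fst (e t)) (snd (e t)))"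
        using curve_smoothD[OF S smooth_curve_Pair[OF smooth_curve_compose[OF c(1) smooth_curve_fst[OF e]]
            smooth_curve_snd[OF e]]] c(2)
        by simp
    qed
  qed auto
  then show ?L using R by (simp add: smoothD_def C_inf_on_curve_iff)
qed

lemma smoothD_slice:
  assumes "smoothD W UNIV \<phi>"
  shows "curve_smooth W (\<lambda>y. \<phi> y \<xi>)"
proof (rule curve_smoothI)
  fix c assume "smooth_curve c" "\<And>t. c t \<in> W"
  then show "smooth_curve (\<lambda>t. \<phi> (c t) \<xi>)"
    using assms curve_smoothD[of "W \<times> UNIV" "\<lambda>p. \<phi> (fst p) (snd p)" "\<lambda>t. (c t, \<xi>)"]
    by (simp add: smoothD_iff smooth_curve_Pair)
qed

lemma test_fun_iff: "test_fun f \<longleftrightarrow> curve_smooth UNIV f \<and> compact (supp f)"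
  by (simp add: test_fun_def boman)

lemma supp_lincomb: "supp (\<lambda>\<xi>. a * f \<xi> + b * g \<xi>) \<subseteq> supp f \<union> supp g"
  unfolding supp_def closure_Un[symmetric] by (rule closure_mono) auto

lemma closed_supp: "closed (supp f)"
  by (simp add: supp_def)

lemma compact_supp: "supp f \<subseteq> K \<Longrightarrow> compact K \<Longrightarrow> compact (supp f)"
  using compact_Int_closed[OF _ closed_supp, of K f] by (simp add: inf.absorb2)

lemma test_fun_lincomb:
  assumes "test_fun f" "test_fun g"
  shows "test_fun (\<lambda>\<xi>. a * f \<xi> + b * g \<xi>)"
  unfolding test_fun_iff
proof
  have "compact (supp f \<union> supp g)" using assms by (auto simp: test_fun_iff)
  then show "compact (supp (\<lambda>\<xi>. a * f \<xi> + b * g \<xi>))"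
    by (rule compact_supp[OF supp_lincomb])
qed (use assms in \<open>auto simp: test_fun_iff intro: curve_smooth_lincomb\<close>)

text \<open>A function that is not integrable has the default integral 0, so integral 1 already
  forces integrability.\<close>

lemma A0_integrable: "A0 f \<Longrightarrow> f integrable_on UNIV"
  using not_integrable_integral[of f UNIV] by (auto simp: A0_def)

lemma A0_lincomb:
  assumes "A0 f" "A0 g" "a + b = 1"
  shows "A0 (\<lambda>\<xi>. a * f \<xi> + b * g \<xi>)"
proof -
  have "(f has_integral 1) UNIV" "(g has_integral 1) UNIV"
    using A0_integrable[OF assms(1)] A0_integrable[OF assms(2)] assms
    by (auto simp: A0_def has_integral_iff)
  then have "((\<lambda>\<xi>. a * f \<xi> + b * g \<xi>) has_integral a * 1 + b * 1) UNIV"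
    by (intro has_integral_add has_integral_mult_right)
  then have "integral UNIV (\<lambda>\<xi>. a * f \<xi> + b * g \<xi>) = 1"
    using assms(3) by (simp add: integral_unique)
  then show ?thesis using assms by (simp add: A0_def test_fun_lincomb)
qed

lemma Dbounded_subset: "Dbounded A \<Longrightarrow> B \<subseteq> A \<Longrightarrow> Dbounded B"
  unfolding Dbounded_def by (meson subsetD)

lemma Dbounded_supp:
  assumes "Dbounded A"
  obtains K where "compact K" "\<And>f. f \<in> A \<Longrightarrow> supp f \<subseteq> K"
  using assms unfolding Dbounded_def by metis

lemma Dbounded_Un:
  assumes "Dbounded A" "Dbounded B"
  shows "Dbounded (A \<union> B)"
proof -
  obtain K L where K: "compact K" "\<And>f. f \<in> A \<Longrightarrow> supp f \<subseteq> K"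
    and L: "compact L" "\<And>f. f \<in> B \<Longrightarrow> supp f \<subseteq> L"
    using assms unfolding Dbounded_def by metis
  have "\<exists>K. compact K \<and> (\<forall>f\<in>A \<union> B. supp f \<subseteq> K)"
    using K L by (intro exI[of _ "K \<union> L"]) auto
  moreover have "\<exists>M. \<forall>f\<in>A \<union> B. \<forall>\<xi>. norm (pdl bs f \<xi>) \<le> M" if bs: "set bs \<subseteq> Basis" for bs
  proof -
    obtain M where M: "\<And>f \<xi>. f \<in> A \<Longrightarrow> norm (pdl bs f \<xi>) \<le> M"
      using assms(1) bs unfolding Dbounded_def by blast
    obtain M' where M': "\<And>f \<xi>. f \<in> B \<Longrightarrow> norm (pdl bs f \<xi>) \<le> M'"
      using assms(2) bs unfolding Dbounded_def by blast
    show ?thesis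
      by (rule exI[of _ "max M M'"]) (auto simp: le_max_iff_disj M M')
  qed
  ultimately show ?thesis using assms unfolding Dbounded_def by blast
qed

text \<open>The coefficients vary with the functions because they will be values of cutoffs at
  varying points; only their common bound M matters.\<close>

lemma Dbounded_lincomb:
  assumes "Dbounded A" "Dbounded B"
  shows "Dbounded {\<lambda>\<xi>. a * f \<xi> + b * g \<xi> | a b f g. f \<in> A \<and> g \<in> B \<and> norm a \<le> M \<and> norm b \<le> M}"
    (is "Dbounded ?X")
  unfolding Dbounded_def
proof (intro conjI allI impI)
  have tf: "test_fun f" if "f \<in> A \<union> B" for f using assms that by (auto simp: Dbounded_def)
  show "\<forall>h\<in>?X. test_fun h" using tf by (auto intro!: test_fun_lincomb)
  obtain K L where K: "compact K" "\<And>f. f \<in> A \<Longrightarrow> supp f \<subseteq> K"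
    and L: "compact L" "\<And>f. f \<in> B \<Longrightarrow> supp f \<subseteq> L"
    using assms unfolding Dbounded_def by metis
  have "supp h \<subseteq> K \<union> L" if "h \<in> ?X" for h
  proof -
    from that obtain a b f g where "h = (\<lambda>\<xi>. a * f \<xi> + b * g \<xi>)" "f \<in> A" "g \<in> B" by blast
    then show ?thesis using supp_lincomb[of a f b g] K(2) L(2) by blast
  qed
  then show "\<exists>K. compact K \<and> (\<forall>h\<in>?X. supp h \<subseteq> K)"
    using K(1) L(1) by (intro exI[of _ "K \<union> L"]) auto
  fix bs :: "'a list" assume bs: "set bs \<subseteq> Basis"
  obtain M1 where M1: "\<And>f \<xi>. f \<in> A \<Longrightarrow> norm (pdl bs f \<xi>) \<le> M1"
    using assms(1) bs unfolding Dbounded_def by blast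
  obtain M2 where M2: "\<And>f \<xi>. f \<in> B \<Longrightarrow> norm (pdl bs f \<xi>) \<le> M2"
    using assms(2) bs unfolding Dbounded_def by blast
  have "norm (pdl bs h \<xi>) \<le> M * M1 + M * M2" if "h \<in> ?X" for h \<xi>
  proof -
    from that obtain a b f g where h: "h = (\<lambda>\<xi>. a * f \<xi> + b * g \<xi>)" "f \<in> A" "g \<in> B"
      "norm a \<le> M" "norm b \<le> M" by blast
    have "curve_smooth UNIV f" "curve_smooth UNIV g" using tf h by (auto simp: test_fun_iff)
    then have "pdl bs h \<xi> = a * pdl bs f \<xi> + b * pdl bs g \<xi>"
      unfolding h(1) by (intro pdl_lincomb[OF open_UNIV]) auto
    also have "norm \<dots> \<le> M * M1 + M * M2"
      using h M1[OF h(2), of \<xi>] M2[OF h(3), of \<xi>] order_trans[OF norm_ge_zero h(4)]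
      by (intro norm_triangle_mono) (auto simp: norm_mult intro!: mult_mono)
    finally show ?thesis .
  qed
  then show "\<exists>M. \<forall>h\<in>?X. \<forall>\<xi>. norm (pdl bs h \<xi>) \<le> M" by blast
qed

section \<open>The scaling operators on test functions\<close>

lemma supp_Seps:
  assumes "r > 0"
  shows "supp (Seps r f) \<subseteq> (\<lambda>\<xi>. r *\<^sub>R \<xi>) ` supp f"
proof -
  have "{\<xi>. Seps r f \<xi> \<noteq> 0} \<subseteq> (\<lambda>\<xi>. r *\<^sub>R \<xi>) ` supp f"
  proof
    fix \<xi> assume "\<xi> \<in> {\<xi>. Seps r f \<xi> \<noteq> 0}"
    then have "inverse r *\<^sub>R \<xi> \<in> supp f"
      using closure_subset[of "{x. f x \<noteq> 0}"] by (auto simp: Seps_def supp_def)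
    moreover have "\<xi> = r *\<^sub>R inverse r *\<^sub>R \<xi>" using assms by simp
    ultimately show "\<xi> \<in> (\<lambda>\<xi>. r *\<^sub>R \<xi>) ` supp f" by blast
  qed
  then show ?thesis unfolding supp_def[of "Seps r f"]
    by (intro closure_minimal closed_scaling closed_supp)
qed

lemma Seps_Seps: "Seps a (Seps b f) = Seps (a * b) f"
  by (auto simp: Seps_def power_mult_distrib mult_ac)

lemma curve_smooth_scale:
  "curve_smooth UNIV f \<Longrightarrow> curve_smooth UNIV (\<lambda>\<xi>. f (l *\<^sub>R \<xi>))"
  by (rule curve_smoothI) (rule curve_smoothD[of UNIV f], auto intro: smooth_curve_scaleR)

lemma test_fun_Seps:
  assumes "test_fun f" "r > 0"
  shows "test_fun (Seps r f)"
  unfolding test_fun_iff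
proof
  show "curve_smooth UNIV (Seps r f)"
    unfolding Seps_def using assms
    by (intro curve_smooth_mult curve_smooth_const curve_smooth_scale) (auto simp: test_fun_iff)
  have "compact ((\<lambda>\<xi>. r *\<^sub>R \<xi>) ` supp f)" using assms by (auto simp: test_fun_iff intro: compact_scaling)
  then show "compact (supp (Seps r f))"
    by (rule compact_supp[OF supp_Seps[OF assms(2)]])
qed

lemma A0_Seps:
  fixes f :: "'a::euclidean_space \<Rightarrow> complex"
  assumes "A0 f" "r > 0"
  shows "A0 (Seps r f)"
proof -
  have f: "(f has_integral 1) UNIV"
    using A0_integrable[OF assms(1)] assms(1) by (auto simp: A0_def has_integral_iff)
  \<comment> \<open>The substitution is carried out on a box containing the support, whose image
    under scaling is again a box; outside these boxes the integrands vanish.\<close>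
  obtain a where a: "supp f \<subseteq> cbox (-a) a"
    using assms(1) bounded_subset_cbox_symmetric[of "supp f"] by (metis A0_def test_fun_def compact_imp_bounded)
  have f0: "f \<xi> = 0" if "\<xi> \<notin> cbox (-a) a" for \<xi>
    using that a closure_subset[of "{x. f x \<noteq> 0}"] by (auto simp: supp_def)
  have "(f has_integral 1) (cbox (-a) a)"
  proof -
    have "(\<lambda>x. if x \<in> cbox (-a) a then f x else 0) = f" using f0 by auto
    then show ?thesis using f has_integral_restrict_UNIV[of "cbox (-a) a" f 1] by simp
  qed
  from has_integral_affinity'[OF this, of "inverse r" 0]
  have "((\<lambda>x. f (inverse r *\<^sub>R x)) has_integral of_real (r ^ DIM('a)))
      (cbox ((- a) /\<^sub>R inverse r) (a /\<^sub>R inverse r))"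
    using assms(2) by (simp add: power_inverse scaleR_conv_of_real)
  moreover have "f (inverse r *\<^sub>R x) = 0" if "x \<notin> cbox ((- a) /\<^sub>R inverse r) (a /\<^sub>R inverse r)" for x
    by (rule f0) (use that assms(2) in \<open>auto simp: mem_box field_simps\<close>)
  ultimately have "((\<lambda>x. f (inverse r *\<^sub>R x)) has_integral of_real (r ^ DIM('a))) UNIV"
    by (rule has_integral_on_superset) auto
  from has_integral_mult_right[OF this, of "complex_of_real (inverse (r ^ DIM('a)))"]
  have "(Seps r f has_integral 1) UNIV"
    using assms(2) by (simp add: Seps_def flip: of_real_mult)
  then show ?thesis using assms by (simp add: A0_def test_fun_Seps integral_unique)
qed

lemma Dbounded_Seps:
  assumes "Dbounded A" "r > 0"
  shows "Dbounded (Seps r ` A)"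
  unfolding Dbounded_def
proof (intro conjI allI impI)
  have tf: "test_fun f" if "f \<in> A" for f using assms that by (auto simp: Dbounded_def)
  show "\<forall>f\<in>Seps r ` A. test_fun f" using tf assms by (auto intro: test_fun_Seps)
  obtain K where K: "compact K" "\<And>f. f \<in> A \<Longrightarrow> supp f \<subseteq> K" using assms unfolding Dbounded_def by metis
  show "\<exists>K. compact K \<and> (\<forall>f\<in>Seps r ` A. supp f \<subseteq> K)"
  proof (intro exI conjI ballI)
    show "compact ((\<lambda>\<xi>. r *\<^sub>R \<xi>) ` K)" by (rule compact_scaling[OF K(1)])
    show "supp h \<subseteq> (\<lambda>\<xi>. r *\<^sub>R \<xi>) ` K" if "h \<in> Seps r ` A" for h
      using that supp_Seps[OF assms(2)] K(2) by (fast dest: subsetD)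
  qed
  fix bs :: "'a list" assume "set bs \<subseteq> Basis"
  then obtain M where M: "\<And>f \<xi>. f \<in> A \<Longrightarrow> norm (pdl bs f \<xi>) \<le> M"
    using assms(1) unfolding Dbounded_def by blast
  have "norm (pdl bs (Seps r f) \<xi>) \<le> inverse (r ^ DIM('a)) * inverse r ^ length bs * M" if "f \<in> A" for f \<xi>
    using pdl_scale[of f bs "complex_of_real (inverse (r ^ DIM('a)))" "inverse r" \<xi>] tf[OF that] assms(2)
      M[OF that, of "inverse r *\<^sub>R \<xi>"]
    by (simp add: Seps_def test_fun_iff norm_mult norm_power norm_inverse mult_left_mono del: power_inverse)
  then show "\<exists>M. \<forall>f\<in>Seps r ` A. \<forall>\<xi>. norm (pdl bs f \<xi>) \<le> M" by blast
qed

section \<open>Smooth maps into A_0 and bounded families of them\<close>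

lemma dx_lincomb:
  assumes "smoothD W UNIV \<phi>" "smoothD W UNIV \<psi>" "x \<in> W"
  shows "dx bs (\<lambda>y \<xi>. a * \<phi> y \<xi> + b * \<psi> y \<xi>) x = (\<lambda>\<xi>. a * dx bs \<phi> x \<xi> + b * dx bs \<psi> x \<xi>)"
  unfolding dx_def
  by (intro ext pdl_lincomb[of W]) (use assms smoothD_slice in \<open>auto simp: smoothD_def\<close>)

text \<open>Scaling acts on \<xi> while \<open>dx\<close> differentiates in x. Only the constant
  factor has to pass through the derivative, as a linear combination with second coefficient
  0.\<close>

lemma dx_Seps:
  assumes "smoothD W UNIV \<phi>" "x \<in> W"
  shows "dx bs (\<lambda>y. Seps r (\<phi> y)) x = Seps r (dx bs \<phi> x)"
proof
  fix \<xi>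
  show "dx bs (\<lambda>y. Seps r (\<phi> y)) x \<xi> = Seps r (dx bs \<phi> x) \<xi>"
    using pdl_lincomb[OF _ smoothD_slice[OF assms(1)] smoothD_slice[OF assms(1)] assms(2),
        of bs "complex_of_real (inverse (r ^ DIM('a)))" "inverse r *\<^sub>R \<xi>" 0] assms(1)
    by (simp add: dx_def Seps_def smoothD_def)
qed

lemma CinfA0_lincomb:
  assumes "CinfA0 \<Omega> \<phi>" "CinfA0 \<Omega> \<psi>" "a + b = 1"
  shows "CinfA0 \<Omega> (\<lambda>y \<xi>. a * \<phi> y \<xi> + b * \<psi> y \<xi>)"
  unfolding CinfA0_def smoothD_iff
proof (intro conjI allI impI ballI)
  show "curve_smooth (\<Omega> \<times> UNIV) (\<lambda>p. a * \<phi> (fst p) (snd p) + b * \<psi> (fst p) (snd p))"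
    using assms by (intro curve_smooth_lincomb) (auto simp: CinfA0_def smoothD_iff)
  fix c :: "real \<Rightarrow> 'a" and u v assume c: "smooth_curve c \<and> (\<forall>t. c t \<in> \<Omega>)"
  obtain K where K: "compact K" "\<forall>t\<in>{u..v}. supp (\<phi> (c t)) \<subseteq> K"
    using assms(1) c unfolding CinfA0_def smoothD_iff by blast
  obtain L where L: "compact L" "\<forall>t\<in>{u..v}. supp (\<psi> (c t)) \<subseteq> L"
    using assms(2) c unfolding CinfA0_def smoothD_iff by blast
  show "\<exists>K. compact K \<and> (\<forall>t\<in>{u..v}. supp (\<lambda>\<xi>. a * \<phi> (c t) \<xi> + b * \<psi> (c t) \<xi>) \<subseteq> K)"
  proof (intro exI conjI ballI)
    show "compact (K \<union> L)" using K L by auto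
    show "supp (\<lambda>\<xi>. a * \<phi> (c t) \<xi> + b * \<psi> (c t) \<xi>) \<subseteq> K \<union> L" if "t \<in> {u..v}" for t
      using supp_lincomb[of a "\<phi> (c t)" b "\<psi> (c t)"] K L that by blast
  qed
qed (use assms in \<open>auto simp: CinfA0_def smoothD_iff intro: A0_lincomb\<close>)

lemma CinfA0_Seps:
  assumes "CinfA0 \<Omega> \<phi>" "r > 0"
  shows "CinfA0 \<Omega> (\<lambda>y. Seps r (\<phi> y))"
  unfolding CinfA0_def smoothD_iff
proof (intro conjI allI impI ballI)
  show "curve_smooth (\<Omega> \<times> UNIV) (\<lambda>p. Seps r (\<phi> (fst p)) (snd p))"
    unfolding Seps_def
  proof (intro curve_smooth_mult curve_smooth_const, rule curve_smoothI)
    fix c :: "real \<Rightarrow> 'a \<times> 'a" assume c: "smooth_curve c" "\<And>t. c t \<in> \<Omega> \<times> UNIV"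
    have "smooth_curve (\<lambda>t. (fst (c t), inverse r *\<^sub>R snd (c t)))"
      by (intro smooth_curve_Pair smooth_curve_fst c smooth_curve_scaleR smooth_curve_const smooth_curve_snd)
    moreover have "curve_smooth (\<Omega> \<times> UNIV) (\<lambda>p. \<phi> (fst p) (snd p))"
      using assms by (simp add: CinfA0_def smoothD_iff)
    ultimately show "smooth_curve (\<lambda>t. \<phi> (fst (c t)) (inverse r *\<^sub>R snd (c t)))"
      using curve_smoothD[of "\<Omega> \<times> UNIV" "\<lambda>p. \<phi> (fst p) (snd p)" "\<lambda>t. (fst (c t), inverse r *\<^sub>R snd (c t))"] c(2)
      by (simp add: mem_Times_iff)
  qed
  fix c :: "real \<Rightarrow> 'a" and u v assume c: "smooth_curve c \<and> (\<forall>t. c t \<in> \<Omega>)"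
  obtain K where K: "compact K" "\<forall>t\<in>{u..v}. supp (\<phi> (c t)) \<subseteq> K"
    using assms(1) c unfolding CinfA0_def smoothD_iff by blast
  show "\<exists>K. compact K \<and> (\<forall>t\<in>{u..v}. supp (Seps r (\<phi> (c t))) \<subseteq> K)"
  proof (intro exI conjI ballI)
    show "compact ((\<lambda>\<xi>. r *\<^sub>R \<xi>) ` K)" by (rule compact_scaling[OF K(1)])
    show "supp (Seps r (\<phi> (c t))) \<subseteq> (\<lambda>\<xi>. r *\<^sub>R \<xi>) ` K" if "t \<in> {u..v}" for t
      using K(2) that supp_Seps[OF assms(2), of "\<phi> (c t)"] by blast
  qed
qed (use assms in \<open>auto simp: CinfA0_def smoothD_iff intro: A0_Seps\<close>)

lemma bounded_CinfA0_D:
  "bounded_CinfA0 \<Omega> B \<Longrightarrow> compact K \<Longrightarrow> K \<subseteq> \<Omega> \<Longrightarrow> set bs \<subseteq> Basis \<Longrightarrow>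
    Dbounded {dx bs \<phi> x |\<phi> x. \<phi> \<in> B \<and> x \<in> K}"
  unfolding bounded_CinfA0_def by blast

lemma bounded_CinfA0_Seps:
  assumes "bounded_CinfA0 \<Omega> B" "r > 0"
  shows "bounded_CinfA0 \<Omega> ((\<lambda>\<phi> y. Seps r (\<phi> y)) ` B)"
  unfolding bounded_CinfA0_def
proof (intro conjI allI impI)
  have B: "CinfA0 \<Omega> \<phi>" if "\<phi> \<in> B" for \<phi> using assms(1) that by (simp add: bounded_CinfA0_def)
  then show "\<forall>\<phi>\<in>(\<lambda>\<phi> y. Seps r (\<phi> y)) ` B. CinfA0 \<Omega> \<phi>" using CinfA0_Seps assms(2) by blast
  fix K and bs :: "'a list" assume K: "compact K \<and> K \<subseteq> \<Omega> \<and> set bs \<subseteq> Basis"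
  have "{dx bs \<phi> x |\<phi> x. \<phi> \<in> (\<lambda>\<phi> y. Seps r (\<phi> y)) ` B \<and> x \<in> K}
      \<subseteq> Seps r ` {dx bs \<phi> x |\<phi> x. \<phi> \<in> B \<and> x \<in> K}"
  proof clarify
    fix \<phi> x assume "\<phi> \<in> B" "x \<in> K"
    moreover from this have "dx bs (\<lambda>y. Seps r (\<phi> y)) x = Seps r (dx bs \<phi> x)"
      using B K by (intro dx_Seps[of \<Omega>]) (auto simp: CinfA0_def)
    ultimately show "dx bs (\<lambda>y. Seps r (\<phi> y)) x \<in> Seps r ` {dx bs \<phi> x |\<phi> x. \<phi> \<in> B \<and> x \<in> K}"
      by blast
  qed
  moreover have "Dbounded (Seps r ` {dx bs \<phi> x |\<phi> x. \<phi> \<in> B \<and> x \<in> K})"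
    using assms K by (intro Dbounded_Seps bounded_CinfA0_D) auto
  ultimately show "Dbounded {dx bs \<phi> x |\<phi> x. \<phi> \<in> (\<lambda>\<phi> y. Seps r (\<phi> y)) ` B \<and> x \<in> K}"
    by (rule Dbounded_subset[rotated])
qed

lemma bounded_CinfA0_subset:
  assumes "bounded_CinfA0 \<Omega> B" "A \<subseteq> B"
  shows "bounded_CinfA0 \<Omega> A"
  unfolding bounded_CinfA0_def
proof (intro conjI allI impI)
  show "\<forall>\<phi>\<in>A. CinfA0 \<Omega> \<phi>" using assms unfolding bounded_CinfA0_def by blast
  fix K and bs :: "'a list" assume "compact K \<and> K \<subseteq> \<Omega> \<and> set bs \<subseteq> Basis"
  then have "Dbounded {dx bs \<phi> x |\<phi> x. \<phi> \<in> B \<and> x \<in> K}" using bounded_CinfA0_D[OF assms(1)] by blast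
  then show "Dbounded {dx bs \<phi> x |\<phi> x. \<phi> \<in> A \<and> x \<in> K}"
    by (rule Dbounded_subset) (use assms(2) in blast)
qed

text \<open>This is order zero of the boundedness condition, since \<open>dx []\<close> is
  evaluation.\<close>

lemma bounded_CinfA0_supp:
  assumes "bounded_CinfA0 \<Omega> B" "compact K" "K \<subseteq> \<Omega>"
  obtains M where "compact M" "\<And>\<phi> x. \<phi> \<in> B \<Longrightarrow> x \<in> K \<Longrightarrow> supp (\<phi> x) \<subseteq> M"
proof -
  have "Dbounded {dx [] \<phi> x |\<phi> x. \<phi> \<in> B \<and> x \<in> K}"
    by (rule bounded_CinfA0_D[OF assms]) simp
  then obtain M where M: "compact M" "\<And>f. f \<in> {dx [] \<phi> x |\<phi> x. \<phi> \<in> B \<and> x \<in> K} \<Longrightarrow> supp f \<subseteq> M"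
    by (rule Dbounded_supp) (rule that)
  have "supp (\<phi> x) \<subseteq> M" if "\<phi> \<in> B" "x \<in> K" for \<phi> x
  proof -
    have "dx [] \<phi> x \<in> {dx [] \<phi> x |\<phi> x. \<phi> \<in> B \<and> x \<in> K}" using that by blast
    then have "supp (dx [] \<phi> x) \<subseteq> M" by (rule M(2))
    then show ?thesis by (simp add: dx_def)
  qed
  then show ?thesis by (rule that[OF M(1)])
qed

subsection \<open>Equivalence of the moderateness conditions\<close>

text \<open>The net is a convex combination of psi 0 and psi n with weight given by a bump at e n. As the
  e n at least halve at each step, these bumps have disjoint supports.\<close>
lemma interpolating_net:
  fixes \<psi> :: "nat \<Rightarrow> 'a::euclidean_space \<Rightarrow> 'a \<Rightarrow> complex" and e :: "nat \<Rightarrow> real"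
  assumes "open \<Omega>" and bd: "bounded_CinfA0 \<Omega> (range \<psi>)"
    and e: "\<And>n. 0 < e n" "\<And>n. e (Suc n) < e n / 2"
  obtains \<Phi> where "Cb_smooth \<Omega> \<Phi>" "\<And>n y. \<Phi> (e n, y) = \<psi> n y"
    "\<And>\<epsilon> y. \<exists>n a. \<Phi> (\<epsilon>, y) = (\<lambda>\<xi>. complex_of_real (1 - a) * \<psi> 0 y \<xi> + complex_of_real a * \<psi> n y \<xi>)"
proof -
  \<comment> \<open>At distance 1/4 from z = 1 the argument of \<open>smooth_step\<close> reaches
    2^2, where it vanishes. The bump for e n therefore lives between 3/4 e n and 5/4 e n.\<close>
  define \<beta> :: "real \<Rightarrow> real" where "\<beta> z = smooth_step ((8 * (z - 1))\<^sup>2)" for z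
  have \<beta>1: "\<beta> 1 = 1" by (simp add: \<beta>_def smooth_step_simps)
  have \<beta>0: "\<beta> z = 0" if "z \<le> 3/4 \<or> 5/4 \<le> z" for z
  proof -
    have "2\<^sup>2 \<le> \<bar>8 * (z - 1)\<bar>\<^sup>2" using that by (intro power_mono) (auto simp: abs_if)
    then show ?thesis by (simp add: \<beta>_def smooth_step_simps del: power_mult_distrib)
  qed
  have \<beta>b: "0 \<le> \<beta> z" "\<beta> z \<le> 1" for z by (simp_all add: \<beta>_def smooth_step_bounds)
  have \<beta>s: "smooth_curve r \<Longrightarrow> smooth_curve (\<lambda>t. \<beta> (r t))" for r
    unfolding \<beta>_def power2_eq_square
    by (intro smooth_curve_smooth_step smooth_curve_mult smooth_curve_diff smooth_curve_const)
  have dec: "e n \<le> e m" if "m \<le> n" for m n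
    using that
  proof (rule lift_Suc_antimono_le[of e, rotated])
    show "e (Suc n) \<le> e n" for n using e[of n] by simp
  qed
  have ex: "\<exists>n. 5/8 * e n < \<epsilon>" if "\<epsilon> > 0" for \<epsilon>
  proof -
    have le: "e n \<le> e 0 * (1/2) ^ n" for n
    proof (induction n)
      case (Suc n)
      then have "e (Suc n) \<le> e 0 * (1/2) ^ n / 2" using e(2)[of n] by linarith
      then show ?case by simp
    qed simp
    have "0 < \<epsilon> / e 0" using that e(1)[of 0] by simp
    then obtain n where n: "(1/2) ^ n < \<epsilon> / e 0"
      using real_arch_pow_inv[of "\<epsilon> / e 0" "1/2"] by auto
    have "e 0 * (1/2) ^ n < \<epsilon>" using n e(1)[of 0] by (simp add: field_simps)
    then have "5/8 * e n < \<epsilon>" using le[of n] e(1)[of n] by linarith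
    then show ?thesis by blast
  qed
  \<comment> \<open>The least index makes \<open>\<Phi>\<close> a total function. Smoothness is not
    visible in this form and is checked on the open cover by the intervals
    \<open>J n\<close>.\<close>
  define idx where "idx \<epsilon> = (LEAST n. 5/8 * e n < \<epsilon>)" for \<epsilon>
  define F where "F n \<epsilon> y = (\<lambda>\<xi>. complex_of_real (1 - \<beta> (\<epsilon> / e n)) * \<psi> 0 y \<xi> +
      complex_of_real (\<beta> (\<epsilon> / e n)) * \<psi> n y \<xi>)" for n \<epsilon> y
  define \<Phi> where "\<Phi> p = F (idx (fst p)) (fst p) (snd p)" for p
  \<comment> \<open>As e n < e (n - 1) / 2, the bump for e n ends before 5/8 e (n - 1), while the
    one for e (n - 1) starts at 3/4 e (n - 1). Between these two values, exactly where
    \<open>J n\<close> and \<open>J (n - 1)\<close> overlap, both bumps vanish.\<close>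
  define J where "J n = {\<epsilon>. 5/8 * e n < \<epsilon> \<and> (n = 0 \<or> \<epsilon> < 3/4 * e (n - 1))}" for n
  have openJ: "open (J n)" for n
    unfolding J_def by (cases "n = 0") (auto intro!: open_Collect_conj open_Collect_less continuous_intros)
  have \<Phi>J: "\<Phi> (\<epsilon>, y) = F n \<epsilon> y" if "\<epsilon> \<in> J n" for \<epsilon> y n
  proof -
    define m where "m = idx \<epsilon>"
    have n: "5/8 * e n < \<epsilon>" using that by (simp add: J_def)
    have m: "5/8 * e m < \<epsilon>" "m \<le> n"
      unfolding m_def idx_def using n by (auto intro: LeastI Least_le)
    show ?thesis
    proof (cases "m = n")
      case True
      then show ?thesis by (simp add: \<Phi>_def m_def)
    next
      \<comment> \<open>The least index m is smaller than n here; both weights are 0, so the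
        formulas for m and n both reduce to \<psi> 0.\<close>
      case False
      then have mn: "m \<le> n - 1" "n > 0" using m(2) by auto
      have "\<epsilon> < 3/4 * e (n - 1)" using that mn(2) by (simp add: J_def)
      then have "\<epsilon> \<le> 3/4 * e m" using dec[OF mn(1)] by linarith
      then have "\<epsilon> / e m \<le> 3/4" using e(1)[of m] by (simp add: divide_le_eq)
      moreover have "5/4 * e n \<le> \<epsilon>"
        using m(1) dec[OF mn(1)] e(2)[of "n - 1"] mn(2) by simp
      then have "5/4 \<le> \<epsilon> / e n" using e(1)[of n] by (simp add: le_divide_eq)
      ultimately have "\<beta> (\<epsilon> / e m) = 0" "\<beta> (\<epsilon> / e n) = 0" using \<beta>0 by blast+
      then show ?thesis by (simp add: \<Phi>_def F_def m_def)
    qed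
  qed
  have J_cover: "(\<Union>n. J n) = {0<..}"
  proof
    have "0 < \<epsilon>" if "5/8 * e n < \<epsilon>" for n \<epsilon> using that e(1)[of n] by linarith
    then show "(\<Union>n. J n) \<subseteq> {0<..}" by (auto simp: J_def)
    show "{0<..} \<subseteq> (\<Union>n. J n)"
    proof
      fix \<epsilon> :: real assume "\<epsilon> \<in> {0<..}"
      then have \<epsilon>: "\<epsilon> > 0" by simp
      have "5/8 * e (idx \<epsilon>) < \<epsilon>" unfolding idx_def by (rule LeastI_ex[OF ex[OF \<epsilon>]])
      moreover have "\<epsilon> < 3/4 * e (idx \<epsilon> - 1)" if "idx \<epsilon> \<noteq> 0"
      proof -
        have "\<not> 5/8 * e (idx \<epsilon> - 1) < \<epsilon>"
          using that not_less_Least[of "idx \<epsilon> - 1" "\<lambda>n. 5/8 * e n < \<epsilon>"] by (simp add: idx_def)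
        then show ?thesis using e(1)[of "idx \<epsilon> - 1"] by linarith
      qed
      ultimately show "\<epsilon> \<in> (\<Union>n. J n)" by (auto simp: J_def)
    qed
  qed
  have C: "CinfA0 \<Omega> (\<psi> n)" for n using bd by (auto simp: bounded_CinfA0_def)
  have CF: "CinfA0 \<Omega> (F n \<epsilon>)" for n \<epsilon>
    unfolding F_def by (intro CinfA0_lincomb C) simp
  have \<Phi>F: "(\<lambda>y. \<Phi> (\<epsilon>, y)) = F (idx \<epsilon>) \<epsilon>" for \<epsilon> by (auto simp: \<Phi>_def)
  have "Cb_weak \<Omega> \<Phi>" unfolding Cb_weak_def \<Phi>F
  proof (intro conjI allI impI ballI)
    show "CinfA0 \<Omega> (F (idx \<epsilon>) \<epsilon>)" for \<epsilon> by (rule CF)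
    fix K and bs :: "'a list" assume K: "compact K \<and> K \<subseteq> \<Omega> \<and> set bs \<subseteq> Basis"
    let ?A = "{dx bs \<phi> x |\<phi> x. \<phi> \<in> range \<psi> \<and> x \<in> K}"
    have A: "Dbounded ?A" by (rule bounded_CinfA0_D[OF bd]) (use K in auto)
    show "Dbounded {dx bs (F (idx \<epsilon>) \<epsilon>) x |\<epsilon> x. \<epsilon> \<in> {0<..1} \<and> x \<in> K}"
    proof (rule Dbounded_subset[OF Dbounded_lincomb[OF A A, of 1]], clarify)
      fix \<epsilon> x assume x: "x \<in> K"
      let ?b = "\<beta> (\<epsilon> / e (idx \<epsilon>))"
      have "dx bs (F (idx \<epsilon>) \<epsilon>) x = (\<lambda>\<xi>. complex_of_real (1 - ?b) * dx bs (\<psi> 0) x \<xi> +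
          complex_of_real ?b * dx bs (\<psi> (idx \<epsilon>)) x \<xi>)"
        unfolding F_def by (rule dx_lincomb[of \<Omega>]) (use C K x in \<open>auto simp: CinfA0_def\<close>)
      moreover have "norm (complex_of_real (1 - ?b)) \<le> 1" "norm (complex_of_real ?b) \<le> 1"
        using \<beta>b[of "\<epsilon> / e (idx \<epsilon>)"] unfolding norm_of_real by auto
      moreover have "dx bs (\<psi> 0) x \<in> ?A" "dx bs (\<psi> (idx \<epsilon>)) x \<in> ?A" using x by auto
      ultimately show "\<exists>a b f g. dx bs (F (idx \<epsilon>) \<epsilon>) x = (\<lambda>\<xi>. a * f \<xi> + b * g \<xi>) \<and>
          f \<in> ?A \<and> g \<in> ?A \<and> norm a \<le> 1 \<and> norm b \<le> 1"
        by blast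
    qed
  qed
  \<comment> \<open>\<open>smooth_on_set\<close> wants an extension to an open set; the formula for
    \<open>\<Phi>\<close> makes sense for parameters beyond 1 as well.\<close>
  moreover have "smoothD ({0<..} \<times> \<Omega>) UNIV \<Phi>"
    unfolding smoothD_iff
  proof (intro conjI allI impI)
    show "open ({0::real<..} \<times> \<Omega>)" using assms(1) by (intro open_Times) auto
    have "curve_smooth (\<Union>n\<in>UNIV. (J n \<times> \<Omega>) \<times> UNIV) (\<lambda>p. \<Phi> (fst p) (snd p))"
    proof (rule curve_smooth_Union)
      fix n
      show "open ((J n \<times> \<Omega>) \<times> (UNIV :: 'a set))" using openJ assms(1) by (intro open_Times) auto
      have sm: "curve_smooth ((J n \<times> \<Omega>) \<times> UNIV) (\<lambda>p. \<psi> k (snd (fst p)) (snd p))" for k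
      proof (rule curve_smoothI)
        fix c :: "real \<Rightarrow> (real \<times> 'a) \<times> 'a" assume c: "smooth_curve c" "\<And>t. c t \<in> (J n \<times> \<Omega>) \<times> UNIV"
        have "curve_smooth (\<Omega> \<times> UNIV) (\<lambda>p. \<psi> k (fst p) (snd p))"
          using C[of k] by (simp add: CinfA0_def smoothD_iff)
        from curve_smoothD[OF this smooth_curve_Pair[OF smooth_curve_snd[OF smooth_curve_fst[OF c(1)]] smooth_curve_snd[OF c(1)]]]
        show "smooth_curve (\<lambda>t. \<psi> k (snd (fst (c t))) (snd (c t)))"
          using c(2) by (simp add: mem_Times_iff)
      qed
      have b: "curve_smooth ((J n \<times> \<Omega>) \<times> UNIV) (\<lambda>p. \<beta> (fst (fst p) / e n))"
        by (rule curve_smoothI, rule \<beta>s)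
           (auto simp: divide_inverse intro!: smooth_curve_mult smooth_curve_fst)
      have "curve_smooth ((J n \<times> \<Omega>) \<times> UNIV) (\<lambda>p. complex_of_real (1 + (- 1) * \<beta> (fst (fst p) / e n)) * \<psi> 0 (snd (fst p)) (snd p) +
          complex_of_real (\<beta> (fst (fst p) / e n)) * \<psi> n (snd (fst p)) (snd p))"
        by (intro curve_smooth_add curve_smooth_mult[of _ _ "\<lambda>p. \<psi> _ (snd (fst p)) (snd p)"] curve_smooth_of_real sm b curve_smooth_const curve_smooth_mult[of _ "\<lambda>p. - 1"])
      then show "curve_smooth ((J n \<times> \<Omega>) \<times> UNIV) (\<lambda>p. \<Phi> (fst p) (snd p))"
        by (rule curve_smooth_cong[rotated]) (auto simp: \<Phi>J F_def)
    qed
    moreover have "(\<Union>n\<in>UNIV. (J n \<times> \<Omega>) \<times> (UNIV :: 'a set)) = ({0::real<..} \<times> \<Omega>) \<times> UNIV"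
      unfolding J_cover[symmetric] by auto
    ultimately show "curve_smooth (({0<..} \<times> \<Omega>) \<times> UNIV) (\<lambda>p. \<Phi> (fst p) (snd p))" by simp
    fix c :: "real \<Rightarrow> real \<times> 'a" and u v assume c: "smooth_curve c \<and> (\<forall>t. c t \<in> {0<..} \<times> \<Omega>)"
    let ?K = "(\<lambda>t. snd (c t)) ` {u..v}"
    have "compact ?K"
      by (intro compact_continuous_image smooth_curve_continuous smooth_curve_snd) (use c in auto)
    moreover have "?K \<subseteq> \<Omega>" using c by (auto simp: mem_Times_iff)
    ultimately obtain M where M: "compact M" "\<And>\<phi> x. \<phi> \<in> range \<psi> \<Longrightarrow> x \<in> ?K \<Longrightarrow> supp (\<phi> x) \<subseteq> M"
      by (rule bounded_CinfA0_supp[OF bd]) (rule that)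
    have "supp (\<Phi> (c t)) \<subseteq> M" if "t \<in> {u..v}" for t
    proof -
      have "snd (c t) \<in> ?K" using that by blast
      then have "supp (\<psi> k (snd (c t))) \<subseteq> M" for k using M(2)[of "\<psi> k"] by blast
      then show ?thesis unfolding \<Phi>_def F_def by (intro order_trans[OF supp_lincomb] Un_least)
    qed
    then show "\<exists>M. compact M \<and> (\<forall>t\<in>{u..v}. supp (\<Phi> (c t)) \<subseteq> M)" using M(1) by blast
  qed
  then have "smooth_on_set ({0<..1} \<times> \<Omega>) \<Phi>"
    unfolding smooth_on_set_def by (intro exI[of _ "{0<..} \<times> \<Omega>"] exI[of _ \<Phi>]) auto
  ultimately have "Cb_smooth \<Omega> \<Phi>" by (simp add: Cb_smooth_def)
  moreover have "\<Phi> (e n, y) = \<psi> n y" for n y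
  proof -
    have "e n \<in> J n" using e(1)[of n] e(2)[of "n - 1"] by (cases n) (auto simp: J_def)
    then show ?thesis using e(1)[of n] by (simp add: \<Phi>J F_def \<beta>1)
  qed
  moreover have "\<exists>n a. \<Phi> (\<epsilon>, y) = (\<lambda>\<xi>. complex_of_real (1 - a) * \<psi> 0 y \<xi> + complex_of_real a * \<psi> n y \<xi>)" for \<epsilon> y
    unfolding \<Phi>_def F_def by auto
  ultimately show ?thesis by (rule that)
qed

section \<open>From (D) to (A)\<close>

lemma est_mono:
  assumes "est \<Omega> R \<Phi> \<epsilon> K bs N C" "C \<le> C'" "\<epsilon> > 0"
  shows "est \<Omega> R \<Phi> \<epsilon> K bs N C'"
proof -
  have "C / \<epsilon> ^ N \<le> C' / \<epsilon> ^ N" using assms by (intro divide_right_mono) auto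
  then show ?thesis using assms(1) unfolding est_def by (meson order_trans)
qed

lemma compact_subset_open_radius:
  fixes K :: "'a::heine_borel set"
  assumes "compact K" "open \<Omega>" "K \<subseteq> \<Omega>"
  obtains d where "d > 0" "\<And>x y. x \<in> K \<Longrightarrow> dist x y < d \<Longrightarrow> y \<in> \<Omega>"
proof -
  obtain d where "d > 0" "(\<Union>x\<in>K. ball x d) \<subseteq> \<Omega>"
    using compact_subset_open_imp_ball_epsilon_subset[OF assms] by blast
  then show ?thesis using that[of d] by (meson UN_I mem_ball subsetD)
qed

lemma inUdelta_if_small_supp:
  assumes "A0 f" "x \<in> \<Omega>" "\<delta> > 0"
    and "\<And>\<xi>. \<xi> \<in> supp f \<Longrightarrow> x + \<delta> *\<^sub>R \<xi> \<in> \<Omega>"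
  shows "inUdelta \<Omega> \<delta> (f, x)"
  unfolding inUdelta_def
proof (intro conjI subsetI)
  fix \<xi> assume "\<xi> \<in> supp (fst (f, x))"
  then have "x + \<delta> *\<^sub>R \<xi> \<in> \<Omega>" using assms(4) by simp
  then show "\<xi> \<in> (\<lambda>z. inverse \<delta> *\<^sub>R (z - snd (f, x))) ` \<Omega>"
    using assms(3) by (intro image_eqI[of _ _ "x + \<delta> *\<^sub>R \<xi>"]) simp_all
qed (use assms in auto)

text \<open>(D) supplies one N for all nets and (A) demands one N for all B, so the same N serves:
  failure for some B with this N is turned into a single net that violates (D).\<close>

lemma condD_imp_condA:
  fixes \<Omega> :: "'a::euclidean_space set"
  assumes "open \<Omega>" "condD \<Omega> R"
  shows "condA \<Omega> R"
  unfolding condA_def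
proof (intro allI impI)
  fix K and bs :: "'a list" assume K: "compact K \<and> K \<subseteq> \<Omega> \<and> set bs \<subseteq> Basis"
  from assms(2)[unfolded condD_def cond_net_def, rule_format, OF K]
  obtain N where N: "\<And>\<phi>. Cb_smooth \<Omega> \<phi> \<and>
      (\<forall>\<epsilon>\<in>{0<..1}. \<forall>\<delta>\<in>{0<..1}. \<forall>x\<in>K. inUdelta \<Omega> \<delta> (\<phi> (\<epsilon>, x), x)) \<Longrightarrow>
      \<exists>C \<eta>. C > 0 \<and> \<eta> > 0 \<and> (\<forall>\<epsilon>\<in>{0<..<\<eta>}. est \<Omega> R (\<lambda>y. \<phi> (\<epsilon>, y)) \<epsilon> K bs N C)"
    by blast
  show "\<exists>N. \<forall>B. bounded_CinfA0 \<Omega> B \<longrightarrow>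
      (\<exists>C \<eta>. C > 0 \<and> \<eta> > 0 \<and> (\<forall>\<phi>\<in>B. \<forall>\<epsilon>\<in>{0<..<\<eta>}. est \<Omega> R \<phi> \<epsilon> K bs N C))"
  proof (rule exI[of _ N], intro allI impI, rule ccontr)
    fix B assume B: "bounded_CinfA0 \<Omega> B"
    assume "\<nexists>C \<eta>. C > 0 \<and> \<eta> > 0 \<and> (\<forall>\<phi>\<in>B. \<forall>\<epsilon>\<in>{0<..<\<eta>}. est \<Omega> R \<phi> \<epsilon> K bs N C)"
    then have fail: "\<exists>\<phi> \<epsilon>. \<phi> \<in> B \<and> \<epsilon> \<in> {0<..<\<eta>} \<and> \<not> est \<Omega> R \<phi> \<epsilon> K bs N C" if "C > 0" "\<eta> > 0" for C \<eta>
      using that by blast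
    obtain M where M: "compact M" "\<And>\<phi> x. \<phi> \<in> B \<Longrightarrow> x \<in> K \<Longrightarrow> supp (\<phi> x) \<subseteq> M"
      using K bounded_CinfA0_supp[OF B, of K] by metis
    obtain d where d: "d > 0" "\<And>x y. x \<in> K \<Longrightarrow> dist x y < d \<Longrightarrow> y \<in> \<Omega>"
      using compact_subset_open_radius[of K \<Omega>] K assms(1) by metis
    obtain b where b: "b > 0" "\<And>\<xi>. \<xi> \<in> M \<Longrightarrow> norm \<xi> \<le> b"
      using compact_imp_bounded[OF M(1)] bounded_pos by metis
    \<comment> \<open>With \<rho> b < d the supports scaled by \<rho> stay inside \<Omega> - x for
      all x in K, and a factor \<delta> <= 1 only shrinks them further. The bound \<rho> <= 1 serves
      to compare e n with \<epsilon> n below.\<close>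
    define \<rho> where "\<rho> = min 1 (d / (2 * b))"
    have \<rho>: "0 < \<rho>" "\<rho> \<le> 1" "\<rho> * b < d"
    proof -
      have "\<rho> * b \<le> d / (2 * b) * b" using b(1) by (intro mult_right_mono) (auto simp: \<rho>_def)
      then show "\<rho> * b < d" using b(1) d(1) by simp
    qed (use b d in \<open>auto simp: \<rho>_def\<close>)
    \<comment> \<open>The constant is n + 1 because \<open>fail\<close> needs a positive one; the
      factor (1/2)^n will make e n tend to 0.\<close>
    define P where "P n p \<longleftrightarrow> fst p \<in> B \<and> 0 < snd p \<and> snd p < \<rho> * (1/2) ^ n \<and>
        \<not> est \<Omega> R (fst p) (snd p) K bs N (real (Suc n))" for n :: nat and p :: "('a \<Rightarrow> 'a \<Rightarrow> complex) \<times> real"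
    have "\<exists>f. \<forall>n. P n (f n) \<and> snd (f (Suc n)) < snd (f n) / 2"
    proof (rule dependent_nat_choice)
      show "\<exists>p. P 0 p" using fail[of 1 \<rho>] \<rho> by (auto simp: P_def)
      fix p and n :: nat assume "P n p"
      \<comment> \<open>As a value of \<eta> this minimum secures both the halving required by
        \<open>interpolating_net\<close> and the decay.\<close>
      then have "min (snd p / 2) (\<rho> * (1/2) ^ Suc n) > 0" using \<rho> by (auto simp: P_def)
      from fail[OF _ this, of "real (Suc (Suc n))"]
      show "\<exists>q. P (Suc n) q \<and> snd q < snd p / 2" by (auto simp: P_def)
    qed
    then obtain f where f: "\<And>n. P n (f n)" "\<And>n. snd (f (Suc n)) < snd (f n) / 2" by blast
    define \<phi> where "\<phi> n = fst (f n)" for n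
    define \<epsilon> where "\<epsilon> n = snd (f n)" for n
    have seq: "\<phi> n \<in> B" "0 < \<epsilon> n" "\<epsilon> n < \<rho> * (1/2) ^ n"
        "\<not> est \<Omega> R (\<phi> n) (\<epsilon> n) K bs N (real (Suc n))" "\<epsilon> (Suc n) < \<epsilon> n / 2" for n
      using f(1)[of n] f(2)[of n] by (auto simp: P_def \<phi>_def \<epsilon>_def)
    define \<psi> where "\<psi> n y = Seps \<rho> (\<phi> n y)" for n y
    \<comment> \<open>Scaling by \<rho> and then by e n is scaling by \<epsilon> n, so the net at e
      n reproduces the violated estimate for \<phi> n at \<epsilon> n.\<close>
    define e where "e n = \<epsilon> n / \<rho>" for n
    have "bounded_CinfA0 \<Omega> (range \<psi>)"
      by (rule bounded_CinfA0_subset[OF bounded_CinfA0_Seps[OF B \<rho>(1)]])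
         (use seq(1) in \<open>auto simp: \<psi>_def fun_eq_iff image_iff\<close>)
    then obtain \<Phi> where \<Phi>: "Cb_smooth \<Omega> \<Phi>" "\<And>n y. \<Phi> (e n, y) = \<psi> n y"
      "\<And>\<epsilon> y. \<exists>n a. \<Phi> (\<epsilon>, y) = (\<lambda>\<xi>. complex_of_real (1 - a) * \<psi> 0 y \<xi> + complex_of_real a * \<psi> n y \<xi>)"
    proof (rule interpolating_net[OF assms(1)])
      show "0 < e n" for n using seq(2) \<rho>(1) by (simp add: e_def)
      show "e (Suc n) < e n / 2" for n using seq(5)[of n] \<rho>(1) by (simp add: e_def field_simps)
    qed (rule that)
    have "inUdelta \<Omega> \<delta> (\<Phi> (\<epsilon>, x), x)" if "\<epsilon> \<in> {0<..1}" "\<delta> \<in> {0<..1}" "x \<in> K" for \<epsilon> \<delta> x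
    proof (rule inUdelta_if_small_supp)
      show "A0 (\<Phi> (\<epsilon>, x))"
        using \<Phi>(1) that K by (auto simp: Cb_smooth_def Cb_weak_def CinfA0_def)
      fix \<xi> assume \<xi>: "\<xi> \<in> supp (\<Phi> (\<epsilon>, x))"
      have "supp (\<psi> n x) \<subseteq> (\<lambda>\<xi>. \<rho> *\<^sub>R \<xi>) ` M" for n
        unfolding \<psi>_def using supp_Seps[OF \<rho>(1), of "\<phi> n x"] M(2)[OF seq(1) that(3), of n] by blast
      moreover obtain n a where "\<Phi> (\<epsilon>, x) = (\<lambda>\<xi>. complex_of_real (1 - a) * \<psi> 0 x \<xi> + complex_of_real a * \<psi> n x \<xi>)"
        using \<Phi>(3) by blast
      ultimately have "supp (\<Phi> (\<epsilon>, x)) \<subseteq> (\<lambda>\<xi>. \<rho> *\<^sub>R \<xi>) ` M"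
        using supp_lincomb[of "complex_of_real (1 - a)" "\<psi> 0 x" "complex_of_real a" "\<psi> n x"]
        by (metis (no_types, lifting) Un_least order_trans)
      then obtain \<zeta> where \<zeta>: "\<zeta> \<in> M" "\<xi> = \<rho> *\<^sub>R \<zeta>" using \<xi> by blast
      have "norm (\<delta> *\<^sub>R \<xi>) = \<delta> * (\<rho> * norm \<zeta>)" using that \<rho> \<zeta> by simp
      also have "\<dots> \<le> 1 * (\<rho> * b)" using that \<rho> b(2)[OF \<zeta>(1)] by (intro mult_mono) auto
      also have "\<dots> < d" using \<rho> by simp
      finally show "x + \<delta> *\<^sub>R \<xi> \<in> \<Omega>" by (intro d(2)[OF that(3)]) (simp add: dist_norm)
    qed (use that K in auto)
    then have "\<forall>\<epsilon>\<in>{0<..1}. \<forall>\<delta>\<in>{0<..1}. \<forall>x\<in>K. inUdelta \<Omega> \<delta> (\<Phi> (\<epsilon>, x), x)" by blast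
    from N[OF conjI[OF \<Phi>(1) this]] obtain C \<eta> where C: "C > 0" "\<eta> > 0"
      "\<And>\<epsilon>. \<epsilon> \<in> {0<..<\<eta>} \<Longrightarrow> est \<Omega> R (\<lambda>y. \<Phi> (\<epsilon>, y)) \<epsilon> K bs N C" by blast
    obtain k where k: "(1/2) ^ k < \<eta>" using real_arch_pow_inv[of \<eta> "1/2"] C(2) by auto
    obtain l :: nat where l: "C \<le> real l" using real_arch_simple by blast
    \<comment> \<open>n >= k brings e n below \<eta>, and n >= l makes the violated constant n + 1
      at least C.\<close>
    define n where "n = max k l"
    have en: "0 < e n" "e n < \<eta>"
    proof -
      have "e n < (1/2) ^ n" using seq(3)[of n] \<rho>(1) by (simp add: e_def divide_less_eq mult.commute)
      also have "\<dots> \<le> (1/2) ^ k" by (intro power_decreasing) (auto simp: n_def)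
      finally show "e n < \<eta>" using k by simp
    qed (use seq(2) \<rho> in \<open>simp add: e_def\<close>)
    have "est \<Omega> R (\<lambda>y. \<Phi> (e n, y)) (e n) K bs N C" by (rule C(3)) (use en in auto)
    then have "est \<Omega> R (\<psi> n) (e n) K bs N C" by (simp add: \<Phi>(2))
    moreover have "Seps (e n) (\<psi> n y) = Seps (\<epsilon> n) (\<phi> n y)" for y
      using \<rho>(1) by (simp add: \<psi>_def Seps_Seps e_def)
    \<comment> \<open>As \<rho> <= 1, e n is at least \<epsilon> n, so the estimate at e n is the
      stronger one.\<close>
    moreover have "C / e n ^ N \<le> C / \<epsilon> n ^ N"
    proof -
      have "\<epsilon> n \<le> e n" using \<rho> seq(2)[of n] by (simp add: e_def le_divide_eq mult_left_le)
      then show ?thesis using C(1) seq(2)[of n] en by (intro divide_left_mono power_mono) auto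
    qed
    ultimately have "est \<Omega> R (\<phi> n) (\<epsilon> n) K bs N C" unfolding est_def by (simp only:) (meson order_trans)
    then have "est \<Omega> R (\<phi> n) (\<epsilon> n) K bs N (real (Suc n))"
      by (rule est_mono) (use l seq(2) in \<open>auto simp: n_def\<close>)
    then show False using seq(4) by blast
  qed
qed

text \<open>The sets have separate tasks: on V the extended net must be unchanged, off the closed
  set S it must be constant, on the open set W products are differentiated, and the compact set L
  supplies bounds. They are finite unions of balls, of radii r, 2 r, 3 r and 3 r.\<close>

lemma smooth_cutoff:
  fixes K :: "'a::euclidean_space set"
  assumes "compact K" "open \<Omega>" "K \<subseteq> \<Omega>"
  obtains \<rho> :: "'a \<Rightarrow> real" and V S W L where "curve_smooth UNIV \<rho>" "open V" "K \<subseteq> V"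
    "\<And>x. x \<in> V \<Longrightarrow> \<rho> x = 1" "closed S" "\<And>x. x \<notin> S \<Longrightarrow> \<rho> x = 0" "V \<subseteq> S" "S \<subseteq> W" "open W" "W \<subseteq> L"
    "compact L" "L \<subseteq> \<Omega>"
proof -
  have "\<exists>r>0. cball x (3 * r) \<subseteq> \<Omega>" if x: "x \<in> K" for x
  proof -
    obtain d where "d > 0" "cball x d \<subseteq> \<Omega>" using x assms open_contains_cball by blast
    then show ?thesis by (intro exI[of _ "d / 3"]) auto
  qed
  then obtain r where r: "\<And>x. x \<in> K \<Longrightarrow> r x > 0" "\<And>x. x \<in> K \<Longrightarrow> cball x (3 * r x) \<subseteq> \<Omega>" by metis
  have cov: "K \<subseteq> (\<Union>x\<in>K. ball x (r x))" using r(1) by force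
  obtain C where C: "C \<subseteq> K" "finite C" "K \<subseteq> (\<Union>x\<in>C. ball x (r x))"
    by (rule compactE_image[OF assms(1) _ cov]) auto
  \<comment> \<open>One vanishing factor gives \<rho> = 1 and all factors equal to 1 give \<rho> =
    0, so the ball cutoffs are merged without a normalizing denominator.\<close>
  define \<rho> where "\<rho> x = 1 - (\<Prod>c\<in>C. 1 - smooth_step ((x - c) \<bullet> (x - c) / (r c)\<^sup>2))" for x
  have e: "(x - c) \<bullet> (x - c) / (r c)\<^sup>2 = (dist c x / r c)\<^sup>2" for x c
    by (metis dist_norm norm_minus_commute power2_norm_eq_inner power_divide)
  have pos: "r c > 0" if "c \<in> C" for c using r(1) C(1) that by blast
  show ?thesis
  proof (rule that)
    show "curve_smooth UNIV \<rho>"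
      unfolding \<rho>_def divide_inverse
      by (rule curve_smoothI)
         (intro smooth_curve_diff smooth_curve_const smooth_curve_prod C smooth_curve_smooth_step
           smooth_curve_mult smooth_curve_inner)
    show "K \<subseteq> (\<Union>c\<in>C. ball c (r c))" by (rule C)
    show "\<rho> x = 1" if "x \<in> (\<Union>c\<in>C. ball c (r c))" for x
    proof -
      obtain c where c: "c \<in> C" "dist c x < r c" using \<open>x \<in> _\<close> by auto
      then have "(dist c x / r c)\<^sup>2 \<le> 1" using pos[OF c(1)] by (intro power_le_one) auto
      then have "(\<Prod>c\<in>C. 1 - smooth_step ((x - c) \<bullet> (x - c) / (r c)\<^sup>2)) = 0"
        using c(1) C(2) by (intro prod_zero bexI[of _ c]) (auto simp: e smooth_step_simps)
      then show ?thesis by (simp add: \<rho>_def)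
    qed
    show "\<rho> x = 0" if "x \<notin> (\<Union>c\<in>C. cball c (2 * r c))" for x
    proof -
      have "smooth_step ((x - c) \<bullet> (x - c) / (r c)\<^sup>2) = 0" if c: "c \<in> C" for c
      proof -
        have "2 * r c < dist c x" using c \<open>x \<notin> _\<close> by auto
        then have "2\<^sup>2 \<le> (dist c x / r c)\<^sup>2" using pos[OF c] by (intro power_mono) (auto simp: field_simps)
        then show ?thesis by (simp add: e smooth_step_simps)
      qed
      then show ?thesis by (simp add: \<rho>_def)
    qed
    show "(\<Union>c\<in>C. ball c (r c)) \<subseteq> (\<Union>c\<in>C. cball c (2 * r c))" using pos by force
    show "(\<Union>c\<in>C. cball c (2 * r c)) \<subseteq> (\<Union>c\<in>C. ball c (3 * r c))" using pos by force
    show "(\<Union>c\<in>C. ball c (3 * r c)) \<subseteq> (\<Union>c\<in>C. cball c (3 * r c))" by force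
    show "(\<Union>c\<in>C. cball c (3 * r c)) \<subseteq> \<Omega>" using r(2) C(1) by blast
    show "closed (\<Union>c\<in>C. cball c (2 * r c))" using C(2) by (intro closed_UN) auto
    show "compact (\<Union>c\<in>C. cball c (3 * r c))" using C(2) by (intro compact_UN) auto
  qed auto
qed

text \<open>Leibniz's rule without its formula: splitting off the innermost derivative turns the
  product into (d_b \<rho>) F + \<rho> (d_b F), two products of the same kind. Hence \<rho> and F
  are arbitrary in the induction, and boundedness of F is assumed at all orders. Compactness of L
  bounds each successive \<rho>.\<close>

lemma Dbounded_mult_family:
  fixes F :: "'j \<Rightarrow> 'a::euclidean_space \<Rightarrow> 'a \<Rightarrow> complex" and \<rho> :: "'a \<Rightarrow> complex"
  assumes "open V" "V \<subseteq> L" "compact L"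
  shows "set bs \<subseteq> Basis \<Longrightarrow> curve_smooth UNIV \<rho> \<Longrightarrow>
    (\<And>j \<xi>. j \<in> I \<Longrightarrow> curve_smooth V (\<lambda>y. F j y \<xi>)) \<Longrightarrow>
    (\<And>bs. set bs \<subseteq> Basis \<Longrightarrow> Dbounded {dx bs (F j) x |j x. j \<in> I \<and> x \<in> V}) \<Longrightarrow>
    Dbounded {dx bs (\<lambda>y \<xi>. \<rho> y * F j y \<xi>) x |j x. j \<in> I \<and> x \<in> V}"
proof (induction bs arbitrary: F \<rho> rule: rev_induct)
  case Nil
  have "continuous_on L \<rho>"
    using curve_smooth_isCont[OF Nil.prems(2)] by (simp add: continuous_at_imp_continuous_on)
  then have "bounded (\<rho> ` L)" using assms(3) by (intro compact_imp_bounded compact_continuous_image)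
  then obtain M where M: "M > 0" "\<And>x. x \<in> L \<Longrightarrow> norm (\<rho> x) \<le> M" by (auto simp: bounded_pos)
  let ?A = "{dx [] (F j) x |j x. j \<in> I \<and> x \<in> V}"
  have A: "Dbounded ?A" by (rule Nil.prems(4)) simp
  show ?case
  proof (rule Dbounded_subset[OF Dbounded_lincomb[OF A A, of M]], clarify)
    fix j x assume jx: "j \<in> I" "x \<in> V"
    have "dx [] (\<lambda>y \<xi>. \<rho> y * F j y \<xi>) x = (\<lambda>\<xi>. \<rho> x * dx [] (F j) x \<xi> + 0 * dx [] (F j) x \<xi>)"
      by (simp add: dx_def)
    moreover have "norm (\<rho> x) \<le> M" "norm (0::complex) \<le> M" using M jx assms by auto
    moreover have "dx [] (F j) x \<in> ?A" using jx by blast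
    ultimately show "\<exists>a b f g. dx [] (\<lambda>y \<xi>. \<rho> y * F j y \<xi>) x = (\<lambda>\<xi>. a * f \<xi> + b * g \<xi>) \<and>
        f \<in> ?A \<and> g \<in> ?A \<and> norm a \<le> M \<and> norm b \<le> M" by blast
  qed
next
  case (snoc b bs)
  define F' where "F' j y \<xi> = pd b (\<lambda>y. F j y \<xi>) y" for j y \<xi>
  have \<rho>: "curve_smooth V \<rho>" by (rule curve_smooth_subset[OF snoc.prems(2)]) simp
  have F': "curve_smooth V (\<lambda>y. F' j y \<xi>)" if "j \<in> I" for j \<xi>
    unfolding F'_def by (intro curve_smooth_pd assms snoc.prems that)
  have dxF': "dx as (F' j) = dx (as @ [b]) (F j)" for as j
    by (intro ext) (simp add: dx_def F'_def pdl_append)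
  let ?A = "{dx bs (\<lambda>y \<xi>. pd b \<rho> y * F j y \<xi>) x |j x. j \<in> I \<and> x \<in> V}"
  let ?B = "{dx bs (\<lambda>y \<xi>. \<rho> y * F' j y \<xi>) x |j x. j \<in> I \<and> x \<in> V}"
  have A: "Dbounded ?A"
    by (rule snoc.IH) (use snoc.prems in \<open>auto intro: curve_smooth_pd\<close>)
  have B: "Dbounded ?B"
  proof (rule snoc.IH)
    show "Dbounded {dx as (F' j) x |j x. j \<in> I \<and> x \<in> V}" if "set as \<subseteq> Basis" for as
      unfolding dxF' by (rule snoc.prems(4)) (use that snoc.prems(1) in auto)
  qed (use snoc.prems F' in auto)
  show ?case
  proof (rule Dbounded_subset[OF Dbounded_lincomb[OF A B, of 1]], clarify)
    fix j x assume jx: "j \<in> I" "x \<in> V"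
    have "dx (bs @ [b]) (\<lambda>y \<xi>. \<rho> y * F j y \<xi>) x =
        (\<lambda>\<xi>. 1 * dx bs (\<lambda>y \<xi>. pd b \<rho> y * F j y \<xi>) x \<xi> + 1 * dx bs (\<lambda>y \<xi>. \<rho> y * F' j y \<xi>) x \<xi>)"
    proof
      fix \<xi>
      have "pdl bs (pd b (\<lambda>y. \<rho> y * F j y \<xi>)) x = pdl bs (\<lambda>y. 1 * (pd b \<rho> y * F j y \<xi>) + 1 * (\<rho> y * F' j y \<xi>)) x"
        by (rule pdl_local[OF assms(1) _ jx(2)])
           (simp add: F'_def pd_mult[OF assms(1) \<rho> snoc.prems(3)[OF jx(1)]])
      also have "\<dots> = 1 * pdl bs (\<lambda>y. pd b \<rho> y * F j y \<xi>) x + 1 * pdl bs (\<lambda>y. \<rho> y * F' j y \<xi>) x"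
        by (rule pdl_lincomb[OF assms(1) _ _ jx(2)])
           (intro curve_smooth_mult curve_smooth_pd assms \<rho> snoc.prems F' jx)+
      finally show "dx (bs @ [b]) (\<lambda>y \<xi>. \<rho> y * F j y \<xi>) x \<xi> =
        1 * dx bs (\<lambda>y \<xi>. pd b \<rho> y * F j y \<xi>) x \<xi> + 1 * dx bs (\<lambda>y \<xi>. \<rho> y * F' j y \<xi>) x \<xi>"
        by (simp add: dx_def pdl_append)
    qed
    moreover have "dx bs (\<lambda>y \<xi>. pd b \<rho> y * F j y \<xi>) x \<in> ?A" "dx bs (\<lambda>y \<xi>. \<rho> y * F' j y \<xi>) x \<in> ?B"
      using jx by blast+
    moreover have "norm (1::complex) \<le> 1" by simp
    ultimately show "\<exists>a ba f g. dx (bs @ [b]) (\<lambda>y \<xi>. \<rho> y * F j y \<xi>) x = (\<lambda>\<xi>. a * f \<xi> + ba * g \<xi>) \<and>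
        f \<in> ?A \<and> g \<in> ?B \<and> norm a \<le> 1 \<and> norm ba \<le> 1" by blast
  qed
qed

lemma pdl_const: "pdl bs (\<lambda>_. a) = (\<lambda>_. if bs = [] then a else 0)"
  by (induction bs) (auto simp: pd_def fun_eq_iff)

lemma Dbounded_dx_const:
  assumes "Dbounded {f}"
  shows "Dbounded {dx bs (\<lambda>_. f) x |j x. P j x}"
proof (rule Dbounded_subset[OF Dbounded_lincomb[OF assms assms, of 1]], clarify)
  fix x
  have "dx bs (\<lambda>_. f) x = (\<lambda>\<xi>. (if bs = [] then 1 else 0) * f \<xi> + 0 * f \<xi>)"
    by (simp add: dx_def pdl_const)
  moreover have "norm (if bs = [] then 1 else 0 :: complex) \<le> 1" "norm (0::complex) \<le> 1" by auto
  ultimately show "\<exists>a b fa g. dx bs (\<lambda>_. f) x = (\<lambda>\<xi>. a * fa \<xi> + b * g \<xi>) \<and>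
      fa \<in> {f} \<and> g \<in> {f} \<and> norm a \<le> 1 \<and> norm b \<le> 1" by blast
qed

text \<open>The values of a net over W are deformed into a fixed f outside the support of a cutoff; the
  result is everywhere defined because the set of functions of integral 1 is affine.\<close>
lemma extend_net:
  fixes \<Omega> :: "'a::euclidean_space set" and \<phi> :: "real \<Rightarrow> 'a \<Rightarrow> 'a \<Rightarrow> complex"
  assumes "open \<Omega>" and \<rho>: "curve_smooth UNIV \<rho>" and S: "closed S" "\<And>x. x \<notin> S \<Longrightarrow> \<rho> x = 0"
    and W: "S \<subseteq> W" "open W" "W \<subseteq> L" "compact L" "L \<subseteq> \<Omega>"
    and sm: "\<And>\<epsilon>. \<epsilon> \<in> I \<Longrightarrow> curve_smooth (W \<times> UNIV) (\<lambda>p. \<phi> \<epsilon> (fst p) (snd p))"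
    and A0: "\<And>\<epsilon> x. \<epsilon> \<in> I \<Longrightarrow> x \<in> L \<Longrightarrow> A0 (\<phi> \<epsilon> x)"
    and bd: "\<And>bs. set bs \<subseteq> Basis \<Longrightarrow> Dbounded {dx bs (\<phi> \<epsilon>) x |\<epsilon> x. \<epsilon> \<in> I \<and> x \<in> L}"
    and f: "A0 f" "Dbounded {f}"
  shows "bounded_CinfA0 \<Omega> ((\<lambda>\<epsilon> y \<xi>. complex_of_real (\<rho> y) * \<phi> \<epsilon> y \<xi> + complex_of_real (1 - \<rho> y) * f \<xi>) ` I)"
proof -
  define \<Phi> where "\<Phi> \<epsilon> y \<xi> = complex_of_real (\<rho> y) * \<phi> \<epsilon> y \<xi> + complex_of_real (1 - \<rho> y) * f \<xi>" for \<epsilon> y \<xi>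
  have off: "\<Phi> \<epsilon> y = f" if "y \<notin> S" for \<epsilon> y using S(2)[OF that] by (auto simp: \<Phi>_def)
  have fs: "curve_smooth UNIV f" using f(1) by (simp add: A0_def test_fun_iff)
  have \<rho>1: "curve_smooth UNIV (\<lambda>y. complex_of_real (1 + (- 1) * \<rho> y))"
    by (intro curve_smooth_of_real curve_smooth_add curve_smooth_mult curve_smooth_const \<rho>)
  have comp: "curve_smooth (X \<times> UNIV) (\<lambda>p. g (fst p))" if "curve_smooth UNIV g"
    for g :: "'a \<Rightarrow> complex" and X :: "'a set"
    by (rule curve_smoothI) (rule curve_smoothD[OF that], auto intro: smooth_curve_fst)
  have comp2: "curve_smooth (X \<times> UNIV) (\<lambda>p. f (snd p))" for X :: "'a set"
    by (rule curve_smoothI) (rule curve_smoothD[OF fs], auto intro: smooth_curve_snd)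
  have slice: "curve_smooth W (\<lambda>y. \<phi> \<epsilon> y \<xi>)" if "\<epsilon> \<in> I" for \<epsilon> \<xi>
  proof (rule curve_smoothI)
    fix c assume "smooth_curve c" "\<And>t. c t \<in> W"
    then show "smooth_curve (\<lambda>t. \<phi> \<epsilon> (c t) \<xi>)"
      using curve_smoothD[OF sm[OF that], of "\<lambda>t. (c t, \<xi>)"] by (simp add: smooth_curve_Pair)
  qed
  have C: "CinfA0 \<Omega> (\<Phi> \<epsilon>)" if \<epsilon>: "\<epsilon> \<in> I" for \<epsilon>
    unfolding CinfA0_def smoothD_iff
  proof (intro conjI allI impI ballI assms(1))
    \<comment> \<open>W and \<Omega> - S are open and cover \<Omega>; on the second set the net is
      the constant f.\<close>
    have "curve_smooth (\<Union>X\<in>{W, \<Omega> - S}. X \<times> UNIV) (\<lambda>p. \<Phi> \<epsilon> (fst p) (snd p))"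
    proof (rule curve_smooth_Union)
      fix X assume X: "X \<in> {W, \<Omega> - S}"
      then show "open (X \<times> (UNIV :: 'a set))" using W(2) assms(1) S(1) by (auto intro!: open_Times open_Diff)
      have "curve_smooth (W \<times> UNIV) (\<lambda>p. complex_of_real (\<rho> (fst p)) * \<phi> \<epsilon> (fst p) (snd p) +
          complex_of_real (1 + (- 1) * \<rho> (fst p)) * f (snd p))"
        by (intro curve_smooth_add curve_smooth_mult[of _ _ "\<lambda>p. f (snd p)"]
          curve_smooth_mult[of _ _ "\<lambda>p. \<phi> _ (fst p) (snd p)"] sm \<epsilon> comp2
          comp[OF \<rho>1] comp[OF curve_smooth_of_real[OF \<rho>]])
      then have 1: "curve_smooth (W \<times> UNIV) (\<lambda>p. \<Phi> \<epsilon> (fst p) (snd p))" by (simp add: \<Phi>_def)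
      have 2: "curve_smooth ((\<Omega> - S) \<times> UNIV) (\<lambda>p. \<Phi> \<epsilon> (fst p) (snd p))"
        by (rule curve_smooth_cong[OF _ comp2]) (auto simp: off)
      show "curve_smooth (X \<times> UNIV) (\<lambda>p. \<Phi> \<epsilon> (fst p) (snd p))" using X 1 2 by blast
    qed
    moreover have "(\<Union>X\<in>{W, \<Omega> - S}. X \<times> (UNIV :: 'a set)) = \<Omega> \<times> UNIV" using W by auto
    ultimately show "curve_smooth (\<Omega> \<times> UNIV) (\<lambda>p. \<Phi> \<epsilon> (fst p) (snd p))" by simp
    show "A0 (\<Phi> \<epsilon> x)" if "x \<in> \<Omega>" for x
    proof (cases "x \<in> S")
      case True
      then have "A0 (\<phi> \<epsilon> x)" using A0[OF \<epsilon>] W by blast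
      then show ?thesis unfolding \<Phi>_def by (intro A0_lincomb f) (simp_all add: field_simps)
    qed (use off f in auto)
    fix c :: "real \<Rightarrow> 'a" and u v
    have "Dbounded {dx [] (\<phi> \<epsilon>) x |\<epsilon> x. \<epsilon> \<in> I \<and> x \<in> L}" by (rule bd) simp
    then obtain M where M: "compact M" "\<And>g. g \<in> {dx [] (\<phi> \<epsilon>) x |\<epsilon> x. \<epsilon> \<in> I \<and> x \<in> L} \<Longrightarrow> supp g \<subseteq> M"
      by (rule Dbounded_supp) (rule that)
    have "supp (\<Phi> \<epsilon> x) \<subseteq> M \<union> supp f" for x
    proof (cases "x \<in> S")
      case True
      then have "dx [] (\<phi> \<epsilon>) x \<in> {dx [] (\<phi> \<epsilon>) x |\<epsilon> x. \<epsilon> \<in> I \<and> x \<in> L}" using \<epsilon> W by blast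
      then have "supp (dx [] (\<phi> \<epsilon>) x) \<subseteq> M" by (rule M(2))
      then have "supp (\<phi> \<epsilon> x) \<subseteq> M" by (simp add: dx_def)
      then show ?thesis unfolding \<Phi>_def by (intro order_trans[OF supp_lincomb] Un_mono) auto
    qed (use off in auto)
    moreover have "compact (M \<union> supp f)" using M(1) f(1) by (auto simp: A0_def test_fun_def)
    ultimately show "\<exists>K. compact K \<and> (\<forall>t\<in>{u..v}. supp (\<Phi> \<epsilon> (c t)) \<subseteq> K)" by blast
  qed
  \<comment> \<open>The bound holds over all of \<Omega> at once: on W by the product rule, and off
    W because the net equals f on the open set - S, so only derivatives of a constant net
    occur.\<close>
  have "Dbounded {dx bs (\<Phi> \<epsilon>) x |\<epsilon> x. \<epsilon> \<in> I \<and> x \<in> \<Omega>}" if bs: "set bs \<subseteq> Basis" for bs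
  proof -
    let ?A = "{dx bs (\<lambda>y \<xi>. complex_of_real (\<rho> y) * \<phi> \<epsilon> y \<xi>) x |\<epsilon> x. \<epsilon> \<in> I \<and> x \<in> W}"
    let ?B = "{dx bs (\<lambda>y \<xi>. complex_of_real (1 - \<rho> y) * f \<xi>) x |\<epsilon> x. \<epsilon> \<in> I \<and> x \<in> W}"
    let ?D = "{dx bs (\<lambda>_. f) x |\<epsilon> x. \<epsilon> \<in> I \<and> x \<in> \<Omega>}"
    have A: "Dbounded ?A"
    proof (rule Dbounded_mult_family[OF W(2,3,4) bs curve_smooth_of_real[OF \<rho>] slice])
      show "Dbounded {dx as (\<phi> j) x |j x. j \<in> I \<and> x \<in> W}" if "set as \<subseteq> Basis" for as
        by (rule Dbounded_subset[OF bd[OF that]]) (use W in blast)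
    qed
    have B: "Dbounded ?B"
      by (rule Dbounded_mult_family[OF W(2,3,4) bs, where F = "\<lambda>_ _. f"])
         (use \<rho>1 f(2) in \<open>auto intro: curve_smooth_const Dbounded_dx_const\<close>)
    have D: "Dbounded ?D" by (rule Dbounded_dx_const[OF f(2)])
    show ?thesis
    proof (rule Dbounded_subset[OF Dbounded_Un[OF D Dbounded_lincomb[OF A B, of 1]]], clarify)
      fix \<epsilon> x assume ex: "\<epsilon> \<in> I" "x \<in> \<Omega>"
        and n: "\<not> (\<exists>a b fa g. dx bs (\<Phi> \<epsilon>) x = (\<lambda>\<xi>. a * fa \<xi> + b * g \<xi>) \<and> fa \<in> ?A \<and> g \<in> ?B \<and> norm a \<le> 1 \<and> norm b \<le> 1)"
      have "x \<notin> W"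
      proof
        assume x: "x \<in> W"
        have "dx bs (\<Phi> \<epsilon>) x = (\<lambda>\<xi>. 1 * dx bs (\<lambda>y \<xi>. complex_of_real (\<rho> y) * \<phi> \<epsilon> y \<xi>) x \<xi> +
            1 * dx bs (\<lambda>y \<xi>. complex_of_real (1 - \<rho> y) * f \<xi>) x \<xi>)"
        proof
          fix \<xi>
          have "pdl bs (\<lambda>y. 1 * (complex_of_real (\<rho> y) * \<phi> \<epsilon> y \<xi>) + 1 * (complex_of_real (1 - \<rho> y) * f \<xi>)) x
            = 1 * pdl bs (\<lambda>y. complex_of_real (\<rho> y) * \<phi> \<epsilon> y \<xi>) x + 1 * pdl bs (\<lambda>y. complex_of_real (1 - \<rho> y) * f \<xi>) x"
            by (rule pdl_lincomb[OF W(2) _ _ x])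
               (use curve_smooth_subset[OF \<rho>1, of W] curve_smooth_subset[OF curve_smooth_of_real[OF \<rho>], of W] slice[OF ex(1)]
                in \<open>auto intro!: curve_smooth_mult curve_smooth_const\<close>)
          then show "dx bs (\<Phi> \<epsilon>) x \<xi> = 1 * dx bs (\<lambda>y \<xi>. complex_of_real (\<rho> y) * \<phi> \<epsilon> y \<xi>) x \<xi> +
            1 * dx bs (\<lambda>y \<xi>. complex_of_real (1 - \<rho> y) * f \<xi>) x \<xi>"
            by (simp add: dx_def \<Phi>_def)
        qed
        moreover have "dx bs (\<lambda>y \<xi>. complex_of_real (\<rho> y) * \<phi> \<epsilon> y \<xi>) x \<in> ?A"
          "dx bs (\<lambda>y \<xi>. complex_of_real (1 - \<rho> y) * f \<xi>) x \<in> ?B" using ex x by blast+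
        moreover have "norm (1::complex) \<le> 1" by simp
        ultimately show False using n by blast
      qed
      then have "dx bs (\<Phi> \<epsilon>) x = dx bs (\<lambda>_. f) x"
        unfolding dx_def using W(1) S(1) off by (intro ext pdl_local[of "- S"]) auto
      then show "\<exists>\<epsilon>' x'. dx bs (\<Phi> \<epsilon>) x = dx bs (\<lambda>_. f) x' \<and> \<epsilon>' \<in> I \<and> x' \<in> \<Omega>" using ex by blast
    qed
  qed
  note bounded = this
  have "bounded_CinfA0 \<Omega> (\<Phi> ` I)"
    unfolding bounded_CinfA0_def
  proof (intro conjI allI impI)
    show "\<forall>g\<in>\<Phi> ` I. CinfA0 \<Omega> g" using C by blast
    fix K and bs :: "'a list" assume K: "compact K \<and> K \<subseteq> \<Omega> \<and> set bs \<subseteq> Basis"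
    show "Dbounded {dx bs g x |g x. g \<in> \<Phi> ` I \<and> x \<in> K}"
      by (rule Dbounded_subset[OF bounded[of bs]]) (use K in blast)+
  qed
  moreover have "\<Phi> = (\<lambda>\<epsilon> y \<xi>. complex_of_real (\<rho> y) * \<phi> \<epsilon> y \<xi> + complex_of_real (1 - \<rho> y) * f \<xi>)"
    by (intro ext) (simp add: \<Phi>_def)
  ultimately show ?thesis by simp
qed

text \<open>Derivatives at points of K see only the germ of the net along K, and the neighbourhood
  in \<open>est\<close> may be shrunk to its intersection with V.\<close>

lemma est_cong:
  assumes "est \<Omega> R \<Phi> \<epsilon> K bs N C" "open V" "K \<subseteq> V" "\<And>y. y \<in> V \<Longrightarrow> \<Phi> y = \<Psi> y"
  shows "est \<Omega> R \<Psi> \<epsilon> K bs N C"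
proof -
  obtain V' where V': "open V'" "K \<subseteq> V'" "V' \<subseteq> \<Omega>" "\<And>y. y \<in> V' \<Longrightarrow> inU \<Omega> (Seps \<epsilon> (\<Phi> y), y)"
    "\<And>x. x \<in> K \<Longrightarrow> norm (pdl bs (\<lambda>y. R (Seps \<epsilon> (\<Phi> y), y)) x) \<le> C / \<epsilon> ^ N"
    using assms(1) unfolding est_def by blast
  have "pdl bs (\<lambda>y. R (Seps \<epsilon> (\<Psi> y), y)) x = pdl bs (\<lambda>y. R (Seps \<epsilon> (\<Phi> y), y)) x" if "x \<in> K" for x
    by (rule pdl_local[OF assms(2)]) (use assms(3,4) that in auto)
  moreover have "inU \<Omega> (Seps \<epsilon> (\<Psi> y), y)" if "y \<in> V' \<inter> V" for y
    using V'(4)[of y] assms(4)[of y] that by simp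
  ultimately show ?thesis
    unfolding est_def using V' assms by (intro exI[of _ "V' \<inter> V"]) (simp add: open_Int le_infI1)
qed

text \<open>(A) is applied to the set of all extended slices, one for each parameter up to
  \<epsilon>0, and then read on the diagonal, where slice parameter and scaling parameter
  agree.\<close>

lemma condA_imp_condZ:
  fixes \<Omega> :: "'a::euclidean_space set"
  assumes "open \<Omega>" "condA \<Omega> R"
  shows "condZ \<Omega> R"
  unfolding condZ_def
proof (intro allI impI)
  fix K and bs :: "'a list" assume K: "compact K \<and> K \<subseteq> \<Omega> \<and> set bs \<subseteq> Basis"
  from assms(2)[unfolded condA_def, rule_format, OF K]
  obtain N where N: "\<And>B. bounded_CinfA0 \<Omega> B \<Longrightarrow>
      \<exists>C \<eta>. C > 0 \<and> \<eta> > 0 \<and> (\<forall>\<phi>\<in>B. \<forall>\<epsilon>\<in>{0<..<\<eta>}. est \<Omega> R \<phi> \<epsilon> K bs N C)" by blast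
  obtain \<rho> :: "'a \<Rightarrow> real" and V S W L where cut: "curve_smooth UNIV \<rho>" "open V" "K \<subseteq> V"
    "\<And>x. x \<in> V \<Longrightarrow> \<rho> x = 1" "closed S" "\<And>x. x \<notin> S \<Longrightarrow> \<rho> x = 0" "V \<subseteq> S" "S \<subseteq> W" "open W" "W \<subseteq> L"
    "compact L" "L \<subseteq> \<Omega>"
    by (rule smooth_cutoff[of K \<Omega>]) (use K assms(1) in auto)
  show "\<exists>N. \<forall>D \<phi>. D \<subseteq> {0<..1} \<times> \<Omega> \<and> (\<forall>p\<in>D. A0 (\<phi> p)) \<and>
        (\<forall>L. compact L \<and> L \<subseteq> \<Omega> \<longrightarrow>
           (\<exists>\<epsilon>0>0. \<exists>U. U \<subseteq> D \<and> openin (top_of_set ({0<..1} \<times> \<Omega>)) U \<and>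
              {0<..\<epsilon>0} \<times> L \<subseteq> U \<and> smooth_on_set U \<phi> \<and>
              (\<forall>bs'. set bs' \<subseteq> Basis \<longrightarrow>
                 Dbounded {dx bs' (\<lambda>y. \<phi> (\<epsilon>, y)) x | \<epsilon> x. \<epsilon> \<in> {0<..\<epsilon>0} \<and> x \<in> L})))
        \<longrightarrow> (\<exists>C \<eta>. C > 0 \<and> \<eta> > 0 \<and>
              (\<forall>\<epsilon>\<in>{0<..<\<eta>}. (\<forall>x\<in>K. (\<epsilon>, x) \<in> D) \<and>
                 (\<exists>V. open V \<and> K \<subseteq> V \<and> (\<forall>y\<in>V. (\<epsilon>, y) \<in> D) \<and>
                      est \<Omega> R (\<lambda>y. \<phi> (\<epsilon>, y)) \<epsilon> K bs N C)))"
  proof (rule exI[of _ N], intro allI impI, elim conjE)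
    fix D and \<phi> :: "real \<times> 'a \<Rightarrow> 'a \<Rightarrow> complex"
    assume D: "D \<subseteq> {0<..1} \<times> \<Omega>" "\<forall>p\<in>D. A0 (\<phi> p)" and
      net: "\<forall>L. compact L \<and> L \<subseteq> \<Omega> \<longrightarrow>
           (\<exists>\<epsilon>0>0. \<exists>U. U \<subseteq> D \<and> openin (top_of_set ({0<..1} \<times> \<Omega>)) U \<and>
              {0<..\<epsilon>0} \<times> L \<subseteq> U \<and> smooth_on_set U \<phi> \<and>
              (\<forall>bs'. set bs' \<subseteq> Basis \<longrightarrow>
                 Dbounded {dx bs' (\<lambda>y. \<phi> (\<epsilon>, y)) x | \<epsilon> x. \<epsilon> \<in> {0<..\<epsilon>0} \<and> x \<in> L}))"
    show "\<exists>C \<eta>. C > 0 \<and> \<eta> > 0 \<and> (\<forall>\<epsilon>\<in>{0<..<\<eta>}. (\<forall>x\<in>K. (\<epsilon>, x) \<in> D) \<and>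
        (\<exists>V. open V \<and> K \<subseteq> V \<and> (\<forall>y\<in>V. (\<epsilon>, y) \<in> D) \<and> est \<Omega> R (\<lambda>y. \<phi> (\<epsilon>, y)) \<epsilon> K bs N C))"
    \<comment> \<open>An empty K provides no base point in L, but then V = {} satisfies
      everything.\<close>
    proof (cases "K = {}")
      case True
      then show ?thesis by (intro exI[of _ 1]) (auto simp: est_def intro!: exI[of _ "{}"])
    next
      case False
      then obtain x0 where x0: "x0 \<in> L" using cut by blast
      \<comment> \<open>The hypothesis is used for the compact neighbourhood L instead of K, because
        the estimate involves the net near K.\<close>
      from net[rule_format, OF conjI[OF cut(11,12)]]
      obtain \<epsilon>0 U where U: "\<epsilon>0 > 0" "U \<subseteq> D" "{0<..\<epsilon>0} \<times> L \<subseteq> U" "smooth_on_set U \<phi>"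
        and bd: "\<And>bs'. set bs' \<subseteq> Basis \<Longrightarrow>
          Dbounded {dx bs' (\<lambda>y. \<phi> (\<epsilon>, y)) x | \<epsilon> x. \<epsilon> \<in> {0<..\<epsilon>0} \<and> x \<in> L}"
        by blast
      obtain X \<psi> where \<psi>: "U \<subseteq> X" "smoothD X UNIV \<psi>" "\<And>p. p \<in> U \<Longrightarrow> \<psi> p = \<phi> p"
        using U(4) unfolding smooth_on_set_def by blast
      have memU: "(\<epsilon>, x) \<in> U" if "\<epsilon> \<in> {0<..\<epsilon>0}" "x \<in> L" for \<epsilon> x using that U(3) by blast
      have sm: "curve_smooth (W \<times> UNIV) (\<lambda>p. \<phi> (\<epsilon>, fst p) (snd p))" if \<epsilon>: "\<epsilon> \<in> {0<..\<epsilon>0}" for \<epsilon>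
      proof (rule curve_smooth_cong)
        show "\<psi> (\<epsilon>, fst p) (snd p) = \<phi> (\<epsilon>, fst p) (snd p)" if "p \<in> W \<times> UNIV" for p
          using that memU[OF \<epsilon>] cut(10) by (subst \<psi>(3)) (auto simp: mem_Times_iff)
        show "curve_smooth (W \<times> UNIV) (\<lambda>p. \<psi> (\<epsilon>, fst p) (snd p))"
        proof (rule curve_smoothI)
          fix c :: "real \<Rightarrow> 'a \<times> 'a" assume c: "smooth_curve c" "\<And>t. c t \<in> W \<times> UNIV"
          have "((\<epsilon>, fst (c t)), snd (c t)) \<in> X \<times> UNIV" for t
            using c(2)[of t] memU[OF \<epsilon>] \<psi>(1) cut(10) by (auto simp: mem_Times_iff)
          moreover have "curve_smooth (X \<times> UNIV) (\<lambda>p. \<psi> (fst p) (snd p))" using \<psi>(2) by (simp add: smoothD_iff)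
          moreover have "smooth_curve (\<lambda>t. ((\<epsilon>, fst (c t)), snd (c t)))"
            by (intro smooth_curve_Pair smooth_curve_const smooth_curve_fst smooth_curve_snd c)
          ultimately show "smooth_curve (\<lambda>t. \<psi> (\<epsilon>, fst (c t)) (snd (c t)))"
            using curve_smoothD[of "X \<times> UNIV" "\<lambda>p. \<psi> (fst p) (snd p)" "\<lambda>t. ((\<epsilon>, fst (c t)), snd (c t))"] by simp
        qed
      qed
      have A0: "A0 (\<phi> (\<epsilon>, x))" if "\<epsilon> \<in> {0<..\<epsilon>0}" "x \<in> L" for \<epsilon> x
        using memU[OF that] U(2) D(2) by blast
      have \<epsilon>0: "\<epsilon>0 \<in> {0<..\<epsilon>0}" using U(1) by simp
      \<comment> \<open>A value of the net itself serves as the fixed function f, so no element of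
        A_0 has to be constructed; its boundedness is inherited from the net.\<close>
      have f: "Dbounded {\<phi> (\<epsilon>0, x0)}"
      proof (rule Dbounded_subset[OF bd[of "[]"]])
        have "\<phi> (\<epsilon>0, x0) = dx [] (\<lambda>y. \<phi> (\<epsilon>0, y)) x0" by (simp add: dx_def)
        then show "{\<phi> (\<epsilon>0, x0)} \<subseteq> {dx [] (\<lambda>y. \<phi> (\<epsilon>, y)) x |\<epsilon> x. \<epsilon> \<in> {0<..\<epsilon>0} \<and> x \<in> L}"
          using \<epsilon>0 x0 by blast
      qed simp
      let ?\<Phi> = "\<lambda>\<epsilon> y \<xi>. complex_of_real (\<rho> y) * \<phi> (\<epsilon>, y) \<xi> + complex_of_real (1 - \<rho> y) * \<phi> (\<epsilon>0, x0) \<xi>"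
      have "bounded_CinfA0 \<Omega> (?\<Phi> ` {0<..\<epsilon>0})"
        by (rule extend_net[OF assms(1) cut(1,5,6,8,9,10,11,12), where \<phi> = "\<lambda>\<epsilon> y. \<phi> (\<epsilon>, y)"])
           (assumption | rule sm A0 bd f \<epsilon>0 x0)+
      from N[OF this] obtain C \<eta> where C: "C > 0" "\<eta> > 0"
        "\<And>\<epsilon> \<epsilon>'. \<epsilon> \<in> {0<..\<epsilon>0} \<Longrightarrow> \<epsilon>' \<in> {0<..<\<eta>} \<Longrightarrow> est \<Omega> R (?\<Phi> \<epsilon>) \<epsilon>' K bs N C" by blast
      have VL: "V \<subseteq> L" using cut by blast
      have "est \<Omega> R (\<lambda>y. \<phi> (\<epsilon>, y)) \<epsilon> K bs N C" if "\<epsilon> \<in> {0<..<min \<eta> \<epsilon>0}" for \<epsilon>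
      proof (rule est_cong[OF _ cut(2,3)])
        show "est \<Omega> R (?\<Phi> \<epsilon>) \<epsilon> K bs N C" by (rule C(3)) (use that in auto)
      qed (simp add: cut(4))
      moreover have "(\<epsilon>, y) \<in> D" if "\<epsilon> \<in> {0<..<min \<eta> \<epsilon>0}" "y \<in> V" for \<epsilon> y
        using memU[of \<epsilon> y] that VL U(2) by auto
      ultimately have "(\<forall>x\<in>K. (\<epsilon>, x) \<in> D) \<and> (\<exists>V. open V \<and> K \<subseteq> V \<and> (\<forall>y\<in>V. (\<epsilon>, y) \<in> D) \<and>
          est \<Omega> R (\<lambda>y. \<phi> (\<epsilon>, y)) \<epsilon> K bs N C)" if "\<epsilon> \<in> {0<..<min \<eta> \<epsilon>0}" for \<epsilon>
        using that cut(2,3) by blast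
      moreover have "min \<eta> \<epsilon>0 > 0" using C(2) U(1) by simp
      ultimately show ?thesis using C(1) by blast
    qed
  qed
qed

section \<open>The remaining implications\<close>

lemma condZ_imp_condC:
  assumes "condZ \<Omega> R"
  shows "condC \<Omega> R"
  unfolding condC_def cond_net_def
proof (intro allI impI)
  fix K and bs :: "'a list" assume K: "compact K \<and> K \<subseteq> \<Omega> \<and> set bs \<subseteq> Basis"
  from assms[unfolded condZ_def, rule_format, OF K] obtain N where
    N: "\<forall>D \<phi>. D \<subseteq> {0<..1} \<times> \<Omega> \<and> (\<forall>p\<in>D. A0 (\<phi> p)) \<and>
        (\<forall>L. compact L \<and> L \<subseteq> \<Omega> \<longrightarrow>
           (\<exists>\<epsilon>0>0. \<exists>U. U \<subseteq> D \<and> openin (top_of_set ({0<..1} \<times> \<Omega>)) U \<and>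
              {0<..\<epsilon>0} \<times> L \<subseteq> U \<and> smooth_on_set U \<phi> \<and>
              (\<forall>bs'. set bs' \<subseteq> Basis \<longrightarrow>
                 Dbounded {dx bs' (\<lambda>y. \<phi> (\<epsilon>, y)) x | \<epsilon> x. \<epsilon> \<in> {0<..\<epsilon>0} \<and> x \<in> L})))
        \<longrightarrow> (\<exists>C \<eta>. C > 0 \<and> \<eta> > 0 \<and>
              (\<forall>\<epsilon>\<in>{0<..<\<eta>}. (\<forall>x\<in>K. (\<epsilon>, x) \<in> D) \<and>
                 (\<exists>V. open V \<and> K \<subseteq> V \<and> (\<forall>y\<in>V. (\<epsilon>, y) \<in> D) \<and>
                      est \<Omega> R (\<lambda>y. \<phi> (\<epsilon>, y)) \<epsilon> K bs N C)))"
    by (elim exE)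
  show "\<exists>N. \<forall>\<phi>. Cb_smooth \<Omega> \<phi> \<longrightarrow>
      (\<exists>C \<eta>. C > 0 \<and> \<eta> > 0 \<and> (\<forall>\<epsilon>\<in>{0<..<\<eta>}. est \<Omega> R (\<lambda>y. \<phi> (\<epsilon>, y)) \<epsilon> K bs N C))"
  proof (rule exI[of _ N], intro allI impI)
    fix \<phi> assume \<phi>: "Cb_smooth \<Omega> \<phi>"
    \<comment> \<open>A global net satisfies the hypothesis of (Z) with D = U = (0, 1] x \<Omega>
      and \<epsilon>0 = 1, whatever L is.\<close>
    have "(\<exists>\<epsilon>0>0. \<exists>U. U \<subseteq> {0<..1} \<times> \<Omega> \<and> openin (top_of_set ({0<..1} \<times> \<Omega>)) U \<and>
              {0<..\<epsilon>0} \<times> L \<subseteq> U \<and> smooth_on_set U \<phi> \<and>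
              (\<forall>bs'. set bs' \<subseteq> Basis \<longrightarrow>
                 Dbounded {dx bs' (\<lambda>y. \<phi> (\<epsilon>, y)) x | \<epsilon> x. \<epsilon> \<in> {0<..\<epsilon>0} \<and> x \<in> L}))"
      if "compact L" "L \<subseteq> \<Omega>" for L
      using \<phi> that unfolding Cb_smooth_def Cb_weak_def
      by (intro exI[of _ "1::real"] conjI exI[of _ "{0<..1} \<times> \<Omega>"]) auto
    moreover have "\<forall>p\<in>{0<..1} \<times> \<Omega>. A0 (\<phi> p)"
      using \<phi> by (auto simp: Cb_smooth_def Cb_weak_def CinfA0_def)
    ultimately have "\<exists>C \<eta>. C > 0 \<and> \<eta> > 0 \<and>
              (\<forall>\<epsilon>\<in>{0<..<\<eta>}. (\<forall>x\<in>K. (\<epsilon>, x) \<in> {0<..1} \<times> \<Omega>) \<and>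
                 (\<exists>V. open V \<and> K \<subseteq> V \<and> (\<forall>y\<in>V. (\<epsilon>, y) \<in> {0<..1} \<times> \<Omega>) \<and>
                      est \<Omega> R (\<lambda>y. \<phi> (\<epsilon>, y)) \<epsilon> K bs N C))"
      by (intro N[rule_format]) auto
    then show "\<exists>C \<eta>. C > 0 \<and> \<eta> > 0 \<and> (\<forall>\<epsilon>\<in>{0<..<\<eta>}. est \<Omega> R (\<lambda>y. \<phi> (\<epsilon>, y)) \<epsilon> K bs N C)" by blast
  qed
qed

lemma cond_net_mono:
  assumes "\<And>K \<phi>. compact K \<Longrightarrow> K \<subseteq> \<Omega> \<Longrightarrow> P K \<phi> \<Longrightarrow> Q K \<phi>" "cond_net Q \<Omega> R"
  shows "cond_net P \<Omega> R"
  unfolding cond_net_def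
proof (intro allI impI)
  fix K and bs :: "'a list" assume K: "compact K \<and> K \<subseteq> \<Omega> \<and> set bs \<subseteq> Basis"
  from assms(2)[unfolded cond_net_def, rule_format, OF K]
  show "\<exists>N. \<forall>\<phi>. P K \<phi> \<longrightarrow> (\<exists>C \<eta>. C > 0 \<and> \<eta> > 0 \<and> (\<forall>\<epsilon>\<in>{0<..<\<eta>}. est \<Omega> R (\<lambda>y. \<phi> (\<epsilon>, y)) \<epsilon> K bs N C))"
    using assms(1) K by meson
qed

text \<open>The slices of a net form one bounded set, since its bounds are uniform in the parameter;
  (A) for this set is read on the diagonal. Taking the minimum with 1 keeps to parameters whose
  slice belongs to the set.\<close>

lemma condA_imp_condB:
  assumes "condA \<Omega> R"
  shows "condB \<Omega> R"
  unfolding condB_def cond_net_def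
proof (intro allI impI)
  fix K and bs :: "'a list" assume K: "compact K \<and> K \<subseteq> \<Omega> \<and> set bs \<subseteq> Basis"
  from assms[unfolded condA_def, rule_format, OF K]
  obtain N where N: "\<And>B. bounded_CinfA0 \<Omega> B \<Longrightarrow>
      \<exists>C \<eta>. C > 0 \<and> \<eta> > 0 \<and> (\<forall>\<phi>\<in>B. \<forall>\<epsilon>\<in>{0<..<\<eta>}. est \<Omega> R \<phi> \<epsilon> K bs N C)" by blast
  show "\<exists>N. \<forall>\<phi>. Cb_weak \<Omega> \<phi> \<longrightarrow>
      (\<exists>C \<eta>. C > 0 \<and> \<eta> > 0 \<and> (\<forall>\<epsilon>\<in>{0<..<\<eta>}. est \<Omega> R (\<lambda>y. \<phi> (\<epsilon>, y)) \<epsilon> K bs N C))"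
  proof (rule exI[of _ N], intro allI impI)
    fix \<phi> assume \<phi>: "Cb_weak \<Omega> \<phi>"
    let ?B = "(\<lambda>\<epsilon> y. \<phi> (\<epsilon>, y)) ` {0<..1}"
    have "{dx as f x |f x. f \<in> ?B \<and> x \<in> L} = {dx as (\<lambda>y. \<phi> (\<epsilon>, y)) x |\<epsilon> x. \<epsilon> \<in> {0<..1} \<and> x \<in> L}" for as L
      by blast
    then have "bounded_CinfA0 \<Omega> ?B" using \<phi> by (auto simp: bounded_CinfA0_def Cb_weak_def)
    from N[OF this] obtain C \<eta> where C: "C > 0" "\<eta> > 0"
      "\<And>\<epsilon> \<epsilon>'. \<epsilon> \<in> {0<..1} \<Longrightarrow> \<epsilon>' \<in> {0<..<\<eta>} \<Longrightarrow> est \<Omega> R (\<lambda>y. \<phi> (\<epsilon>, y)) \<epsilon>' K bs N C" by blast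
    then show "\<exists>C \<eta>. C > 0 \<and> \<eta> > 0 \<and> (\<forall>\<epsilon>\<in>{0<..<\<eta>}. est \<Omega> R (\<lambda>y. \<phi> (\<epsilon>, y)) \<epsilon> K bs N C)"
      by (intro exI[of _ C] exI[of _ "min \<eta> 1"]) auto
  qed
qed

text \<open>Over L all supports lie in one ball of radius b, and every point within distance d of L
  is in \<Omega>. So \<open>d / (2 * b)\<close> works for the whole net, the 2 making the inequality
  strict.\<close>

lemma Cb_weak_inUdelta:
  fixes \<Omega> :: "'a::euclidean_space set"
  assumes "open \<Omega>" "Cb_weak \<Omega> \<phi>" "compact L" "L \<subseteq> \<Omega>"
  shows "\<exists>\<delta>0>0. \<forall>\<epsilon>\<in>{0<..1}. \<forall>x\<in>L. \<forall>\<delta>. 0 < \<delta> \<and> \<delta> \<le> \<delta>0 \<longrightarrow> inUdelta \<Omega> \<delta> (\<phi> (\<epsilon>, x), x)"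
proof -
  let ?A = "{dx [] (\<lambda>y. \<phi> (\<epsilon>, y)) x |\<epsilon> x. \<epsilon> \<in> {0<..1} \<and> x \<in> L}"
  have "\<forall>K bs. compact K \<and> K \<subseteq> \<Omega> \<and> set bs \<subseteq> Basis \<longrightarrow>
      Dbounded {dx bs (\<lambda>y. \<phi> (\<epsilon>, y)) x |\<epsilon> x. \<epsilon> \<in> {0<..1} \<and> x \<in> K}"
    using assms(2) by (simp add: Cb_weak_def)
  then have "Dbounded ?A" using assms(3,4) by (elim allE[of _ L] allE[of _ "[]"]) simp
  then obtain M where M: "compact M" "\<And>f. f \<in> ?A \<Longrightarrow> supp f \<subseteq> M"
    by (rule Dbounded_supp) (rule that)
  obtain d where d: "d > 0" "\<And>x y. x \<in> L \<Longrightarrow> dist x y < d \<Longrightarrow> y \<in> \<Omega>"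
    using compact_subset_open_radius[OF assms(3,1,4)] by metis
  obtain b where b: "b > 0" "\<And>\<xi>. \<xi> \<in> M \<Longrightarrow> norm \<xi> \<le> b"
    using compact_imp_bounded[OF M(1)] bounded_pos by metis
  have "inUdelta \<Omega> \<delta> (\<phi> (\<epsilon>, x), x)"
    if "\<epsilon> \<in> {0<..1}" "x \<in> L" "0 < \<delta>" "\<delta> \<le> d / (2 * b)" for \<epsilon> x \<delta>
  proof (rule inUdelta_if_small_supp)
    show "A0 (\<phi> (\<epsilon>, x))" using assms(2,4) that by (auto simp: Cb_weak_def CinfA0_def)
    have "dx [] (\<lambda>y. \<phi> (\<epsilon>, y)) x \<in> ?A" using that by blast
    then have "supp (dx [] (\<lambda>y. \<phi> (\<epsilon>, y)) x) \<subseteq> M" by (rule M(2))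
    then have supp: "supp (\<phi> (\<epsilon>, x)) \<subseteq> M" by (simp add: dx_def)
    fix \<xi> assume "\<xi> \<in> supp (\<phi> (\<epsilon>, x))"
    then have "norm \<xi> \<le> b" using supp b by blast
    then have "\<delta> * norm \<xi> \<le> d / (2 * b) * b" using that b d by (intro mult_mono) auto
    then have "\<delta> * norm \<xi> < d" using b d by simp
    then show "x + \<delta> *\<^sub>R \<xi> \<in> \<Omega>" using that by (intro d(2)[OF that(2)]) (simp add: dist_norm)
  qed (use that assms in auto)
  then show ?thesis using b d by (intro exI[of _ "d / (2 * b)"]) auto
qed

theorem theorem10p5:
  fixes \<Omega> :: "'a::euclidean_space set"
    and R :: "('a \<Rightarrow> complex) \<times> 'a \<Rightarrow> complex"
  assumes "open \<Omega>"
    and "Ealg \<Omega> R"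
  shows "(condA \<Omega> R \<longleftrightarrow> condB \<Omega> R) \<and> (condB \<Omega> R \<longleftrightarrow> condC \<Omega> R) \<and>
         (condC \<Omega> R \<longleftrightarrow> condD \<Omega> R) \<and> (condD \<Omega> R \<longleftrightarrow> condE \<Omega> R) \<and>
         (condE \<Omega> R \<longleftrightarrow> condZ \<Omega> R)"
proof -
  \<comment> \<open>The implications form the cycle A, B, C, D, A; E is tied to C in both
    directions, and Z sits between A and C.\<close>
  have "condA \<Omega> R \<Longrightarrow> condB \<Omega> R" by (rule condA_imp_condB)
  moreover have "condB \<Omega> R \<Longrightarrow> condC \<Omega> R"
    unfolding condB_def condC_def by (erule cond_net_mono[rotated]) (simp add: Cb_smooth_def)
  moreover have "condC \<Omega> R \<Longrightarrow> condD \<Omega> R"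
    unfolding condC_def condD_def by (erule cond_net_mono[rotated]) simp
  moreover have "condD \<Omega> R \<Longrightarrow> condA \<Omega> R" by (rule condD_imp_condA[OF assms(1)])
  moreover have "condC \<Omega> R \<Longrightarrow> condE \<Omega> R"
    unfolding condC_def condE_def by (erule cond_net_mono[rotated]) simp
  moreover have "condE \<Omega> R \<Longrightarrow> condC \<Omega> R"
    unfolding condC_def condE_def
    by (erule cond_net_mono[rotated]) (use Cb_weak_inUdelta[OF assms(1)] in \<open>auto simp: Cb_smooth_def\<close>)
  moreover have "condA \<Omega> R \<Longrightarrow> condZ \<Omega> R" by (rule condA_imp_condZ[OF assms(1)])
  moreover have "condZ \<Omega> R \<Longrightarrow> condC \<Omega> R" by (rule condZ_imp_condC)
  ultimately show ?thesis by blast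
qed

end
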